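(* Let $D$ be a definite quaternion algebra over $\mathbb{Q}$ split at $p$ with a neat tame level $K^p$, and let $t=\#\,D^\times\backslash(D\otimes\mathbb{A}_f)^\times/K^p\mathrm{Iw}_q$. Let $P=(P_{m,n})_{m,n\in\mathbb{Z}_{\ge0}}$ denote the infinite matrix (with entries in $\Lambda$) of the $U_p$-action on $S^D_{\mathrm{int}}\cong\bigoplus_{i=0}^{t-1}\mathcal{C}(\mathbb{Z}_p;\Lambda)$ with respect to the basis $$1_0,\dots,1_{t-1},\,z_0,\dots,z_{t-1},\,\tbinom{z_0}2,\dots,\tbinom{z_{t-1}}2,\dots,$$ where the subscript $i$ indicates that the function lies in the $i$-th direct summand. Then the characteristic power series $$\mathrm{Char}(P):=\lim_{n\to\infty}\det\big(1-X(P_{i,j})_{i,j=0,\dots,n-1}\big)=\sum_{n\ge0}c_nX^n\in\Lambda[[X]]$$ is well defined (the limit exists). Moreover, $$c_n\in T^{\lambda(n)}\cdot\Lambda^{>1/p}\qquad\text{for }n\in\mathbb{Z}_{\ge0},$$ where $\lambda(0)=0,\lambda(1),\dots$ is the sequence of integers determined by $$\lambda(i+1)-\lambda(i)=\Big\lfloor\frac it\Big\rfloor-\Big\lfloor\frac i{pt}\Big\rfloor.$$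
   Context: $p$ is a prime; $q=p$ if $p$ is odd, $q=4$ if $p=2$. $\Delta\cong(\mathbb{Z}/q)^\times$ is the torsion subgroup of $\mathbb{Z}_p^\times$. $\Lambda=\mathbb{Z}_p[[\mathbb{Z}_p^\times]]\cong\mathbb{Z}_p[\Delta]\otimes_{\mathbb{Z}_p}\mathbb{Z}_p[[T]]$ with $T=[\exp(q)]-1$, where $[-]:\mathbb{Z}_p^\times\to\Lambda^\times$ is the universal character; $\mathfrak{m}_\Lambda=(p,T)$, and $\Lambda$, $\Lambda[[X]]$ carry the $\mathfrak{m}_\Lambda$-adic topology. $\Lambda^{>1/p}=\Lambda[[pT^{-1}]]=\mathbb{Z}_p[[T,pT^{-1}]]\otimes_{\mathbb{Z}_p}\mathbb{Z}_p[\Delta]$. $D$ is a definite quaternion algebra over $\mathbb{Q}$ with a fixed isomorphism $D\otimes\mathbb{Q}_p\cong M_2(\mathbb{Q}_p)$; $\mathrm{Iw}_q=\begin{pmatrix}\mathbb{Z}_p^\times & \mathbb{Z}_p \\ q\mathbb{Z}_p & \mathbb{Z}_p^\times\end{pmatrix}$; the tame level $K^p$ is an open compact subgroup of $(D\otimes\mathbb{A}_f^{(p)})^\times$, *neat* meaning $x^{-1}D^\times x\cap K^p\mathrm{Iw}_q=\{1\}$ for all $x\in(D\otimes\mathbb{A}_f)^\times$. Let $\mathcal{C}(\mathbb{Z}_p;\Lambda)$ be the space of continuous functions $\mathbb{Z}_p\to\Lambda$. The monoid $\mathbf{M}_1$ of matrices $g=\begin{pmatrix}a & b \\ c & d\end{pmatrix}\in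 M_2(\mathbb{Z}_p)$ with $q\mid c$, $p\nmid d$, $ad-bc\ne0$ acts on it on the right by $(h\|^{[-]}_g)(z)=[cz+d]\,h\big(\tfrac{az+b}{cz+d}\big)$. The space of integral $p$-adic automorphic forms is $$S^D_{\mathrm{int}}=\{\phi:D^\times\backslash(D\otimes\mathbb{A}_f)^\times/K^p\to\mathcal{C}(\mathbb{Z}_p;\Lambda)\mid\phi(xu)=\phi(x)\|^{[-]}_u\ \forall u\in\mathrm{Iw}_q\},$$ with $U_p(\phi)(g)=\sum_{j=0}^{p-1}\phi(gv_j^{-1})\|^{[-]}_{v_j}$, $v_j=\begin{pmatrix}p & 0 \\ jq & 1\end{pmatrix}$ (placed at $p$). Choose representatives: $(D\otimes\mathbb{A}_f)^\times=\coprod_{i=0}^{t-1}D^\times\gamma_iK^p\mathrm{Iw}_q$ with each $\gamma_i$ having $p$-component $1$. Evaluation $\phi\mapsto(\phi(\gamma_i))_i$ gives $S^D_{\mathrm{int}}\cong\bigoplus_{i=0}^{t-1}\mathcal{C}(\mathbb{Z}_p;\Lambda)$. The displayed functions form an orthonormal basis (Mahler basis in each summand). The $n$-th column of $P$ consists of the coefficients of $U_p$ applied to the $n$-th basis vector; indices start at $0$. *)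

theory Defs
  imports
    Complex_Main
    "HOL-Library.FuncSet"
    "HOL-Algebra.QuotRing"
    "HOL-Computational_Algebra.Formal_Power_Series"
    "HOL-Computational_Algebra.Fraction_Field"
    "Jordan_Normal_Form.Determinant"
    "Berlekamp_Zassenhaus.Finite_Field"
begin

text \<open>
  The prime $p$ is the cardinality of a type of class \<^class>\<open>prime_card\<close>.
\<close>

abbreviation prm :: "'p::prime_card itself \<Rightarrow> nat" where
  "prm (_ :: 'p itself) \<equiv> CARD('p)"

text \<open>The number $q$.\<close>

definition lev :: "'p::prime_card itself \<Rightarrow> nat" where
  "lev P = (if prm P = 2 then 4 else prm P)"

lemma prime_prm: "prime (CARD('p::prime_card))"
  by (rule prime_card)

lemma prm_gt_1: "CARD('p::prime_card) > 1"
  using prime_prm prime_gt_1_nat by blast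

section \<open>The p-adic integers\<close>

typedef (overloaded) 'p padic_int =
  "{x :: nat \<Rightarrow> int. \<forall>n. x (Suc n) mod int (CARD('p::prime_card)) ^ n = x n}"
  morphisms residue Abs_padic_int
  by (rule exI[of _ "\<lambda>_. 0"]) auto

setup_lifting type_definition_padic_int

lemma residue_Suc:
  "residue (x::'p::prime_card padic_int) (Suc n) mod int (CARD('p)) ^ n = residue x n"
  using residue[of x] by auto

lemma residue_mod [simp]:
  "residue (x::'p::prime_card padic_int) n mod int (CARD('p)) ^ n = residue x n"
  by (metis residue_Suc mod_mod_trivial)

lemma residue_le:
  assumes "m \<le> n"
  shows "residue (x::'p::prime_card padic_int) n mod int (CARD('p)) ^ m = residue x m"
  using assms
proof (induction n rule: dec_induct)
  case base
  show ?case by simp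
next
  case (step n)
  have "int (CARD('p)) ^ m dvd int (CARD('p)) ^ n"
    using step.hyps by (intro le_imp_power_dvd) simp
  then have "residue x (Suc n) mod int (CARD('p)) ^ m
      = residue x (Suc n) mod int (CARD('p)) ^ n mod int (CARD('p)) ^ m"
    by (simp add: mod_mod_cancel)
  then show ?case using step.IH by (simp add: residue_Suc)
qed

instantiation padic_int :: (prime_card) comm_ring_1
begin

lift_definition zero_padic_int :: "'a padic_int" is "\<lambda>_. 0" by simp

lift_definition one_padic_int :: "'a padic_int" is "\<lambda>n. 1 mod int (CARD('a)) ^ n"
  by (simp add: mod_mod_cancel)

lift_definition plus_padic_int :: "'a padic_int \<Rightarrow> 'a padic_int \<Rightarrow> 'a padic_int"
  is "\<lambda>x y n. (x n + y n) mod int (CARD('a)) ^ n"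
  by (simp add: mod_mod_cancel) (metis mod_add_eq)

lift_definition times_padic_int :: "'a padic_int \<Rightarrow> 'a padic_int \<Rightarrow> 'a padic_int"
  is "\<lambda>x y n. (x n * y n) mod int (CARD('a)) ^ n"
  by (simp add: mod_mod_cancel) (metis mod_mult_eq)

lift_definition uminus_padic_int :: "'a padic_int \<Rightarrow> 'a padic_int"
  is "\<lambda>x n. (- x n) mod int (CARD('a)) ^ n"
  by (simp add: mod_mod_cancel) (metis mod_minus_eq)

lift_definition minus_padic_int :: "'a padic_int \<Rightarrow> 'a padic_int \<Rightarrow> 'a padic_int"
  is "\<lambda>x y n. (x n - y n) mod int (CARD('a)) ^ n"
  by (simp add: mod_mod_cancel) (metis mod_diff_eq)

instance
proof
  fix a b c :: "'a padic_int"
  show "a * b * c = a * (b * c)"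
    by (transfer, rule ext) (simp add: mod_mult_left_eq mod_mult_right_eq ac_simps)
  show "a * b = b * a" by transfer (simp add: ac_simps)
  show "1 * a = a" by (transfer, rule ext) (simp add: mod_mult_left_eq, metis mod_mod_trivial)
  show "a + b + c = a + (b + c)"
    by (transfer, rule ext) (simp add: mod_add_left_eq mod_add_right_eq ac_simps)
  show "a + b = b + a" by transfer (simp add: ac_simps)
  show "0 + a = a" by (transfer, rule ext) (simp, metis mod_mod_trivial)
  show "- a + a = 0" by (transfer, rule ext) (simp add: mod_add_left_eq)
  show "a - b = a + - b" by (transfer, rule ext) (simp add: mod_add_right_eq)
  show "(a + b) * c = a * c + b * c"
    by (transfer, rule ext) (simp add: mod_mult_left_eq mod_add_eq distrib_right)
  show "(0::'a padic_int) \<noteq> 1"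
  proof transfer
    have "(1::int) mod int (CARD('a)) ^ 1 = 1" using prm_gt_1[where 'p='a] by simp
    then show "(\<lambda>_::nat. 0::int) \<noteq> (\<lambda>n. 1 mod int (CARD('a)) ^ n)"
      by (metis zero_neq_one)
  qed
qed

end

lemma residue_of_nat: "residue (of_nat k :: 'p::prime_card padic_int) n = int k mod int (CARD('p)) ^ n"
proof (induction k)
  case 0
  show ?case by (simp add: zero_padic_int.rep_eq)
next
  case (Suc k)
  then show ?case
    by (simp add: plus_padic_int.rep_eq one_padic_int.rep_eq mod_add_eq add.commute)
qed

lemma padic_int_eq_0_iff: "(x::'p::prime_card padic_int) = 0 \<longleftrightarrow> (\<forall>n. residue x n = 0)"
  by transfer auto

instance padic_int :: (prime_card) ring_char_0
proof
  show "inj (of_nat :: nat \<Rightarrow> 'a padic_int)"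
  proof (rule injI)
    fix k l assume eq: "(of_nat k :: 'a padic_int) = of_nat l"
    define n where "n = k + l"
    have "n < CARD('a) ^ n" using prm_gt_1[where 'p='a] by (intro power_gt_expt) simp
    then have "int k < int (CARD('a)) ^ n" "int l < int (CARD('a)) ^ n"
      unfolding n_def by (metis add_lessD1 of_nat_less_iff of_nat_power,
        metis add.commute add_lessD1 of_nat_less_iff of_nat_power)
    moreover have "int k mod int (CARD('a)) ^ n = int l mod int (CARD('a)) ^ n"
      using residue_of_nat eq by metis
    ultimately show "k = l" by simp
  qed
qed

instance padic_int :: (prime_card) idom
proof
  fix x y :: "'a padic_int"
  assume "x \<noteq> 0" "y \<noteq> 0"
  then obtain m n where m: "residue x m \<noteq> 0" and n: "residue y n \<noteq> 0"
    unfolding padic_int_eq_0_iff by blast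
  define N where "N = m + n"
  let ?p = "int (CARD('a))"
  have p: "prime_elem ?p" using prime_prm[where 'p='a] by simp
  have "\<not> ?p ^ m dvd residue x N" "\<not> ?p ^ n dvd residue y N"
    using m n residue_le[of m N x] residue_le[of n N y] unfolding N_def
    by (auto simp: dvd_eq_mod_eq_0)
  moreover have "m > 0"
    using m residue_mod[of x m] by (cases m) auto
  ultimately have "\<not> ?p ^ N dvd residue x N * residue y N"
    using prime_elem_power_dvd_cases[of ?p "N" "residue x N" "residue y N" m "Suc n"] 
      prime_elem_power_dvd_cases[of ?p "N - 1" "residue x N" "residue y N" m "n"] p
    unfolding N_def by (metis Suc_pred' add_gr_0 le_imp_power_dvd diff_le_self dvd_trans)
  then have "residue (x * y) N \<noteq> 0"
    by (simp add: times_padic_int.rep_eq dvd_eq_mod_eq_0)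
  then show "x * y \<noteq> 0" unfolding padic_int_eq_0_iff by blast
qed

instantiation padic_int :: (prime_card) idom_divide
begin

definition divide_padic_int :: "'a padic_int \<Rightarrow> 'a padic_int \<Rightarrow> 'a padic_int" where
  "(x :: 'a padic_int) div y = (if y \<noteq> 0 \<and> y dvd x then THE w. x = w * y else 0)"

instance
proof
  fix a b :: "'a padic_int"
  assume "b \<noteq> 0"
  then show "(a * b) div b = a" by (auto simp: divide_padic_int_def)
next
  fix a :: "'a padic_int"
  show "a div 0 = 0" by (simp add: divide_padic_int_def)
qed

end

instantiation padic_int :: (prime_card) topological_space
begin

definition open_padic_int :: "'a padic_int set \<Rightarrow> bool" where
  "open (U :: 'a padic_int set) \<longleftrightarrow> (\<forall>x\<in>U. \<exists>n. \<forall>y. of_nat (CARD('a)) ^ n dvd y - x \<longrightarrow> y \<in> U)"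

instance
proof
  show "open (UNIV :: 'a padic_int set)" by (simp add: open_padic_int_def)
next
  fix S T :: "'a padic_int set"
  assume S: "open S" and T: "open T"
  show "open (S \<inter> T)"
    unfolding open_padic_int_def
  proof
    fix x assume "x \<in> S \<inter> T"
    then obtain m n where
      "\<And>y. of_nat (CARD('a)) ^ m dvd y - x \<Longrightarrow> y \<in> S"
      "\<And>y. of_nat (CARD('a)) ^ n dvd y - x \<Longrightarrow> y \<in> T"
      using S T unfolding open_padic_int_def by blast
    then have "\<forall>y. of_nat (CARD('a)) ^ (m + n) dvd y - x \<longrightarrow> y \<in> S \<inter> T"
      by (metis IntI dvd_mult_left dvd_mult_right power_add)
    then show "\<exists>n. \<forall>y. of_nat (CARD('a)) ^ n dvd y - x \<longrightarrow> y \<in> S \<inter> T" by blast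
  qed
next
  fix \<U> :: "'a padic_int set set"
  assume "\<forall>S\<in>\<U>. open S"
  then show "open (\<Union>\<U>)" unfolding open_padic_int_def by (meson Union_iff)
qed

end

text \<open>The division by \<^term>\<open>fact n\<close> is exact for \<open>x\<close> divisible by $q$.\<close>

definition padic_exp :: "'p::prime_card padic_int \<Rightarrow> 'p padic_int" where
  "padic_exp x = (\<Sum>n. x ^ n div fact n)"

type_synonym 'p padic = "'p padic_int fract"

section \<open>The Iwasawa algebra\<close>

definition units_mod :: "'p::prime_card itself \<Rightarrow> nat \<Rightarrow> int set" where
  "units_mod P n = {a. 0 \<le> a \<and> a < int (prm P) ^ n \<and> coprime a (int (prm P) ^ n)}"

lemma finite_units_mod [simp]: "finite (units_mod P n)"
  by (rule finite_subset[of _ "{0..int (prm P) ^ n}"]) (auto simp: units_mod_def)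

lemma prm_pow_pos [simp]: "int (CARD('p::prime_card)) ^ n > 0"
  using prm_gt_1[where 'p='p] by simp

lemma units_mod_modI:
  "coprime a (int (CARD('p::prime_card)) ^ n) \<Longrightarrow> a mod int (CARD('p)) ^ n \<in> units_mod TYPE('p) n"
  by (simp add: units_mod_def del: coprime_power_right_iff)

lemma units_mod_mult:
  "a \<in> units_mod TYPE('p::prime_card) n \<Longrightarrow> b \<in> units_mod TYPE('p) n \<Longrightarrow>
    a * b mod int (CARD('p)) ^ n \<in> units_mod TYPE('p) n"
  by (rule units_mod_modI) (auto simp: units_mod_def)

lemma units_mod_mod: "a \<in> units_mod TYPE('p::prime_card) n \<Longrightarrow> a mod int (CARD('p)) ^ n = a"
  by (simp add: units_mod_def)

lemma units_mod_1: "1 mod int (CARD('p::prime_card)) ^ n \<in> units_mod TYPE('p) n"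
  by (rule units_mod_modI) simp

lemma units_mod_Suc:
  assumes "a \<in> units_mod TYPE('p::prime_card) (Suc n)"
  shows "a mod int (CARD('p)) ^ n \<in> units_mod TYPE('p) n"
  using assms by (intro units_mod_modI) (simp add: units_mod_def)

text \<open>
  An element is a compatible system of elements $\sum_a \mu_n(a) [a]$ of the group rings
  $\mathbb{Z}_p[(\mathbb{Z}/p^n)^\times]$; the compatibility condition also forces
  $\mu_n(a) = 0$ unless $a$ represents a class in $(\mathbb{Z}/p^n)^\times$.
\<close>

typedef (overloaded) 'p iwasawa =
  "{\<mu> :: nat \<Rightarrow> int \<Rightarrow> 'p::prime_card padic_int. \<forall>n a.
      (\<Sum>b | b \<in> units_mod TYPE('p) (Suc n) \<and> b mod int (CARD('p)) ^ n = a. \<mu> (Suc n) b) = \<mu> n a}"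
  morphisms mass Abs_iwasawa
  by (rule exI[of _ "\<lambda>_ _. 0"]) auto

lifting_forget padic_int.lifting
setup_lifting type_definition_iwasawa

lemma sum_Collect_if:
  "finite A \<Longrightarrow> (\<Sum>b | b \<in> A \<and> Q b. f b) = (\<Sum>b\<in>A. if Q b then f b else 0)"
  by (rule sum.inter_filter)

lemma mass_eq:
  "mass (\<mu>::'p::prime_card iwasawa) n a =
    (\<Sum>b\<in>units_mod TYPE('p) (Suc n). if b mod int (CARD('p)) ^ n = a then mass \<mu> (Suc n) b else 0)"
  using mass[of \<mu>] by (simp only: mem_Collect_eq sum_Collect_if[OF finite_units_mod])

lemma mass_outside:
  assumes "a \<notin> units_mod TYPE('p) n" shows "mass (\<mu>::'p::prime_card iwasawa) n a = 0"
  unfolding mass_eq[of \<mu> n a] by (rule sum.neutral) (use assms units_mod_Suc in auto)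

text \<open>The sum of $f$ against $\mu_n$; used to verify the ring axioms.\<close>

definition iwint :: "(nat \<Rightarrow> int \<Rightarrow> 'p::prime_card padic_int) \<Rightarrow> nat \<Rightarrow> (int \<Rightarrow> 'p padic_int) \<Rightarrow> 'p padic_int" where
  "iwint \<mu> n f = (\<Sum>a\<in>units_mod TYPE('p) n. \<mu> n a * f a)"

definition conv :: "(nat \<Rightarrow> int \<Rightarrow> 'p::prime_card padic_int) \<Rightarrow> (nat \<Rightarrow> int \<Rightarrow> 'p padic_int) \<Rightarrow>
    nat \<Rightarrow> int \<Rightarrow> 'p padic_int" where
  "conv \<mu> \<nu> n c =
    (\<Sum>(a, b) | a \<in> units_mod TYPE('p) n \<and> b \<in> units_mod TYPE('p) n \<and> a * b mod int (CARD('p)) ^ n = c.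
      \<mu> n a * \<nu> n b)"

lemma conv_eq:
  fixes \<mu> \<nu> :: "nat \<Rightarrow> int \<Rightarrow> 'p::prime_card padic_int"
  shows "conv \<mu> \<nu> n c = iwint \<mu> n (\<lambda>a. iwint \<nu> n (\<lambda>b. of_bool (a * b mod int (CARD('p)) ^ n = c)))"
proof -
  let ?U = "units_mod TYPE('p) n" and ?p = "int (CARD('p)) ^ n"
  have "conv \<mu> \<nu> n c = (\<Sum>x | x \<in> ?U \<times> ?U \<and> fst x * snd x mod ?p = c. \<mu> n (fst x) * \<nu> n (snd x))"
    unfolding conv_def by (rule sum.cong) auto
  also have "\<dots> = (\<Sum>x\<in>?U \<times> ?U. if fst x * snd x mod ?p = c then \<mu> n (fst x) * \<nu> n (snd x) else 0)"
    by (rule sum_Collect_if) simp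
  also have "\<dots> = (\<Sum>a\<in>?U. \<Sum>b\<in>?U. if a * b mod ?p = c then \<mu> n a * \<nu> n b else 0)"
    by (simp add: sum.cartesian_product case_prod_beta)
  finally show ?thesis
    unfolding iwint_def sum_distrib_left by (simp add: of_bool_def if_distrib cong: if_cong)
qed

lemma iwint_cong: "(\<And>a. a \<in> units_mod TYPE('p::prime_card) n \<Longrightarrow> f a = g a) \<Longrightarrow> iwint \<mu> n f = iwint \<mu> n (g::int \<Rightarrow> 'p padic_int)"
  by (simp add: iwint_def cong: sum.cong)

lemma iwint_swap:
  "iwint \<mu> n (\<lambda>a. iwint \<nu> n (\<lambda>b. f a b)) = iwint \<nu> n (\<lambda>b. iwint \<mu> n (\<lambda>a. f a b))"
  unfolding iwint_def sum_distrib_left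
  by (subst sum.swap) (simp add: ac_simps)

lemma iwint_sum: "iwint \<mu> n (\<lambda>a. \<Sum>i\<in>I. f i a) = (\<Sum>i\<in>I. iwint \<mu> n (f i))"
  unfolding iwint_def sum_distrib_left by (rule sum.swap)

lemma iwint_mult_right: "iwint \<mu> n (\<lambda>a. f a * x) = iwint \<mu> n f * x"
  unfolding iwint_def sum_distrib_right by (simp add: ac_simps)

lemma sum_of_bool_units:
  assumes "x \<in> units_mod TYPE('p::prime_card) n"
  shows "(\<Sum>c\<in>units_mod TYPE('p) n. of_bool (x = c) * f c) = (f x :: 'p padic_int)"
proof -
  have "(\<Sum>c\<in>units_mod TYPE('p) n. of_bool (x = c) * f c)
      = (\<Sum>c\<in>units_mod TYPE('p) n. if x = c then f c else 0)"
    by (rule sum.cong) auto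
  then show ?thesis using assms by simp
qed

lemma iwint_conv:
  fixes \<mu> \<nu> :: "nat \<Rightarrow> int \<Rightarrow> 'p::prime_card padic_int"
  shows "iwint (conv \<mu> \<nu>) n f = iwint \<mu> n (\<lambda>a. iwint \<nu> n (\<lambda>b. f (a * b mod int (CARD('p)) ^ n)))"
proof -
  let ?U = "units_mod TYPE('p) n" and ?p = "int (CARD('p)) ^ n"
  have "iwint (conv \<mu> \<nu>) n f
      = (\<Sum>c\<in>?U. iwint \<mu> n (\<lambda>a. iwint \<nu> n (\<lambda>b. of_bool (a * b mod ?p = c) * f c)))"
    unfolding iwint_def[of "conv \<mu> \<nu>"] conv_eq by (simp add: iwint_mult_right)
  also have "\<dots> = iwint \<mu> n (\<lambda>a. iwint \<nu> n (\<lambda>b. \<Sum>c\<in>?U. of_bool (a * b mod ?p = c) * f c))"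
    by (simp only: iwint_sum)
  also have "\<dots> = iwint \<mu> n (\<lambda>a. iwint \<nu> n (\<lambda>b. f (a * b mod ?p)))"
    by (intro iwint_cong sum_of_bool_units units_mod_mult)
  finally show ?thesis .
qed

lemma iwint_Suc:
  fixes \<mu> :: "'p::prime_card iwasawa"
  shows "iwint (mass \<mu>) n f = iwint (mass \<mu>) (Suc n) (\<lambda>b. f (b mod int (CARD('p)) ^ n))"
proof -
  let ?U = "units_mod TYPE('p) n" and ?V = "units_mod TYPE('p) (Suc n)" and ?p = "int (CARD('p)) ^ n"
  have "iwint (mass \<mu>) n f = (\<Sum>a\<in>?U. \<Sum>b\<in>?V. of_bool (b mod ?p = a) * f a * mass \<mu> (Suc n) b)"
    unfolding iwint_def mass_eq[of \<mu> n] sum_distrib_right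
    by (intro sum.cong refl) auto
  also have "\<dots> = (\<Sum>b\<in>?V. (\<Sum>a\<in>?U. of_bool (b mod ?p = a) * f a) * mass \<mu> (Suc n) b)"
    unfolding sum_distrib_right by (rule sum.swap)
  also have "\<dots> = iwint (mass \<mu>) (Suc n) (\<lambda>b. f (b mod ?p))"
    unfolding iwint_def
    by (rule sum.cong[OF refl], subst sum_of_bool_units[OF units_mod_Suc]) (auto simp: mult.commute)
  finally show ?thesis .
qed

instantiation iwasawa :: (prime_card) comm_ring_1
begin

lift_definition zero_iwasawa :: "'a iwasawa" is "\<lambda>_ _. 0" by simp

lift_definition one_iwasawa :: "'a iwasawa" is "\<lambda>n a. of_bool (a = 1 mod int (CARD('a)) ^ n)"
  unfolding sum_Collect_if[OF finite_units_mod]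
proof -
  fix n :: nat and a :: int
  let ?V = "units_mod TYPE('a) (Suc n)" and ?p = "int (CARD('a)) ^ n" and ?u = "1 mod int (CARD('a)) ^ Suc n"
  have "(\<Sum>b\<in>?V. if b mod ?p = a then of_bool (b = ?u) else (0::'a padic_int))
      = (\<Sum>b\<in>?V. of_bool (?u = b) * of_bool (b mod ?p = a))"
    by (intro sum.cong) auto
  also have "\<dots> = of_bool (?u mod ?p = a)"
    by (rule sum_of_bool_units) (rule units_mod_1)
  also have "\<dots> = of_bool (a = 1 mod ?p)" by (auto simp: mod_mod_cancel)
  finally show "(\<Sum>b\<in>?V. if b mod ?p = a then of_bool (b = ?u) else (0::'a padic_int))
      = of_bool (a = 1 mod ?p)" .
qed

lift_definition plus_iwasawa :: "'a iwasawa \<Rightarrow> 'a iwasawa \<Rightarrow> 'a iwasawa"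
  is "\<lambda>\<mu> \<nu> n a. \<mu> n a + \<nu> n a"
  by (simp only: sum.distrib)

lift_definition minus_iwasawa :: "'a iwasawa \<Rightarrow> 'a iwasawa \<Rightarrow> 'a iwasawa"
  is "\<lambda>\<mu> \<nu> n a. \<mu> n a - \<nu> n a"
  by (simp only: sum_subtractf)

lift_definition uminus_iwasawa :: "'a iwasawa \<Rightarrow> 'a iwasawa"
  is "\<lambda>\<mu> n a. - \<mu> n a"
  by (simp only: sum_negf)

lift_definition times_iwasawa :: "'a iwasawa \<Rightarrow> 'a iwasawa \<Rightarrow> 'a iwasawa" is conv
  unfolding sum_Collect_if[OF finite_units_mod]
proof -
  fix f g :: "nat \<Rightarrow> int \<Rightarrow> 'a padic_int" and n :: nat and c :: int
  let ?U = "units_mod TYPE('a) n" and ?V = "units_mod TYPE('a) (Suc n)"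
    and ?p = "int (CARD('a)) ^ n" and ?p' = "int (CARD('a)) ^ Suc n"
  assume f: "\<And>n a. (\<Sum>b\<in>units_mod TYPE('a) (Suc n). if b mod int (CARD('a)) ^ n = a then f (Suc n) b else 0) = f n a"
    and g: "\<And>n a. (\<Sum>b\<in>units_mod TYPE('a) (Suc n). if b mod int (CARD('a)) ^ n = a then g (Suc n) b else 0) = g n a"
  define \<mu> \<nu> where "\<mu> = Abs_iwasawa f" and "\<nu> = Abs_iwasawa g"
  have f': "f = mass \<mu>" and g': "g = mass \<nu>"
    using f g unfolding \<mu>_def \<nu>_def by (simp_all add: Abs_iwasawa_inverse sum_Collect_if del: sum.inter_filter)
  have "(\<Sum>b\<in>?V. if b mod ?p = c then conv f g (Suc n) b else 0)
      = iwint (conv f g) (Suc n) (\<lambda>b. of_bool (b mod ?p = c))"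
    unfolding iwint_def by (intro sum.cong) auto
  also have "\<dots> = iwint f (Suc n) (\<lambda>a. iwint g (Suc n) (\<lambda>b. of_bool (a * b mod ?p = c)))"
    unfolding iwint_conv by (simp add: mod_mod_cancel)
  also have "\<dots> = iwint f (Suc n) (\<lambda>a. iwint g (Suc n) (\<lambda>b. of_bool ((a mod ?p) * (b mod ?p) mod ?p = c)))"
    by (simp add: mod_mult_eq)
  also have "\<dots> = iwint f n (\<lambda>a. iwint g n (\<lambda>b. of_bool (a * b mod ?p = c)))"
    unfolding f' g' iwint_Suc[of \<mu> n] iwint_Suc[of \<nu> n] ..
  finally show "(\<Sum>b\<in>?V. if b mod ?p = c then conv f g (Suc n) b else 0) = conv f g n c"
    by (simp add: conv_eq)
qed

instance
proof
  fix a b c :: "'a iwasawa"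
  show "a + b + c = a + (b + c)" by transfer (simp add: add.assoc)
  show "a + b = b + a" by transfer (simp add: add.commute)
  show "0 + a = a" by transfer simp
  show "- a + a = 0" by transfer simp
  show "a - b = a + - b" by transfer simp
  show "(a + b) * c = a * c + b * c"
    by transfer (auto simp: conv_eq iwint_def fun_eq_iff distrib_right sum.distrib)
  show "a * b = b * a"
  proof -
    have "conv (mass a) (mass b) n x = conv (mass b) (mass a) n x" for n x
      unfolding conv_eq by (subst iwint_swap) (simp only: mult.commute)
    then have "mass (a * b) = mass (b * a)"
      by (simp add: times_iwasawa.rep_eq fun_eq_iff)
    then show ?thesis by (simp add: mass_inject)
  qed
  show "a * b * c = a * (b * c)"
  proof -
    have "conv (conv (mass a) (mass b)) (mass c) n x = conv (mass a) (conv (mass b) (mass c)) n x" for n x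
      by (simp add: conv_eq[of "conv (mass a) (mass b)"] conv_eq[of "mass a" "conv (mass b) (mass c)"]
          iwint_conv mod_mult_left_eq mod_mult_right_eq mult.assoc)
    then have "mass (a * b * c) = mass (a * (b * c))"
      by (simp add: times_iwasawa.rep_eq fun_eq_iff)
    then show ?thesis by (simp add: mass_inject)
  qed
  show "1 * a = a"
  proof -
    have "mass (1 * a) n x = mass a n x" for n x
    proof -
      let ?U = "units_mod TYPE('a) n" and ?p = "int (CARD('a)) ^ n"
      have "mass (1 * a) n x = (\<Sum>c\<in>?U. of_bool (1 mod ?p = c) * iwint (mass a) n (\<lambda>b. of_bool (c * b mod ?p = x)))"
        unfolding times_iwasawa.rep_eq conv_eq iwint_def[of "mass 1"]
        unfolding one_iwasawa.rep_eq
        by (rule sum.cong[OF refl], rule arg_cong2[where f = "(*)"]) auto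
      also have "\<dots> = iwint (mass a) n (\<lambda>b. of_bool (1 mod ?p * b mod ?p = x))"
        by (rule sum_of_bool_units[OF units_mod_1])
      also have "\<dots> = iwint (mass a) n (\<lambda>b. of_bool (x = b))"
        by (rule iwint_cong) (auto simp: mod_mult_left_eq units_mod_mod)
      also have "\<dots> = mass a n x"
      proof (cases "x \<in> ?U")
        case True
        then show ?thesis using sum_of_bool_units[OF True, of "mass a n"]
          unfolding iwint_def by (simp add: mult.commute)
      next
        case False
        then show ?thesis unfolding iwint_def mass_outside[OF False]
          by (intro sum.neutral) auto
      qed
      finally show ?thesis .
    qed
    then show ?thesis by (metis mass_inject ext)
  qed
  show "(0::'a iwasawa) \<noteq> 1"
  proof
    assume "(0::'a iwasawa) = 1"
    then have "mass (0::'a iwasawa) 0 0 = mass 1 0 0" by simp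
    then show False by (simp add: zero_iwasawa.rep_eq one_iwasawa.rep_eq)
  qed
qed

end

lift_definition iw_const :: "'p::prime_card padic_int \<Rightarrow> 'p iwasawa"
  is "\<lambda>c n a. if a = 1 mod int (CARD('p)) ^ n then c else 0"
  unfolding sum_Collect_if[OF finite_units_mod]
proof -
  fix c :: "'p padic_int" and n :: nat and a :: int
  let ?V = "units_mod TYPE('p) (Suc n)" and ?p = "int (CARD('p)) ^ n" and ?u = "1 mod int (CARD('p)) ^ Suc n"
  have "(\<Sum>b\<in>?V. if b mod ?p = a then if b = ?u then c else 0 else 0)
      = (\<Sum>b\<in>?V. of_bool (?u = b) * (if b mod ?p = a then c else 0))"
    by (intro sum.cong) auto
  also have "\<dots> = (if ?u mod ?p = a then c else 0)"
    by (rule sum_of_bool_units) (rule units_mod_1)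
  also have "\<dots> = (if a = 1 mod ?p then c else 0)" by (auto simp: mod_mod_cancel)
  finally show "(\<Sum>b\<in>?V. if b mod ?p = a then if b = ?u then c else 0 else 0)
      = (if a = 1 mod ?p then c else 0)" .
qed

lemma residue_unit:
  assumes "(x::'p::prime_card padic_int) dvd 1"
  shows "residue x n \<in> units_mod TYPE('p) n"
proof -
  obtain y where "1 = x * y" using assms by (rule dvdE)
  then have "residue x n * residue y n mod int (CARD('p)) ^ n = 1 mod int (CARD('p)) ^ n"
    by (metis times_padic_int.rep_eq one_padic_int.rep_eq)
  then have "coprime (residue x n * residue y n) (int (CARD('p)) ^ n)"
    by (metis coprime_1_left coprime_mod_left_iff prm_pow_pos less_irrefl)
  then have "coprime (residue x n) (int (CARD('p)) ^ n)" by auto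
  then show ?thesis using units_mod_modI by (metis residue_mod)
qed

text \<open>The universal character $[-]$, extended by $0$ outside $\mathbb{Z}_p^\times$.\<close>

lift_definition univ_char :: "'p::prime_card padic_int \<Rightarrow> 'p iwasawa"
  is "\<lambda>x n a. of_bool (x dvd 1 \<and> a = residue x n)"
  unfolding sum_Collect_if[OF finite_units_mod]
proof -
  fix x :: "'p padic_int" and n :: nat and a :: int
  let ?V = "units_mod TYPE('p) (Suc n)" and ?p = "int (CARD('p)) ^ n"
  show "(\<Sum>b\<in>?V. if b mod ?p = a then of_bool (x dvd 1 \<and> b = residue x (Suc n)) else (0::'p padic_int))
      = of_bool (x dvd 1 \<and> a = residue x n)"
  proof (cases "x dvd 1")
    case True
    have "(\<Sum>b\<in>?V. if b mod ?p = a then of_bool (x dvd 1 \<and> b = residue x (Suc n)) else (0::'p padic_int))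
        = (\<Sum>b\<in>?V. of_bool (residue x (Suc n) = b) * of_bool (b mod ?p = a))"
      using True by (intro sum.cong) auto
    also have "\<dots> = of_bool (residue x (Suc n) mod ?p = a)"
      by (rule sum_of_bool_units) (rule residue_unit[OF True])
    also have "\<dots> = of_bool (x dvd 1 \<and> a = residue x n)"
      using True by (auto simp: residue_Suc)
    finally show ?thesis .
  next
    case False
    then show ?thesis by (auto intro!: sum.neutral)
  qed
qed

definition iw_T :: "'p::prime_card iwasawa" where
  "iw_T = univ_char (padic_exp (of_nat (lev TYPE('p)))) - 1"

text \<open>The powers of the ideal $(a, b)$.\<close>

primrec ideal_pow :: "'a::comm_ring_1 \<Rightarrow> 'a \<Rightarrow> nat \<Rightarrow> 'a set" where
  "ideal_pow a b 0 = UNIV"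
| "ideal_pow a b (Suc k) = {a * x + b * y | x y. x \<in> ideal_pow a b k \<and> y \<in> ideal_pow a b k}"

lemma ideal_pow_Suc_subset: "ideal_pow a b (Suc k) \<subseteq> ideal_pow a b k"
proof (induction k)
  case 0
  show ?case by simp
next
  case (Suc k)
  show ?case
  proof
    fix z assume "z \<in> ideal_pow a b (Suc (Suc k))"
    then obtain x y where "z = a * x + b * y" "x \<in> ideal_pow a b (Suc k)" "y \<in> ideal_pow a b (Suc k)"
      by (subst (asm) ideal_pow.simps(2)) blast
    with Suc.IH show "z \<in> ideal_pow a b (Suc k)"
      by (subst ideal_pow.simps(2)) blast
  qed
qed

lemma ideal_pow_antimono: "m \<le> n \<Longrightarrow> ideal_pow a b n \<subseteq> ideal_pow a b m"
  using lift_Suc_antimono_le[of "ideal_pow a b" m n] ideal_pow_Suc_subset by blast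

instantiation iwasawa :: (prime_card) topological_space
begin

definition open_iwasawa :: "'a iwasawa set \<Rightarrow> bool" where
  "open (U :: 'a iwasawa set) \<longleftrightarrow> (\<forall>x\<in>U. \<exists>n. \<forall>y. y - x \<in> ideal_pow (of_nat (CARD('a))) iw_T n \<longrightarrow> y \<in> U)"

instance
proof
  show "open (UNIV :: 'a iwasawa set)" by (simp add: open_iwasawa_def)
next
  fix S T :: "'a iwasawa set"
  assume S: "open S" and T: "open T"
  let ?I = "ideal_pow (of_nat (CARD('a))) (iw_T :: 'a iwasawa)"
  show "open (S \<inter> T)"
    unfolding open_iwasawa_def
  proof
    fix x assume "x \<in> S \<inter> T"
    then obtain m n where
      "\<And>y. y - x \<in> ?I m \<Longrightarrow> y \<in> S" "\<And>y. y - x \<in> ?I n \<Longrightarrow> y \<in> T"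
      using S T unfolding open_iwasawa_def by blast
    then have "\<forall>y. y - x \<in> ?I (max m n) \<longrightarrow> y \<in> S \<inter> T"
      using ideal_pow_antimono[of m "max m n"] ideal_pow_antimono[of n "max m n"] by fastforce
    then show "\<exists>n. \<forall>y. y - x \<in> ?I n \<longrightarrow> y \<in> S \<inter> T" by blast
  qed
next
  fix \<U> :: "'a iwasawa set set"
  assume "\<forall>S\<in>\<U>. open S"
  then show "open (\<Union>\<U>)" unfolding open_iwasawa_def by (meson Union_iff)
qed

end

text \<open>
  Convergence in $\Lambda[[X]]$ for the $\mathfrak{m}_\Lambda$-adic topology. (The topology that the
  library puts on \<^typ>\<open>'a fps\<close> is the $X$-adic one.)
\<close>

definition iw_fps_limit :: "(nat \<Rightarrow> 'p::prime_card iwasawa fps) \<Rightarrow> 'p iwasawa fps \<Rightarrow> bool" where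
  "iw_fps_limit F C \<longleftrightarrow>
    (\<forall>k. eventually (\<lambda>n. F n - C \<in> ideal_pow (of_nat (CARD('p))) (fps_const iw_T) k) sequentially)"

text \<open>
  The ring $\Lambda^{>1/p} = \Lambda[[pT^{-1}]]$, presented as $\Lambda[[U]]/(TU - p)$,
  where $U$ stands for $pT^{-1}$.
\<close>

definition annulus_rel :: "'p::prime_card iwasawa fps" where
  "annulus_rel = fps_const iw_T * fps_X - of_nat (CARD('p))"

quotient_type (overloaded) 'p iw_annulus =
  "'p::prime_card iwasawa fps" / "\<lambda>f g. annulus_rel dvd f - g"
proof (rule equivpI)
  show "reflp (\<lambda>f g :: 'p iwasawa fps. annulus_rel dvd f - g)" by (rule reflpI) simp
  show "symp (\<lambda>f g :: 'p iwasawa fps. annulus_rel dvd f - g)"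
    by (rule sympI) (metis dvd_minus_iff minus_diff_eq)
  show "transp (\<lambda>f g :: 'p iwasawa fps. annulus_rel dvd f - g)"
    by (rule transpI) (metis diff_add_cancel add_diff_eq dvd_add)
qed

lifting_forget iwasawa.lifting

lemma dvd_diff_mult:
  fixes r :: "'a::comm_ring_1"
  assumes "r dvd a - b" "r dvd c - d" shows "r dvd a * c - b * d"
proof -
  have "a * c - b * d = (a - b) * c + b * (c - d)" by (simp add: algebra_simps)
  then show ?thesis using assms by (simp add: dvd_add)
qed

lemma not_annulus_rel_dvd_1: "\<not> (annulus_rel :: 'p::prime_card iwasawa fps) dvd 1"
proof
  assume "(annulus_rel :: 'p iwasawa fps) dvd 1"
  then obtain g :: "'p iwasawa fps" where "1 = annulus_rel * g" by (rule dvdE)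
  then have "fps_nth (1 :: 'p iwasawa fps) 0 = fps_nth (annulus_rel * g) 0" by simp
  then have "1 = - of_nat (CARD('p)) * fps_nth g 0"
    by (simp add: annulus_rel_def fps_of_nat[symmetric])
  then have eq: "1 = of_nat (CARD('p)) * - fps_nth g 0" by simp
  have U: "units_mod TYPE('p) 0 = {0}" by (auto simp: units_mod_def)
  have mult: "mass (\<mu> * \<nu>) 0 0 = mass \<mu> 0 0 * mass \<nu> 0 0" for \<mu> \<nu> :: "'p iwasawa"
    by (simp add: times_iwasawa.rep_eq conv_eq iwint_def U)
  have one: "mass (1 :: 'p iwasawa) 0 0 = 1" by (simp add: one_iwasawa.rep_eq)
  have nat: "mass (of_nat k :: 'p iwasawa) 0 0 = of_nat k" for k
    by (induction k) (simp_all add: one zero_iwasawa.rep_eq plus_iwasawa.rep_eq)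
  define y where "y = mass (- fps_nth g 0) 0 0"
  have "1 = of_nat (CARD('p)) * y"
    using arg_cong[OF eq, of "\<lambda>\<mu>. mass \<mu> 0 0"] unfolding mult one nat y_def .
  then have "residue (1 :: 'p padic_int) 1 = residue (of_nat (CARD('p)) * y) 1" by simp
  then show False
    using prm_gt_1[where 'p='p]
    by (simp add: one_padic_int.rep_eq times_padic_int.rep_eq residue_of_nat)
qed

instantiation iw_annulus :: (prime_card) comm_ring_1
begin

lift_definition zero_iw_annulus :: "'a iw_annulus" is 0 .

lift_definition one_iw_annulus :: "'a iw_annulus" is 1 .

lift_definition plus_iw_annulus :: "'a iw_annulus \<Rightarrow> 'a iw_annulus \<Rightarrow> 'a iw_annulus" is "(+)"
  by (metis add_diff_add dvd_add)

lift_definition minus_iw_annulus :: "'a iw_annulus \<Rightarrow> 'a iw_annulus \<Rightarrow> 'a iw_annulus" is "(-)"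
proof -
  fix a b c d :: "'a iwasawa fps"
  assume "annulus_rel dvd a - b" "annulus_rel dvd c - d"
  then have "annulus_rel dvd (a - b) - (c - d)" by (rule dvd_diff)
  then show "annulus_rel dvd a - c - (b - d)" by (simp add: algebra_simps)
qed

lift_definition uminus_iw_annulus :: "'a iw_annulus \<Rightarrow> 'a iw_annulus" is uminus
  by (metis dvd_minus_iff minus_diff_eq minus_diff_minus)

lift_definition times_iw_annulus :: "'a iw_annulus \<Rightarrow> 'a iw_annulus \<Rightarrow> 'a iw_annulus" is "(*)"
  by (rule dvd_diff_mult)

instance
proof
  fix a b c :: "'a iw_annulus"
  show "a + b + c = a + (b + c)" by transfer (simp add: algebra_simps)
  show "a + b = b + a" by transfer (simp add: algebra_simps)
  show "0 + a = a" by transfer simp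
  show "- a + a = 0" by transfer simp
  show "a - b = a + - b" by transfer simp
  show "(a + b) * c = a * c + b * c" by transfer (simp add: algebra_simps)
  show "a * b = b * a" by transfer (simp add: algebra_simps)
  show "a * b * c = a * (b * c)" by transfer (simp add: algebra_simps)
  show "1 * a = a" by transfer simp
  show "(0::'a iw_annulus) \<noteq> 1"
    by transfer (use not_annulus_rel_dvd_1[where 'p='a] in simp)
qed

end

lift_definition iw_annulus_of :: "'p::prime_card iwasawa \<Rightarrow> 'p iw_annulus" is fps_const .

section \<open>The prime-to-p finite adeles\<close>

text \<open>
  $\hat{\mathbb{Z}}^{(p)} = \prod_{\ell \ne p} \mathbb{Z}_\ell$ as the inverse limit of $\mathbb{Z}/n$
  over the $n$ prime to $p$; the value at other $n$ is a dummy.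
\<close>

typedef (overloaded) 'p zhat =
  "{x :: nat \<Rightarrow> int. (\<forall>n. \<not> coprime n (CARD('p::prime_card)) \<longrightarrow> x n = 0) \<and>
      (\<forall>m n. coprime n (CARD('p)) \<longrightarrow> m dvd n \<longrightarrow> x n mod int m = x m)}"
  morphisms zhat_residue Abs_zhat
  by (rule exI[of _ "\<lambda>_. 0"]) auto

setup_lifting type_definition_zhat

lemma zhat_residue_dummy:
  "\<not> coprime n (CARD('p)) \<Longrightarrow> zhat_residue (x :: 'p::prime_card zhat) n = 0"
  using zhat_residue[of x] unfolding mem_Collect_eq by blast

lemma zhat_residue_dvd:
  "coprime n (CARD('p)) \<Longrightarrow> m dvd n \<Longrightarrow>
    zhat_residue (x :: 'p::prime_card zhat) n mod int m = zhat_residue x m"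
  using zhat_residue[of x] unfolding mem_Collect_eq by blast

lemma zhat_residue_mod [simp]:
  "zhat_residue (x :: 'p::prime_card zhat) n mod int n = zhat_residue x n"
  by (cases "coprime n (CARD('p))") (simp_all add: zhat_residue_dummy zhat_residue_dvd)

lemma coprime_dvd: "coprime n (p::nat) \<Longrightarrow> m dvd n \<Longrightarrow> coprime m p"
  using coprime_divisors[of m n p p] by simp

instantiation zhat :: (prime_card) comm_ring_1
begin

lift_definition zero_zhat :: "'a zhat" is "\<lambda>_. 0" by simp

lift_definition one_zhat :: "'a zhat" is "\<lambda>n. if coprime n (CARD('a)) then 1 mod int n else 0"
  by (auto simp: mod_mod_cancel dest: coprime_dvd)

lift_definition plus_zhat :: "'a zhat \<Rightarrow> 'a zhat \<Rightarrow> 'a zhat"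
  is "\<lambda>x y n. (x n + y n) mod int n"
  by (auto simp: mod_mod_cancel) (metis mod_add_eq)

lift_definition times_zhat :: "'a zhat \<Rightarrow> 'a zhat \<Rightarrow> 'a zhat"
  is "\<lambda>x y n. (x n * y n) mod int n"
  by (auto simp: mod_mod_cancel) (metis mod_mult_eq)

lift_definition uminus_zhat :: "'a zhat \<Rightarrow> 'a zhat"
  is "\<lambda>x n. (- x n) mod int n"
  by (auto simp: mod_mod_cancel) (metis mod_minus_eq)

lift_definition minus_zhat :: "'a zhat \<Rightarrow> 'a zhat \<Rightarrow> 'a zhat"
  is "\<lambda>x y n. (x n - y n) mod int n"
  by (auto simp: mod_mod_cancel) (metis mod_diff_eq)

instance
proof
  fix a b c :: "'a zhat"
  show "a + b + c = a + (b + c)"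
    by (transfer, rule ext) (simp add: mod_add_left_eq mod_add_right_eq ac_simps)
  show "a + b = b + a" by transfer (simp add: ac_simps)
  have "zhat_residue (0 + a) n = zhat_residue a n" for n
    by (simp add: plus_zhat.rep_eq zero_zhat.rep_eq)
  then show "0 + a = a" by (metis zhat_residue_inject ext)
  show "- a + a = 0" by (transfer, rule ext) (simp add: mod_add_left_eq)
  show "a - b = a + - b" by (transfer, rule ext) (simp add: mod_add_right_eq)
  show "(a + b) * c = a * c + b * c"
    by (transfer, rule ext) (simp add: mod_mult_left_eq mod_add_eq distrib_right)
  show "a * b = b * a" by transfer (simp add: ac_simps)
  show "a * b * c = a * (b * c)"
    by (transfer, rule ext) (simp add: mod_mult_left_eq mod_mult_right_eq ac_simps)
  have "zhat_residue (1 * a) n = zhat_residue a n" for n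
    by (cases "coprime n (CARD('a))")
      (simp_all add: times_zhat.rep_eq one_zhat.rep_eq mod_mult_left_eq zhat_residue_dummy)
  then show "1 * a = a" by (metis zhat_residue_inject ext)
  show "(0::'a zhat) \<noteq> 1"
  proof
    assume "(0::'a zhat) = 1"
    then have "zhat_residue (0::'a zhat) (Suc (CARD('a))) = zhat_residue 1 (Suc (CARD('a)))" by simp
    then show False using prm_gt_1[where 'p='a]
      by (simp add: zero_zhat.rep_eq one_zhat.rep_eq)
  qed
qed

end

text \<open>
  $\mathbb{A}_f^{(p)} = \hat{\mathbb{Z}}^{(p)} \otimes \mathbb{Q}$, the localization of
  $\hat{\mathbb{Z}}^{(p)}$ at the nonzero integers.
\<close>

lifting_forget zhat.lifting

definition away_rel :: "'p::prime_card zhat \<times> int \<Rightarrow> 'p zhat \<times> int \<Rightarrow> bool" where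
  "away_rel x y \<longleftrightarrow> snd x \<noteq> 0 \<and> snd y \<noteq> 0 \<and>
    (\<exists>k. k \<noteq> 0 \<and> of_int k * (fst x * of_int (snd y) - fst y * of_int (snd x)) = 0)"

lemma away_relI: "snd x \<noteq> 0 \<Longrightarrow> snd y \<noteq> 0 \<Longrightarrow> k \<noteq> 0 \<Longrightarrow>
    of_int k * (fst x * of_int (snd y) - fst y * of_int (snd x)) = 0 \<Longrightarrow> away_rel x y"
  unfolding away_rel_def by blast

quotient_type (overloaded) 'p away_adele =
  "'p::prime_card zhat \<times> int" / partial: "away_rel :: 'p zhat \<times> int \<Rightarrow> 'p zhat \<times> int \<Rightarrow> bool"
proof (rule part_equivpI)
  show "\<exists>x :: 'p zhat \<times> int. away_rel x x"
    by (rule exI[of _ "(0, 1)"], rule away_relI[of _ _ 1]) auto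
  show "symp (away_rel :: 'p zhat \<times> int \<Rightarrow> 'p zhat \<times> int \<Rightarrow> bool)"
  proof (rule sympI)
    fix x y :: "'p zhat \<times> int"
    assume "away_rel x y"
    then obtain k where "snd x \<noteq> 0" "snd y \<noteq> 0" "k \<noteq> 0"
      "of_int k * (fst x * of_int (snd y) - fst y * of_int (snd x)) = 0"
      unfolding away_rel_def by blast
    then show "away_rel y x" by (intro away_relI[of _ _ k]) (auto simp: algebra_simps)
  qed
  show "transp (away_rel :: 'p zhat \<times> int \<Rightarrow> 'p zhat \<times> int \<Rightarrow> bool)"
  proof (rule transpI)
    fix x y z :: "'p zhat \<times> int"
    assume "away_rel x y" "away_rel y z"
    then obtain k l where k: "snd x \<noteq> 0" "snd y \<noteq> 0" "k \<noteq> 0"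
      "of_int k * (fst x * of_int (snd y) - fst y * of_int (snd x)) = 0"
      and l: "snd z \<noteq> 0" "l \<noteq> 0"
      "of_int l * (fst y * of_int (snd z) - fst z * of_int (snd y)) = 0"
      unfolding away_rel_def by blast
    have "of_int (k * l * snd y) * (fst x * of_int (snd z) - fst z * of_int (snd x))
      = of_int (l * snd z) * (of_int k * (fst x * of_int (snd y) - fst y * of_int (snd x)))
        + of_int (k * snd x) * (of_int l * (fst y * of_int (snd z) - fst z * of_int (snd y)))"
      by (simp add: algebra_simps)
    also have "\<dots> = 0" by (simp only: k l mult_zero_right add_0)
    finally show "away_rel x z" using k l by (intro away_relI[of _ _ "k * l * snd y"]) auto
  qed
qed

lemma away_rel_refl: "snd x \<noteq> 0 \<Longrightarrow> away_rel x x"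
  by (rule away_relI[of _ _ 1]) auto

lemma away_rel_add:
  assumes "away_rel x x'" "away_rel y y'"
  shows "away_rel (fst x * of_int (snd y) + fst y * of_int (snd x), snd x * snd y)
    (fst x' * of_int (snd y') + fst y' * of_int (snd x'), snd x' * snd y')"
proof -
  obtain k l where k: "snd x \<noteq> 0" "snd x' \<noteq> 0" "k \<noteq> 0"
    "of_int k * (fst x * of_int (snd x') - fst x' * of_int (snd x)) = 0"
    and l: "snd y \<noteq> 0" "snd y' \<noteq> 0" "l \<noteq> 0"
    "of_int l * (fst y * of_int (snd y') - fst y' * of_int (snd y)) = 0"
    using assms unfolding away_rel_def by blast
  have "of_int (k * l) * ((fst x * of_int (snd y) + fst y * of_int (snd x)) * of_int (snd x' * snd y')
      - (fst x' * of_int (snd y') + fst y' * of_int (snd x')) * of_int (snd x * snd y))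
    = of_int (l * snd y * snd y') * (of_int k * (fst x * of_int (snd x') - fst x' * of_int (snd x)))
      + of_int (k * snd x * snd x') * (of_int l * (fst y * of_int (snd y') - fst y' * of_int (snd y)))"
    by (simp add: algebra_simps)
  also have "\<dots> = 0" by (simp only: k l mult_zero_right add_0)
  finally show ?thesis using k l by (intro away_relI[of _ _ "k * l"]) auto
qed

lemma away_rel_mult:
  assumes "away_rel x x'" "away_rel y y'"
  shows "away_rel (fst x * fst y, snd x * snd y) (fst x' * fst y', snd x' * snd y')"
proof -
  obtain k l where k: "snd x \<noteq> 0" "snd x' \<noteq> 0" "k \<noteq> 0"
    "of_int k * (fst x * of_int (snd x') - fst x' * of_int (snd x)) = 0"
    and l: "snd y \<noteq> 0" "snd y' \<noteq> 0" "l \<noteq> 0"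
    "of_int l * (fst y * of_int (snd y') - fst y' * of_int (snd y)) = 0"
    using assms unfolding away_rel_def by blast
  have "of_int (k * l) * (fst x * fst y * of_int (snd x' * snd y') - fst x' * fst y' * of_int (snd x * snd y))
    = of_int l * fst y * of_int (snd y') * (of_int k * (fst x * of_int (snd x') - fst x' * of_int (snd x)))
      + of_int k * fst x' * of_int (snd x) * (of_int l * (fst y * of_int (snd y') - fst y' * of_int (snd y)))"
    by (simp add: algebra_simps)
  also have "\<dots> = 0" by (simp only: k l mult_zero_right add_0)
  finally show ?thesis using k l by (intro away_relI[of _ _ "k * l"]) auto
qed

lemma away_rel_minus:
  assumes "away_rel x x'" shows "away_rel (- fst x, snd x) (- fst x', snd x')"
proof -
  obtain k where k: "snd x \<noteq> 0" "snd x' \<noteq> 0" "k \<noteq> 0"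
    "of_int k * (fst x * of_int (snd x') - fst x' * of_int (snd x)) = 0"
    using assms unfolding away_rel_def by blast
  then show ?thesis by (intro away_relI[of _ _ k]) (auto simp: algebra_simps)
qed

instantiation away_adele :: (prime_card) comm_ring_1
begin

lift_definition zero_away_adele :: "'a away_adele" is "(0, 1)"
  by (rule away_rel_refl) simp

lift_definition one_away_adele :: "'a away_adele" is "(1, 1)"
  by (rule away_rel_refl) simp

lift_definition plus_away_adele :: "'a away_adele \<Rightarrow> 'a away_adele \<Rightarrow> 'a away_adele"
  is "\<lambda>x y. (fst x * of_int (snd y) + fst y * of_int (snd x), snd x * snd y)"
  by (rule away_rel_add)

lift_definition times_away_adele :: "'a away_adele \<Rightarrow> 'a away_adele \<Rightarrow> 'a away_adele"
  is "\<lambda>x y. (fst x * fst y, snd x * snd y)"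
  by (rule away_rel_mult)

lift_definition uminus_away_adele :: "'a away_adele \<Rightarrow> 'a away_adele"
  is "\<lambda>x. (- fst x, snd x)"
  by (rule away_rel_minus)

definition minus_away_adele :: "'a away_adele \<Rightarrow> 'a away_adele \<Rightarrow> 'a away_adele" where
  "minus_away_adele x y = x + - y"

instance
proof
  fix a b c :: "'a away_adele"
  have nz: "snd x \<noteq> 0" if "away_rel x x" for x :: "'a zhat \<times> int"
    using that by (simp add: away_rel_def)
  show "a + b + c = a + (b + c)"
    by transfer (rule away_relI[of _ _ 1]; auto dest!: nz simp: algebra_simps)
  show "a + b = b + a"
    by transfer (rule away_relI[of _ _ 1]; auto dest!: nz simp: algebra_simps)
  show "0 + a = a"
    by transfer (rule away_relI[of _ _ 1]; auto dest!: nz simp: algebra_simps)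
  show "- a + a = 0"
    by transfer (rule away_relI[of _ _ 1]; auto dest!: nz simp: algebra_simps)
  show "a - b = a + - b" by (rule minus_away_adele_def)
  show "(a + b) * c = a * c + b * c"
    by transfer (rule away_relI[of _ _ 1]; auto dest!: nz simp: algebra_simps)
  show "a * b = b * a"
    by transfer (rule away_relI[of _ _ 1]; auto dest!: nz simp: algebra_simps)
  show "a * b * c = a * (b * c)"
    by transfer (rule away_relI[of _ _ 1]; auto dest!: nz simp: algebra_simps)
  show "1 * a = a"
    by transfer (rule away_relI[of _ _ 1]; auto dest!: nz simp: algebra_simps)
  show "(0::'a away_adele) \<noteq> 1"
  proof transfer
    show "\<not> away_rel (0, 1) (1 :: 'a zhat, 1)"
    proof
      assume "away_rel (0, 1) (1 :: 'a zhat, 1)"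
      then obtain k where k: "k \<noteq> 0" "(of_int k :: 'a zhat) = 0"
        unfolding away_rel_def by auto
      have nat: "zhat_residue (of_nat j :: 'a zhat) n = int j mod int n"
        if "coprime n (CARD('a))" for j n
        using that by (induction j)
          (simp_all add: zero_zhat.rep_eq plus_zhat.rep_eq one_zhat.rep_eq mod_add_eq add.commute)
      have "(of_nat (nat \<bar>k\<bar>) :: 'a zhat) = 0"
        using k by (cases "k \<ge> 0") (simp_all add: of_nat_nat)
      moreover define n where "n = Suc (CARD('a) * nat \<bar>k\<bar>)"
      have "coprime n (CARD('a))" unfolding n_def
        by (metis coprime_Suc_left_nat coprime_commute coprime_mult_left_iff)
      ultimately have "int (nat \<bar>k\<bar>) mod int n = 0"
        using nat[of n "nat \<bar>k\<bar>"] by (simp add: zero_zhat.rep_eq)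
      moreover have "nat \<bar>k\<bar> < n"
        unfolding n_def using prm_gt_1[where 'p='a] by (simp add: less_Suc_eq_le)
      ultimately show False using k by simp
    qed
  qed
qed

end

lift_definition away_of_zhat :: "'p::prime_card zhat \<Rightarrow> 'p away_adele" is "\<lambda>x. (x, 1)"
  by (rule away_rel_refl) simp

text \<open>The sets $N \hat{\mathbb{Z}}^{(p)}$, $N \geq 1$, form a basis of neighbourhoods of $0$.\<close>

instantiation away_adele :: (prime_card) topological_space
begin

definition open_away_adele :: "'a away_adele set \<Rightarrow> bool" where
  "open (U :: 'a away_adele set) \<longleftrightarrow>
    (\<forall>x\<in>U. \<exists>N>0. \<forall>w. x + away_of_zhat (of_nat N * w) \<in> U)"

instance
proof
  show "open (UNIV :: 'a away_adele set)" by (auto simp: open_away_adele_def)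
next
  fix S T :: "'a away_adele set"
  assume S: "open S" and T: "open T"
  show "open (S \<inter> T)"
    unfolding open_away_adele_def
  proof
    fix x assume "x \<in> S \<inter> T"
    then obtain M N :: nat where MN: "M > 0" "N > 0"
      and M: "\<And>w. x + away_of_zhat (of_nat M * w) \<in> S"
      and N: "\<And>w. x + away_of_zhat (of_nat N * w) \<in> T"
      using S T unfolding open_away_adele_def by blast
    have "x + away_of_zhat (of_nat (M * N) * w) \<in> S \<inter> T" for w
      using M[of "of_nat N * w"] N[of "of_nat M * w"] by (simp add: ac_simps)
    then show "\<exists>N>0. \<forall>w. x + away_of_zhat (of_nat N * w) \<in> S \<inter> T"
      using MN by (intro exI[of _ "M * N"]) simp
  qed
next
  fix \<U> :: "'a away_adele set set"
  assume "\<forall>S\<in>\<U>. open S"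
  then show "open (\<Union>\<U>)" unfolding open_away_adele_def by (meson Union_iff)
qed

end

section \<open>Quaternion algebras\<close>

text \<open>
  The quaternion algebra $(\alpha, \beta)$ over a commutative ring: $(x_0, x_1, x_2, x_3)$ stands for
  $x_0 + x_1 i + x_2 j + x_3 k$ with $i^2 = \alpha$, $j^2 = \beta$, $k = ij = -ji$.
\<close>

type_synonym 'r quat = "'r \<times> 'r \<times> 'r \<times> 'r"

fun quat_mult :: "'r::comm_ring_1 \<Rightarrow> 'r \<Rightarrow> 'r quat \<Rightarrow> 'r quat \<Rightarrow> 'r quat" where
  "quat_mult \<alpha> \<beta> (x0, x1, x2, x3) (y0, y1, y2, y3) =
    (x0 * y0 + \<alpha> * x1 * y1 + \<beta> * x2 * y2 - \<alpha> * \<beta> * x3 * y3,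
     x0 * y1 + x1 * y0 - \<beta> * x2 * y3 + \<beta> * x3 * y2,
     x0 * y2 + x2 * y0 + \<alpha> * x1 * y3 - \<alpha> * x3 * y1,
     x0 * y3 + x3 * y0 + x1 * y2 - x2 * y1)"

fun quat_add :: "'r::comm_ring_1 quat \<Rightarrow> 'r quat \<Rightarrow> 'r quat" where
  "quat_add (x0, x1, x2, x3) (y0, y1, y2, y3) = (x0 + y0, x1 + y1, x2 + y2, x3 + y3)"

definition quat_of :: "'r::comm_ring_1 \<Rightarrow> 'r quat" where
  "quat_of c = (c, 0, 0, 0)"

definition quat_alg :: "'r::comm_ring_1 \<Rightarrow> 'r \<Rightarrow> 'r quat ring" where
  "quat_alg \<alpha> \<beta> = \<lparr>carrier = UNIV, monoid.mult = quat_mult \<alpha> \<beta>, one = quat_of 1,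
     zero = quat_of 0, add = quat_add\<rparr>"

lemma ring_quat_alg: "Ring.ring (quat_alg \<alpha> \<beta>)"
proof (rule ringI)
  show "abelian_group (quat_alg \<alpha> \<beta>)"
  proof (rule abelian_groupI)
    fix x assume "x \<in> carrier (quat_alg \<alpha> \<beta>)"
    obtain x0 x1 x2 x3 where x: "x = (x0, x1, x2, x3)" by (metis prod.exhaust)
    show "\<exists>y\<in>carrier (quat_alg \<alpha> \<beta>). y \<oplus>\<^bsub>quat_alg \<alpha> \<beta>\<^esub> x = \<zero>\<^bsub>quat_alg \<alpha> \<beta>\<^esub>"
      by (rule bexI[of _ "(- x0, - x1, - x2, - x3)"]) (auto simp: quat_alg_def quat_of_def x)
  qed (auto simp: quat_alg_def quat_of_def algebra_simps)
  show "Group.monoid (quat_alg \<alpha> \<beta>)"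
    by (rule monoidI) (auto simp: quat_alg_def quat_of_def algebra_simps)
qed (auto simp: quat_alg_def algebra_simps)

text \<open>The structure map of a commutative ring in which all nonzero integers are invertible.\<close>

definition rat_in :: "rat \<Rightarrow> 'r::comm_ring_1" where
  "rat_in r = (case quotient_of r of (m, n) \<Rightarrow> of_int m * (THE y. of_int n * y = 1))"

definition definite_quat :: "rat \<Rightarrow> rat \<Rightarrow> bool" where
  "definite_quat \<alpha> \<beta> \<longleftrightarrow> \<alpha> \<noteq> 0 \<and> \<beta> \<noteq> 0 \<and>
    Units (quat_alg (real_of_rat \<alpha>) (real_of_rat \<beta>)) = UNIV - {quat_of 0}"

abbreviation D_p :: "rat \<Rightarrow> rat \<Rightarrow> 'p::prime_card padic quat ring" where
  "D_p \<alpha> \<beta> \<equiv> quat_alg (rat_in \<alpha>) (rat_in \<beta>)"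

abbreviation D_away :: "rat \<Rightarrow> rat \<Rightarrow> 'p::prime_card away_adele quat ring" where
  "D_away \<alpha> \<beta> \<equiv> quat_alg (rat_in \<alpha>) (rat_in \<beta>)"

text \<open>The multiplicative monoid of $D \otimes \mathbb{A}_f$, where
  $\mathbb{A}_f = \mathbb{Q}_p \times \mathbb{A}_f^{(p)}$.\<close>

definition D_fin :: "rat \<Rightarrow> rat \<Rightarrow> ('p::prime_card padic quat \<times> 'p away_adele quat) monoid" where
  "D_fin \<alpha> \<beta> = D_p \<alpha> \<beta> \<times>\<times> D_away \<alpha> \<beta>"

definition quat_map :: "('r \<Rightarrow> 's) \<Rightarrow> 'r quat \<Rightarrow> 's quat" where
  "quat_map f = map_prod f (map_prod f (map_prod f f))"

definition global_units :: "rat \<Rightarrow> rat \<Rightarrow> ('p::prime_card padic quat \<times> 'p away_adele quat) set" where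
  "global_units \<alpha> \<beta> = (\<lambda>\<delta>. (quat_map rat_in \<delta>, quat_map rat_in \<delta>)) ` Units (quat_alg \<alpha> \<beta>)"

definition splitting :: "rat \<Rightarrow> rat \<Rightarrow> ('p::prime_card padic quat \<Rightarrow> 'p padic mat) \<Rightarrow> bool" where
  "splitting \<alpha> \<beta> \<theta> \<longleftrightarrow> \<theta> \<in> ring_iso (D_p \<alpha> \<beta>) (ring_mat TYPE('p padic) 2 ()) \<and>
    (\<forall>c. \<theta> (quat_of c) = c \<cdot>\<^sub>m 1\<^sub>m 2)"

text \<open>
  The unit group carries the topology induced by $x \mapsto (x, x^{-1})$, not the subspace topology.
\<close>

definition open_compact_subgroup ::
    "'r::{comm_ring_1,topological_space} quat ring \<Rightarrow> 'r quat set \<Rightarrow> bool" where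
  "open_compact_subgroup A K \<longleftrightarrow> subgroup K (units_of A) \<and>
    (\<exists>W. open W \<and> K = {x \<in> Units A. (x, inv\<^bsub>A\<^esub> x) \<in> W}) \<and>
    compact ((\<lambda>x. (x, inv\<^bsub>A\<^esub> x)) ` K)"

section \<open>Automorphic forms\<close>

definition mat2 :: "'a \<Rightarrow> 'a \<Rightarrow> 'a \<Rightarrow> 'a \<Rightarrow> 'a mat" where
  "mat2 a b c d = mat_of_rows_list 2 [[a, b], [c, d]]"

definition iwahori :: "'p::prime_card padic_int mat set" where
  "iwahori = {mat2 a b c d | a b c d. a dvd 1 \<and> of_nat (lev TYPE('p)) dvd c \<and> d dvd 1}"

text \<open>The element of $(D \otimes \mathbb{A}_f)^\times$ that is $g$ at $p$ and $1$ elsewhere.\<close>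

definition at_p :: "('p::prime_card padic quat \<Rightarrow> 'p padic mat) \<Rightarrow> 'p padic_int mat \<Rightarrow>
    'p padic quat \<times> 'p away_adele quat" where
  "at_p \<theta> g = (the_inv_into UNIV \<theta> (map_mat to_fract g), quat_of 1)"

definition away_p :: "'p::prime_card away_adele quat \<Rightarrow> 'p padic quat \<times> 'p away_adele quat" where
  "away_p k = (quat_of 1, k)"

definition level_group :: "('p::prime_card padic quat \<Rightarrow> 'p padic mat) \<Rightarrow> 'p away_adele quat set \<Rightarrow>
    ('p padic quat \<times> 'p away_adele quat) set" where
  "level_group \<theta> K = {(fst (at_p \<theta> u), k) | u k. u \<in> iwahori \<and> k \<in> K}"

definition neat :: "rat \<Rightarrow> rat \<Rightarrow> ('p::prime_card padic quat \<Rightarrow> 'p padic mat) \<Rightarrow>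
    'p away_adele quat set \<Rightarrow> bool" where
  "neat \<alpha> \<beta> \<theta> K \<longleftrightarrow> (\<forall>x\<in>Units (D_fin \<alpha> \<beta>).
    {inv\<^bsub>D_fin \<alpha> \<beta>\<^esub> x \<otimes>\<^bsub>D_fin \<alpha> \<beta>\<^esub> \<delta> \<otimes>\<^bsub>D_fin \<alpha> \<beta>\<^esub> x | \<delta>. \<delta> \<in> global_units \<alpha> \<beta>} \<inter> level_group \<theta> K
      = {\<one>\<^bsub>D_fin \<alpha> \<beta>\<^esub>})"

definition double_coset :: "rat \<Rightarrow> rat \<Rightarrow> ('p::prime_card padic quat \<Rightarrow> 'p padic mat) \<Rightarrow>
    'p away_adele quat set \<Rightarrow> 'p padic quat \<times> 'p away_adele quat \<Rightarrow>
    ('p padic quat \<times> 'p away_adele quat) set" where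
  "double_coset \<alpha> \<beta> \<theta> K x =
    {\<delta> \<otimes>\<^bsub>D_fin \<alpha> \<beta>\<^esub> x \<otimes>\<^bsub>D_fin \<alpha> \<beta>\<^esub> u | \<delta> u. \<delta> \<in> global_units \<alpha> \<beta> \<and> u \<in> level_group \<theta> K}"

text \<open>
  The right action of $g$ with bottom right entry prime to $p$; the division in $\mathbb{Z}_p$ is
  then by a unit.
\<close>

definition slash :: "('p::prime_card padic_int \<Rightarrow> 'p iwasawa) \<Rightarrow> 'p padic_int mat \<Rightarrow>
    'p padic_int \<Rightarrow> 'p iwasawa" where
  "slash h g z =
    (let a = g $$ (0, 0); b = g $$ (0, 1); c = g $$ (1, 0); d = g $$ (1, 1)
     in univ_char (c * z + d) * h ((a * z + b) div (c * z + d)))"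

type_synonym 'p form =
  "'p padic quat \<times> 'p away_adele quat \<Rightarrow> 'p padic_int \<Rightarrow> 'p iwasawa"

definition forms :: "rat \<Rightarrow> rat \<Rightarrow> ('p::prime_card padic quat \<Rightarrow> 'p padic mat) \<Rightarrow>
    'p away_adele quat set \<Rightarrow> 'p form set" where
  "forms \<alpha> \<beta> \<theta> K = {\<phi> \<in> Units (D_fin \<alpha> \<beta>) \<rightarrow>\<^sub>E {h. continuous_on UNIV h}.
    (\<forall>x\<in>Units (D_fin \<alpha> \<beta>).
      (\<forall>\<delta>\<in>global_units \<alpha> \<beta>. \<phi> (\<delta> \<otimes>\<^bsub>D_fin \<alpha> \<beta>\<^esub> x) = \<phi> x) \<and>
      (\<forall>k\<in>K. \<phi> (x \<otimes>\<^bsub>D_fin \<alpha> \<beta>\<^esub> away_p k) = \<phi> x) \<and>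
      (\<forall>u\<in>iwahori. \<phi> (x \<otimes>\<^bsub>D_fin \<alpha> \<beta>\<^esub> at_p \<theta> u) = slash (\<phi> x) u))}"

definition Up_rep :: "nat \<Rightarrow> 'p::prime_card padic_int mat" where
  "Up_rep j = mat2 (of_nat (CARD('p))) 0 (of_nat (j * lev TYPE('p))) 1"

definition Up :: "rat \<Rightarrow> rat \<Rightarrow> ('p::prime_card padic quat \<Rightarrow> 'p padic mat) \<Rightarrow> 'p form \<Rightarrow> 'p form" where
  "Up \<alpha> \<beta> \<theta> \<phi> = (\<lambda>g\<in>Units (D_fin \<alpha> \<beta>). \<lambda>z.
    \<Sum>j<CARD('p). slash (\<phi> (g \<otimes>\<^bsub>D_fin \<alpha> \<beta>\<^esub> inv\<^bsub>D_fin \<alpha> \<beta>\<^esub> (at_p \<theta> (Up_rep j)))) (Up_rep j) z)"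

text \<open>The division by \<^term>\<open>fact k\<close> is exact.\<close>

definition padic_binom :: "'p::prime_card padic_int \<Rightarrow> nat \<Rightarrow> 'p padic_int" where
  "padic_binom z k = (\<Prod>i<k. z - of_nat i) div fact k"

text \<open>
  The basis vector with index \<open>n = t * k + i\<close>, \<open>i < t\<close>, is $\binom{z_i}{k}$; \<open>basis_value t n j\<close> is
  its component in the $j$-th summand.
\<close>

definition basis_value :: "nat \<Rightarrow> nat \<Rightarrow> nat \<Rightarrow> 'p::prime_card padic_int \<Rightarrow> 'p iwasawa" where
  "basis_value t n j z = (if j = n mod t then iw_const (padic_binom z (n div t)) else 0)"

definition basis_form :: "rat \<Rightarrow> rat \<Rightarrow> ('p::prime_card padic quat \<Rightarrow> 'p padic mat) \<Rightarrow>
    'p away_adele quat set \<Rightarrow> nat \<Rightarrow> (nat \<Rightarrow> 'p padic quat \<times> 'p away_adele quat) \<Rightarrow> nat \<Rightarrow> 'p form" where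
  "basis_form \<alpha> \<beta> \<theta> K t \<gamma> n =
    (THE \<phi>. \<phi> \<in> forms \<alpha> \<beta> \<theta> K \<and> (\<forall>j<t. \<phi> (\<gamma> j) = basis_value t n j))"

text \<open>
  Coordinates with respect to the orthonormal basis: the null sequence $(c_m)$ such that
  $\phi = \sum_m c_m e_m$.
\<close>

definition coords :: "nat \<Rightarrow> (nat \<Rightarrow> 'p padic quat \<times> 'p away_adele quat) \<Rightarrow> 'p::prime_card form \<Rightarrow>
    nat \<Rightarrow> 'p iwasawa" where
  "coords t \<gamma> \<phi> = (THE c. c \<longlonglongrightarrow> 0 \<and>
    (\<forall>j<t. \<forall>z. (\<lambda>m. c m * basis_value t m j z) sums \<phi> (\<gamma> j) z))"

definition Up_matrix :: "rat \<Rightarrow> rat \<Rightarrow> ('p::prime_card padic quat \<Rightarrow> 'p padic mat) \<Rightarrow>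
    'p away_adele quat set \<Rightarrow> nat \<Rightarrow> (nat \<Rightarrow> 'p padic quat \<times> 'p away_adele quat) \<Rightarrow>
    nat \<Rightarrow> nat \<Rightarrow> 'p iwasawa" where
  "Up_matrix \<alpha> \<beta> \<theta> K t \<gamma> m n = coords t \<gamma> (Up \<alpha> \<beta> \<theta> (basis_form \<alpha> \<beta> \<theta> K t \<gamma> n)) m"

definition char_trunc :: "(nat \<Rightarrow> nat \<Rightarrow> 'r::comm_ring_1) \<Rightarrow> nat \<Rightarrow> 'r fps" where
  "char_trunc P n = det (1\<^sub>m n - fps_X \<cdot>\<^sub>m mat n n (\<lambda>(i, j). fps_const (P i j)))"

definition char_series :: "(nat \<Rightarrow> nat \<Rightarrow> 'p::prime_card iwasawa) \<Rightarrow> 'p iwasawa fps" where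
  "char_series P = (THE C. iw_fps_limit (char_trunc P) C)"

end

theory Submission
  imports Defs "HOL-Number_Theory.Modular_Inverse"
begin

text \<open>
  All coefficients $c_n$ already lie in $\mathfrak{m}_\Lambda^{\lambda(n)}$; the statement over
  $\Lambda^{>1/p}$ follows because $p = T \cdot (p T^{-1})$ there. By neatness a form is given by
  arbitrary continuous functions at the $\gamma_i$, and each block of $U_p$ is a sum of operators $\|_g$ with
  $g = (a, b; c, d)$, $p \mid a$, $q \mid c$, $p \nmid d$. The Mahler
  coefficients of $\binom{z}{n} \|_g = [cz+d] \binom{(az+b)/(cz+d)}{n}$ are finite differences at $0$.
  The generating function over $n$ is $E(cz+d, (az+b)/(cz+d))$ for the character
  $E(w, x) = [w] (1+X)^x$, and repeated use of $\Delta E(w, f) = E(w, f) (E(w(z+1)/w(z), \Delta f) - 1)$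
  shows that the $m$-th coefficient lies in $\mathfrak{m}_\Lambda^{m - \lfloor n/p \rfloor}$. Hence the
  principal minor of $P$ on a set $S$ of indices lies in the power of $\mathfrak{m}_\Lambda$ with
  exponent $\sum_{i \in S} (\lfloor i/t \rfloor - \lfloor i/(pt) \rfloor) \geq \lambda(\# S)$.
\<close>

text \<open>A single function [w] binom(x, n) is not multiplicative in (w, x); only all n together
  are. This is why the estimate is made on power series in X, with a loss depending on the degree n.
  In the matrix the loss depends on the column alone, so it adds up to the same total along every
  permutation of S, and the terms of a minor can be estimated one by one.

  The main obstacle is the weight: T controls [exp(q)] only, while [w] - 1 has to be estimated for
  every w congruent to 1 mod q p^k. Such a w is a limit of powers of exp(q), which requires
  exp(q)^(p^a) = 1 + q p^a mod q p^(a+1) and the closedness of the powers of (p, T). Elements of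
  \<Lambda> are encoded as measures, so completeness is first obtained for the profinite topology
  and then transferred.

  The basis forms, the coordinates, the characteristic series and the infinite sum exp(q) are given
  by definite descriptions, so existence and uniqueness have to be settled before any estimate
  applies to them.\<close>

section \<open>Divisibility and completeness in $\mathbb{Z}_p$\<close>

lemma residue_of_nat_power:
  "residue (of_nat (CARD('p)) ^ k :: 'p::prime_card padic_int) n = int (CARD('p)) ^ k mod int (CARD('p)) ^ n"
  using residue_of_nat[of "CARD('p) ^ k" n, where 'p='p] by simp

lemma power_dvd_iff_residue:
  "of_nat (CARD('p)) ^ n dvd (x::'p::prime_card padic_int) \<longleftrightarrow> residue x n = 0"
proof
  assume "of_nat (CARD('p)) ^ n dvd x"
  then obtain w where "x = of_nat (CARD('p)) ^ n * w" by (rule dvdE)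
  then show "residue x n = 0" by (simp add: times_padic_int.rep_eq residue_of_nat_power)
next
  assume 0: "residue x n = 0"
  let ?p = "int (CARD('p))"
  \<comment> \<open>Division by p^n costs n digits: the quotient modulo p^m is read off from x
    modulo p^(m+n).\<close>
  define y :: "'p padic_int" where "y = Abs_padic_int (\<lambda>m. residue x (m + n) div ?p ^ n)"
  have y: "residue y m = residue x (m + n) div ?p ^ n" for m
  proof -
    have "residue x (Suc m + n) div ?p ^ n mod ?p ^ m = residue x (m + n) div ?p ^ n" for m
    proof -
      have "residue x (Suc m + n) div ?p ^ n mod ?p ^ m
          = (residue x (Suc m + n) mod (?p ^ n * ?p ^ m)) div ?p ^ n"
        by (subst zmod_zmult2_eq) (simp_all add: div_add1_eq)
      also have "?p ^ n * ?p ^ m = ?p ^ (m + n)" by (simp add: power_add)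
      also have "residue x (Suc m + n) mod ?p ^ (m + n) = residue x (m + n)"
        by (simp add: residue_Suc)
      finally show ?thesis .
    qed
    then show ?thesis unfolding y_def by (subst Abs_padic_int_inverse) auto
  qed
  have "residue (of_nat (CARD('p)) ^ n * y) m = residue x m" for m
  proof -
    have "residue x (m + n) mod ?p ^ n = 0" using residue_le[of n "m + n" x] 0 by simp
    then have "?p ^ n * (residue x (m + n) div ?p ^ n) = residue x (m + n)" by auto
    then show ?thesis
      using residue_le[of m "m + n" x]
      by (simp add: times_padic_int.rep_eq residue_of_nat_power y mod_mult_left_eq)
  qed
  then have "x = of_nat (CARD('p)) ^ n * y" by (metis residue_inject ext)
  then show "of_nat (CARD('p)) ^ n dvd x" by (rule dvdI)
qed

lemma power_dvd_diff_iff_residue: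
  "of_nat (CARD('p)) ^ n dvd x - (y::'p::prime_card padic_int) \<longleftrightarrow> residue x n = residue y n"
proof -
  have "residue (x - y) n = 0 \<longleftrightarrow> residue x n mod int (CARD('p)) ^ n = residue y n mod int (CARD('p)) ^ n"
    by (simp only: minus_padic_int.rep_eq mod_eq_dvd_iff dvd_eq_mod_eq_0)
  then show ?thesis by (simp add: power_dvd_iff_residue)
qed

lemma padic_int_eq_0I:
  assumes "\<And>n. n \<ge> m \<Longrightarrow> of_nat (CARD('p)) ^ n dvd (x::'p::prime_card padic_int)"
  shows "x = 0"
proof -
  have "residue x n = 0" for n
    using assms[of "max m n"] by (metis power_dvd_iff_residue le_imp_power_dvd max.cobounded1 max.cobounded2 dvd_trans)
  then show ?thesis by (simp add: padic_int_eq_0_iff)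
qed

lemma padic_int_approx_nat:
  obtains k where "of_nat (CARD('p)) ^ n dvd (x::'p::prime_card padic_int) - of_nat k"
proof
  have "residue x n \<ge> 0" using residue_mod[of x n] by (metis prm_pow_pos pos_mod_sign)
  then have "residue (of_nat (nat (residue x n)) :: 'p padic_int) n = residue x n"
    unfolding residue_of_nat by (metis nat_0_le residue_mod)
  then show "of_nat (CARD('p)) ^ n dvd x - of_nat (nat (residue x n))"
    by (simp add: power_dvd_diff_iff_residue)
qed

text \<open>Level n of the limit is the residue of \<open>x n\<close>, so the rate of convergence is
  part of the hypothesis. The offset m serves sequences whose congruences begin only at level m,
  such as the masses at a fixed level in \<open>small_complete\<close>.\<close>

lemma padic_int_complete:
  fixes x :: "nat \<Rightarrow> 'p::prime_card padic_int"
  assumes "\<And>n. n \<ge> m \<Longrightarrow> of_nat (CARD('p)) ^ n dvd x (Suc n) - x n"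
  obtains L where "\<And>n. n \<ge> m \<Longrightarrow> of_nat (CARD('p)) ^ n dvd L - x n"
proof -
  define y where "y n = x (max m n)" for n
  have y: "of_nat (CARD('p)) ^ n dvd y (Suc n) - y n" for n
    using assms[of n] by (cases "m \<le> n") (auto simp: y_def max_def dest: antisym)
  define L :: "'p padic_int" where "L = Abs_padic_int (\<lambda>n. residue (y n) n)"
  have L: "residue L n = residue (y n) n" for n
  proof -
    have "residue (y (Suc n)) (Suc n) mod int (CARD('p)) ^ n = residue (y n) n" for n
      using y[of n] by (simp add: residue_Suc power_dvd_diff_iff_residue)
    then show ?thesis unfolding L_def by (subst Abs_padic_int_inverse) auto
  qed
  show ?thesis
    by (rule that[of L]) (simp add: power_dvd_diff_iff_residue L y_def max_def)
qed

lemma padic_int_unit_iff: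
  "(x::'p::prime_card padic_int) dvd 1 \<longleftrightarrow> \<not> of_nat (CARD('p)) dvd x"
proof
  assume "x dvd 1"
  show "\<not> of_nat (CARD('p)) dvd x"
  proof
    assume "of_nat (CARD('p)) dvd x"
    then have "of_nat (CARD('p)) dvd (1 :: 'p padic_int)" using \<open>x dvd 1\<close> by (rule dvd_trans)
    then have "of_nat (CARD('p)) ^ 1 dvd (1 :: 'p padic_int)" by simp
    then show False unfolding power_dvd_iff_residue
      using prm_gt_1[where 'p='p] by (simp add: one_padic_int.rep_eq)
  qed
next
  assume nd: "\<not> of_nat (CARD('p)) dvd x"
  let ?p = "int (CARD('p))"
  have p: "prime ?p" using prime_prm[where 'p='p] by simp
  have "\<not> ?p dvd residue x n" if "n > 0" for n
  proof
    assume "?p dvd residue x n"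
    moreover have "residue x n mod ?p = residue x 1"
      using residue_le[of 1 n x] that by simp
    ultimately have "residue x 1 = 0" by (metis dvd_imp_mod_0)
    then show False using nd power_dvd_iff_residue[of 1 x] by simp
  qed
  then have cop: "coprime (residue x n) (?p ^ n)" for n
    using p by (cases "n = 0") (simp_all add: prime_imp_coprime coprime_commute[of "residue x n"])
  define b where "b n = modular_inverse (?p ^ n) (residue x n)" for n
  have b: "residue x n * b n mod ?p ^ n = 1 mod ?p ^ n" for n
    using cong_modular_inverse1[OF cop[of n]] unfolding b_def cong_def by simp
  have bm: "b n mod ?p ^ n = b n" for n
    unfolding b_def by (rule mod_pos_pos_trivial) (simp_all add: modular_inverse_int_nonneg modular_inverse_int_less)
  \<comment> \<open>Inverses modulo p^n are unique, and both sides invert x there; hence the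
    inverses chosen level by level are compatible.\<close>
  have "b (Suc n) mod ?p ^ n = b n" for n
  proof -
    have "residue x (Suc n) * b (Suc n) mod ?p ^ n = 1 mod ?p ^ n"
    proof -
      have "residue x (Suc n) * b (Suc n) mod ?p ^ n
          = (residue x (Suc n) * b (Suc n) mod ?p ^ Suc n) mod ?p ^ n" by (simp add: mod_mod_cancel)
      also have "\<dots> = 1 mod ?p ^ n" unfolding b by (simp add: mod_mod_cancel)
      finally show ?thesis .
    qed
    then have "residue x n * b (Suc n) mod ?p ^ n = 1 mod ?p ^ n"
      using residue_Suc[of x n] by (metis mod_mult_left_eq)
    then have "b n * (residue x n * b (Suc n)) mod ?p ^ n = b n mod ?p ^ n"
      by (metis mod_mult_right_eq mult.right_neutral)
    moreover have "b n * (residue x n * b (Suc n)) mod ?p ^ n = b (Suc n) mod ?p ^ n"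
      using b[of n] by (metis mod_mult_left_eq mult.assoc mult.commute mult.right_neutral)
    ultimately show ?thesis by (simp add: bm)
  qed
  then have "residue (Abs_padic_int b :: 'p padic_int) = b" by (intro Abs_padic_int_inverse) auto
  then have "residue (x * Abs_padic_int b) n = residue (1 :: 'p padic_int) n" for n
    by (simp add: times_padic_int.rep_eq one_padic_int.rep_eq b)
  then have "x * Abs_padic_int b = 1" by (metis residue_inject ext)
  then show "x dvd 1" by (metis dvd_triv_left)
qed

lemma unit_add_p:
  assumes "(x::'p::prime_card padic_int) dvd 1" "of_nat (CARD('p)) dvd y - x"
  shows "y dvd 1"
  unfolding padic_int_unit_iff
proof
  assume "of_nat (CARD('p)) dvd y"
  then have "of_nat (CARD('p)) dvd y - (y - x)" using assms(2) by (rule dvd_diff)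
  then show False using assms(1) by (simp add: padic_int_unit_iff)
qed

lemma of_nat_unit_iff:
  "(of_nat k :: 'p::prime_card padic_int) dvd 1 \<longleftrightarrow> \<not> CARD('p) dvd k"
proof -
  have "(of_nat (CARD('p)) :: 'p padic_int) dvd of_nat k \<longleftrightarrow> int k mod int (CARD('p)) = 0"
    using power_dvd_iff_residue[of 1 "of_nat k :: 'p padic_int"] by (simp add: residue_of_nat)
  then show ?thesis unfolding padic_int_unit_iff by (simp add: mod_eq_0_iff_dvd)
qed

lemma of_nat_padic_split:
  assumes "k > 0"
  obtains m where "k = CARD('p::prime_card) ^ multiplicity (CARD('p)) k * m"
    "(of_nat m :: 'p padic_int) dvd 1"
proof -
  have "k \<noteq> 0" "\<not> is_unit (CARD('p))" using assms prm_gt_1[where 'p='p] by auto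
  then obtain m where "k = CARD('p) ^ multiplicity (CARD('p)) k * m" "\<not> CARD('p) dvd m"
    by (rule multiplicity_decompose')
  then show ?thesis using that by (simp add: of_nat_unit_iff)
qed

lemma unit_cancel_dvd:
  assumes "(u::'a::comm_ring_1) dvd 1" shows "x dvd u * y \<longleftrightarrow> x dvd y"
proof
  obtain v where v: "1 = u * v" using assms by (rule dvdE)
  assume "x dvd u * y"
  then have "x dvd v * (u * y)" by (rule dvd_mult)
  also have "v * (u * y) = u * v * y" by (simp add: ac_simps)
  finally show "x dvd y" by (simp flip: v)
qed simp

text \<open>The ideal generated by k is closed: k is a unit times p^v, so an approximation modulo
  p^v already decides divisibility.\<close>

lemma of_nat_dvd_padicI:
  assumes "k > 0" and "\<And>n. \<exists>y. of_nat k dvd (y::'p::prime_card padic_int) \<and> of_nat (CARD('p)) ^ n dvd x - y"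
  shows "of_nat k dvd x"
proof -
  obtain m where m: "k = CARD('p) ^ multiplicity (CARD('p)) k * m" "(of_nat m :: 'p padic_int) dvd 1"
    using of_nat_padic_split[OF assms(1)] .
  let ?v = "multiplicity (CARD('p)) k"
  obtain u :: "'p padic_int" where u: "1 = of_nat m * u" using m(2) by (rule dvdE)
  obtain y where y: "of_nat k dvd y" "of_nat (CARD('p)) ^ ?v dvd x - y" using assms(2) by blast
  have "(of_nat (CARD('p)) ^ ?v :: 'p padic_int) dvd of_nat k"
    by (subst m(1)) simp
  then have "of_nat (CARD('p)) ^ ?v dvd x" using y by (metis diff_add_cancel dvd_add dvd_trans)
  then obtain w where w: "x = of_nat (CARD('p)) ^ ?v * w" by (rule dvdE)
  have "x = (of_nat (CARD('p)) ^ ?v * of_nat m) * (u * w)" using u w by (metis mult.assoc mult.left_neutral)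
  also have "of_nat (CARD('p)) ^ ?v * of_nat m = (of_nat k :: 'p padic_int)" by (subst (2) m(1)) simp
  finally show ?thesis by (rule dvdI)
qed

lemma div_mult_padic:
  assumes "y \<noteq> 0" "(y::'p::prime_card padic_int) dvd x" shows "x div y * y = x"
  using assms by (metis dvdE mult.commute nonzero_mult_div_cancel_left)

section \<open>Convergence\<close>

lemma open_padic_ball: "open {y :: 'p::prime_card padic_int. of_nat (CARD('p)) ^ n dvd y - x}"
  unfolding open_padic_int_def
proof (intro ballI exI[of _ n] allI impI)
  fix z y :: "'p padic_int"
  assume "z \<in> {y. of_nat (CARD('p)) ^ n dvd y - x}" "of_nat (CARD('p)) ^ n dvd y - z"
  then have "of_nat (CARD('p)) ^ n dvd (y - z) + (z - x)" by (intro dvd_add) auto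
  then show "y \<in> {y. of_nat (CARD('p)) ^ n dvd y - x}" by simp
qed

lemma tendsto_padic_int_iff:
  "(f \<longlongrightarrow> (L :: 'p::prime_card padic_int)) F \<longleftrightarrow>
    (\<forall>n. eventually (\<lambda>i. of_nat (CARD('p)) ^ n dvd f i - L) F)"
proof
  assume "(f \<longlongrightarrow> L) F"
  then show "\<forall>n. eventually (\<lambda>i. of_nat (CARD('p)) ^ n dvd f i - L) F"
    using topological_tendstoD[OF _ open_padic_ball, of f L F _ L] by simp
next
  assume ev: "\<forall>n. eventually (\<lambda>i. of_nat (CARD('p)) ^ n dvd f i - L) F"
  show "(f \<longlongrightarrow> L) F"
  proof (rule topological_tendstoI)
    fix S assume "open S" "L \<in> S"
    then obtain n where "\<And>y. of_nat (CARD('p)) ^ n dvd y - L \<Longrightarrow> y \<in> S"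
      unfolding open_padic_int_def by blast
    then show "eventually (\<lambda>i. f i \<in> S) F"
      using ev by (metis (mono_tags, lifting) eventually_mono)
  qed
qed

text \<open>Uniqueness of limits is what identifies the infinite sum in \<open>padic_exp\<close>
  with the limit of its partial sums.\<close>

instance padic_int :: (prime_card) t2_space
proof
  fix x y :: "'a padic_int"
  assume "x \<noteq> y"
  then obtain n where n: "\<not> of_nat (CARD('a)) ^ n dvd x - y"
    using padic_int_eq_0I[of 0 "x - y"] by auto
  have "{z. of_nat (CARD('a)) ^ n dvd z - x} \<inter> {z. of_nat (CARD('a)) ^ n dvd z - y} = {}"
  proof (rule ccontr)
    assume "\<not> ?thesis"
    then obtain z where "of_nat (CARD('a)) ^ n dvd z - x" "of_nat (CARD('a)) ^ n dvd z - y" by blast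
    then have "of_nat (CARD('a)) ^ n dvd (z - y) - (z - x)" by (rule dvd_diff[rotated])
    then show False using n by simp
  qed
  then show "\<exists>U V. open U \<and> open V \<and> x \<in> U \<and> y \<in> V \<and> U \<inter> V = {}"
    using open_padic_ball[of n x] open_padic_ball[of n y]
    by (intro exI[of _ "{z. of_nat (CARD('a)) ^ n dvd z - x}"] exI[of _ "{z. of_nat (CARD('a)) ^ n dvd z - y}"]) auto
qed

lemma padic_summable:
  fixes f :: "nat \<Rightarrow> 'p::prime_card padic_int"
  assumes "\<And>n. \<exists>N. \<forall>k\<ge>N. of_nat (CARD('p)) ^ n dvd f k"
  shows "summable f"
proof -
  obtain N where N: "\<And>n k. k \<ge> N n \<Longrightarrow> of_nat (CARD('p)) ^ n dvd f k" using assms by metis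
  \<comment> \<open>Monotone thresholds: the partial sums at M n then satisfy the congruence at
    level n that completeness asks for.\<close>
  define M where "M n = (\<Sum>i\<le>n. N i)" for n
  have M: "M n \<ge> N n" "M n \<le> M (Suc n)" for n
    unfolding M_def by (auto intro: member_le_sum)
  define s where "s n = (\<Sum>i<n. f i)" for n
  have tail: "of_nat (CARD('p)) ^ n dvd s k - s (M n)" if "k \<ge> M n" for k n
  proof -
    have "s k - s (M n) = (\<Sum>i=M n..<k. f i)"
      unfolding s_def using that by (simp add: sum_diff_nat_ivl atLeast0LessThan[symmetric])
    also have "of_nat (CARD('p)) ^ n dvd \<dots>"
      using M(1)[of n] by (intro dvd_sum N) auto
    finally show ?thesis .
  qed
  obtain L where L: "\<And>n. n \<ge> 0 \<Longrightarrow> of_nat (CARD('p)) ^ n dvd L - s (M n)"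
    using padic_int_complete[of 0 "\<lambda>n. s (M n)"] tail M(2) by blast
  have "s \<longlonglongrightarrow> L" unfolding tendsto_padic_int_iff
  proof
    fix n
    have "of_nat (CARD('p)) ^ n dvd s k - L" if "k \<ge> M n" for k
      using dvd_diff[OF tail[OF that] L[of n]] by simp
    then show "eventually (\<lambda>i. of_nat (CARD('p)) ^ n dvd s i - L) sequentially"
      unfolding eventually_sequentially by blast
  qed
  then show ?thesis unfolding summable_def sums_def s_def by blast
qed

section \<open>Powers of $\exp(q)$\<close>

lemma power_minus_1_sum: "(y::'a::comm_ring_1) ^ n - 1 = (y - 1) * (\<Sum>i<n. y ^ i)"
  by (rule power_diff_1_eq)

lemma dvd_power_minus_1: "(y::'a::comm_ring_1) - 1 dvd y ^ n - 1"
  unfolding power_minus_1_sum by (rule dvd_triv_left)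

lemma dvd_sum_power_minus: "(y::'a::comm_ring_1) - 1 dvd (\<Sum>i<n. y ^ i) - of_nat n"
proof -
  have "(\<Sum>i<n. y ^ i) - of_nat n = (\<Sum>i<n. y ^ i - 1)" by (simp add: sum_subtractf)
  then show ?thesis by (simp add: dvd_sum dvd_power_minus_1)
qed

text \<open>One step of Legendre's formula: there are n div p multiples of p up to n, and dividing
  them by p leaves the numbers up to n div p.\<close>

lemma multiplicity_fact_div:
  assumes "prime (p::nat)"
  shows "multiplicity p (fact n) = n div p + multiplicity p (fact (n div p))"
proof (induction n)
  case 0
  show ?case by simp
next
  case (Suc n)
  have mult: "multiplicity p (fact (Suc m)) = multiplicity p (Suc m) + multiplicity p (fact m)" for m
    using assms by (simp add: prime_elem_multiplicity_mult_distrib del: mult_Suc)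
  show ?case
  proof (cases "p dvd Suc n")
    case False
    then have "multiplicity p (Suc n) = 0" by (rule not_dvd_imp_multiplicity_0)
    moreover have "Suc n div p = n div p" using False by (simp add: div_Suc dvd_eq_mod_eq_0)
    ultimately show ?thesis using Suc mult[of n] by simp
  next
    case True
    then have d: "Suc n div p = Suc (n div p)" by (simp add: div_Suc dvd_eq_mod_eq_0)
    then have "Suc n = p * Suc (n div p)" using True by (metis dvd_mult_div_cancel)
    then have "multiplicity p (Suc n) = Suc (multiplicity p (Suc (n div p)))"
      using assms by (metis multiplicity_times_same nat.distinct(1) prime_nat_iff not_prime_0 not_is_unit_0 prime_def prime_elem_def)
    then show ?thesis using Suc mult[of n] mult[of "n div p"] d by simp
  qed
qed

text \<open>Strictness matters: for p = 2 it gives v(n!) <= n - 1, so that 4^n / n! is divisible by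
  2^(n+1).\<close>

lemma multiplicity_fact_less:
  assumes "prime (p::nat)" "n > 0"
  shows "(p - 1) * multiplicity p (fact n) < n"
  using assms(2)
proof (induction n rule: less_induct)
  case (less n)
  have p: "p > 1" using assms(1) prime_gt_1_nat by blast
  let ?m = "n div p"
  show ?case
  proof (cases "?m = 0")
    case True
    then show ?thesis using less.prems multiplicity_fact_div[OF assms(1), of n] by simp
  next
    case False
    have "(p - 1) * multiplicity p (fact ?m) < ?m"
      using less.IH[of ?m] False p less.prems by simp
    then have "(p - 1) * ?m + (p - 1) * multiplicity p (fact ?m) < (p - 1) * ?m + ?m" by simp
    also have "(p - 1) * ?m + ?m = p * ?m" using p by (cases p) auto
    also have "\<dots> \<le> n" by simp
    finally show ?thesis
      using multiplicity_fact_div[OF assms(1), of n] by (simp add: distrib_left)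
  qed
qed

definition lev_exp :: "'p::prime_card itself \<Rightarrow> nat" where
  "lev_exp P = (if CARD('p) = 2 then 2 else 1)"

lemma lev_eq_power: "lev TYPE('p::prime_card) = CARD('p) ^ lev_exp TYPE('p)"
  by (simp add: lev_def lev_exp_def)

lemma lev_exp_ge_1: "lev_exp TYPE('p::prime_card) \<ge> 1"
  by (simp add: lev_exp_def)

lemma exp_term_dvd:
  assumes "j + multiplicity (CARD('p)) (fact n :: nat) \<le> lev_exp TYPE('p::prime_card) * n"
  shows "of_nat (CARD('p)) ^ j dvd (of_nat (lev TYPE('p)) ^ n div fact n :: 'p padic_int)"
proof -
  let ?v = "multiplicity (CARD('p)) (fact n :: nat)" and ?e = "lev_exp TYPE('p) * n"
  obtain m where m: "fact n = CARD('p) ^ ?v * m" "(of_nat m :: 'p padic_int) dvd 1"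
    using of_nat_padic_split[of "fact n", where 'p='p] by auto
  obtain u :: "'p padic_int" where u: "1 = of_nat m * u" using m(2) by (rule dvdE)
  have f: "(fact n :: 'p padic_int) = of_nat (CARD('p)) ^ ?v * of_nat m"
    using m(1) by (metis of_nat_fact of_nat_mult of_nat_power)
  have "(of_nat (CARD('p)) ^ (?e - ?v) * u) * (fact n :: 'p padic_int)
      = of_nat (CARD('p)) ^ (?e - ?v + ?v) * (of_nat m * u)"
    unfolding f power_add by (simp add: ac_simps)
  also have "\<dots> = of_nat (lev TYPE('p)) ^ n"
    using assms by (simp add: lev_eq_power power_mult flip: u)
  finally have "of_nat (lev TYPE('p)) ^ n div fact n = of_nat (CARD('p)) ^ (?e - ?v) * (u :: 'p padic_int)"
    by (metis nonzero_mult_div_cancel_right fact_nonzero)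
  moreover have "of_nat (CARD('p)) ^ j dvd (of_nat (CARD('p)) ^ (?e - ?v) :: 'p padic_int)"
    using assms by (intro le_imp_power_dvd) simp
  ultimately show ?thesis by simp
qed

lemma multiplicity_fact_prm:
  assumes "n > 0"
  shows "if CARD('p::prime_card) = 2 then multiplicity (CARD('p)) (fact n :: nat) < n
    else 2 * multiplicity (CARD('p)) (fact n :: nat) < n"
proof -
  have *: "(CARD('p) - 1) * multiplicity (CARD('p)) (fact n :: nat) < n"
    by (rule multiplicity_fact_less[OF prime_prm assms])
  show ?thesis
  proof (cases "CARD('p) = 2")
    case False
    then have "2 \<le> CARD('p) - 1" using prm_gt_1[where 'p='p] by simp
    then have "2 * multiplicity (CARD('p)) (fact n :: nat) \<le> (CARD('p) - 1) * multiplicity (CARD('p)) (fact n :: nat)"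
      by (rule mult_right_mono) simp
    then have "2 * multiplicity (CARD('p)) (fact n :: nat) < n" using * by (rule le_less_trans)
    then show ?thesis using False by simp
  qed (use * in simp)
qed

definition gam :: "'p::prime_card padic_int" where
  "gam = padic_exp (of_nat (lev TYPE('p)))"

text \<open>Modulo p q only the terms of degree 0 and 1 of the exponential series survive.\<close>

lemma gam_cong:
  "of_nat (CARD('p)) ^ (lev_exp TYPE('p) + 1) dvd (gam :: 'p::prime_card padic_int) - (1 + of_nat (lev TYPE('p)))"
proof -
  let ?e = "lev_exp TYPE('p) + 1"
  define f where "f n = (of_nat (lev TYPE('p)) ^ n div fact n :: 'p padic_int)" for n
  have "summable f"
  proof (rule padic_summable)
    fix j
    \<comment> \<open>The threshold comes from odd p, where the term has valuation n - v(n!) > n /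
      2.\<close>
    have "of_nat (CARD('p)) ^ j dvd f n" if "n \<ge> 2 * j + 1" for n
      unfolding f_def using multiplicity_fact_prm[of n, where 'p='p] that
      by (intro exp_term_dvd) (auto simp: lev_exp_def split: if_splits)
    then show "\<exists>N. \<forall>n\<ge>N. of_nat (CARD('p)) ^ j dvd f n" by blast
  qed
  then have "f sums gam" unfolding gam_def padic_exp_def f_def[symmetric] by (rule summable_sums)
  then have "eventually (\<lambda>k. of_nat (CARD('p)) ^ ?e dvd (\<Sum>i<k. f i) - gam) sequentially"
    unfolding sums_def tendsto_padic_int_iff by blast
  then obtain N where N: "\<And>k. k \<ge> N \<Longrightarrow> of_nat (CARD('p)) ^ ?e dvd (\<Sum>i<k. f i) - gam"
    unfolding eventually_sequentially by blast
  have "(\<Sum>i<Suc (Suc N). f i) = f 0 + (f 1 + (\<Sum>i<N. f (Suc (Suc i))))"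
    by (simp add: sum.lessThan_Suc_shift del: sum.lessThan_Suc)
  moreover have "f 0 = 1" "f 1 = of_nat (lev TYPE('p))"
    unfolding f_def using nonzero_mult_div_cancel_right[of "1 :: 'p padic_int"] by (auto simp: divide_padic_int_def)
  moreover have "of_nat (CARD('p)) ^ ?e dvd (\<Sum>i<N. f (Suc (Suc i)))"
    unfolding f_def
  proof (intro dvd_sum exp_term_dvd)
    fix i :: nat
    show "?e + multiplicity (CARD('p)) (fact (Suc (Suc i)) :: nat) \<le> lev_exp TYPE('p) * Suc (Suc i)"
    proof -
      define v where "v = multiplicity (CARD('p)) (fact (Suc (Suc i)) :: nat)"
      have "if CARD('p) = 2 then v < Suc (Suc i) else 2 * v < Suc (Suc i)"
        unfolding v_def by (rule multiplicity_fact_prm) simp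
      then show ?thesis unfolding v_def[symmetric] by (auto simp: lev_exp_def split: if_splits)
    qed
  qed
  ultimately show ?thesis
    using dvd_diff[OF _ N[of "Suc (Suc N)"], of "\<Sum>i<N. f (Suc (Suc i))"] by (simp add: algebra_simps)
qed

lemma lev_dvd: "of_nat (CARD('p)) dvd (of_nat (lev TYPE('p)) :: 'p::prime_card padic_int)"
  by (auto simp: lev_def intro: dvdI[of _ _ 2])

lemma gam_unit: "(gam :: 'p::prime_card padic_int) dvd 1"
proof (rule unit_add_p[of 1])
  have "of_nat (CARD('p)) dvd (gam :: 'p padic_int) - (1 + of_nat (lev TYPE('p)))"
    using gam_cong[where 'p='p] by (metis dvd_mult_left power_Suc Suc_eq_plus1)
  then have "of_nat (CARD('p)) dvd (gam :: 'p padic_int) - (1 + of_nat (lev TYPE('p))) + of_nat (lev TYPE('p))"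
    by (intro dvd_add lev_dvd)
  then show "of_nat (CARD('p)) dvd (gam :: 'p padic_int) - 1" by simp
qed simp

text \<open>For p = 2 the difference is y - 1, and q = 4 is what makes it divisible by p^2. For odd
  p one factor p comes from y - 1 and the other from the sum 0 + 1 + ... + (p - 1), which is
  divisible by p.\<close>

lemma sum_powers_cong:
  assumes "of_nat (CARD('p)) ^ lev_exp TYPE('p) dvd (y::'p::prime_card padic_int) - 1"
  shows "of_nat (CARD('p)) ^ 2 dvd (\<Sum>i<CARD('p). y ^ i) - of_nat (CARD('p))"
proof (cases "CARD('p) = 2")
  case True
  then have "(\<Sum>i<CARD('p). y ^ i) - of_nat (CARD('p)) = y - 1"
    by (simp add: numeral_2_eq_2)
  then show ?thesis using assms True by (simp add: lev_exp_def)
next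
  case False
  let ?p = "of_nat (CARD('p)) :: 'p padic_int"
  have py: "?p dvd y - 1" using assms False by (simp add: lev_exp_def)
  have "odd (CARD('p))" 
    using False prime_prm[where 'p='p] prm_gt_1[where 'p='p] by (intro prime_odd_nat) auto
  have "2 * (\<Sum>i<n. i) = n * (n - 1)" for n :: nat
  proof (induction n)
    case (Suc n)
    then show ?case by (cases n) (simp_all add: algebra_simps)
  qed simp
  then have "CARD('p) dvd 2 * (\<Sum>i<CARD('p). i)" by simp
  moreover have "coprime (CARD('p)) 2" using \<open>odd (CARD('p))\<close> by simp
  ultimately have "CARD('p) dvd (\<Sum>i<CARD('p). i)" by (metis coprime_dvd_mult_right_iff)
  then obtain k where "(\<Sum>i<CARD('p). i) = CARD('p) * k" by (rule dvdE)
  then have "of_nat (\<Sum>i<CARD('p). i) = ?p * of_nat k" by simp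
  then have s: "?p dvd (\<Sum>i<CARD('p). of_nat i)" by simp
  have "(\<Sum>i<CARD('p). y ^ i) - ?p = (\<Sum>i<CARD('p). y ^ i - 1)" by (simp add: sum_subtractf)
  also have "\<dots> = (y - 1) * (\<Sum>i<CARD('p). \<Sum>l<i. y ^ l)"
    unfolding power_minus_1_sum sum_distrib_left ..
  finally have eq: "(\<Sum>i<CARD('p). y ^ i) - ?p = (y - 1) * (\<Sum>i<CARD('p). \<Sum>l<i. y ^ l)" .
  have "?p dvd (\<Sum>i<CARD('p). (\<Sum>l<i. y ^ l) - of_nat i)"
    by (intro dvd_sum dvd_trans[OF py] dvd_sum_power_minus)
  then have "?p dvd (\<Sum>i<CARD('p). (\<Sum>l<i. y ^ l) - of_nat i) + (\<Sum>i<CARD('p). of_nat i)"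
    using s by (rule dvd_add)
  then have "?p dvd (\<Sum>i<CARD('p). \<Sum>l<i. y ^ l)" by (simp add: sum_subtractf)
  then show ?thesis unfolding eq power2_eq_square using py by (intro mult_dvd_mono)
qed

text \<open>The leading term of y - 1 is multiplied by p when y is raised to the p-th power, because
  (y^p - 1) / (y - 1) is p up to p^2.\<close>

lemma gam_power_cong:
  fixes a
  defines "E \<equiv> lev_exp TYPE('p::prime_card) + a"
  shows "of_nat (CARD('p)) ^ Suc E dvd (gam :: 'p padic_int) ^ (CARD('p) ^ a) - 1 - of_nat (CARD('p)) ^ E"
  unfolding E_def
proof (induction a)
  case 0
  show ?case using gam_cong[where 'p='p] by (simp add: lev_eq_power algebra_simps)
next
  case (Suc a)
  let ?p = "of_nat (CARD('p)) :: 'p padic_int" and ?E = "lev_exp TYPE('p) + a"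
  define y where "y = (gam :: 'p padic_int) ^ (CARD('p) ^ a)"
  obtain w where w: "y - 1 - ?p ^ ?E = ?p ^ Suc ?E * w" using Suc unfolding y_def by (rule dvdE)
  then have y: "y - 1 = ?p ^ ?E * (1 + ?p * w)" by (simp add: algebra_simps)
  have "?p ^ lev_exp TYPE('p) dvd ?p ^ ?E" by (rule le_imp_power_dvd) simp
  then have "?p ^ lev_exp TYPE('p) dvd y - 1" unfolding y by (rule dvd_mult2)
  then obtain w' where w': "(\<Sum>i<CARD('p). y ^ i) - ?p = ?p ^ 2 * w'"
    using sum_powers_cong by (metis dvdE)
  then have S: "(\<Sum>i<CARD('p). y ^ i) = ?p + ?p ^ 2 * w'" by (simp add: algebra_simps)
  have "y ^ CARD('p) - 1 = ?p ^ ?E * (1 + ?p * w) * (?p + ?p ^ 2 * w')"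
    unfolding power_minus_1_sum y S ..
  then have "y ^ CARD('p) - 1 - ?p ^ Suc ?E = ?p ^ Suc (Suc ?E) * (w' + w + ?p * w * w')"
    by (simp add: algebra_simps power2_eq_square)
  moreover have "y ^ CARD('p) = gam ^ (CARD('p) ^ Suc a)"
    unfolding y_def by (simp add: power_mult[symmetric] mult.commute)
  ultimately show ?case by simp
qed

text \<open>The quotient of 1 + q p^a Z_p by 1 + q p^(a+1) Z_p is cyclic of order p, generated by
  the class of exp(q)^(p^a).\<close>

lemma gam_approx:
  fixes y :: "'p::prime_card padic_int"
  assumes "of_nat (CARD('p)) ^ (lev_exp TYPE('p) + a) dvd y - 1"
  obtains i where "of_nat (CARD('p)) ^ (lev_exp TYPE('p) + Suc a) dvd y - gam ^ (CARD('p) ^ a * i)"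
proof -
  let ?p = "of_nat (CARD('p)) :: 'p padic_int" and ?E = "lev_exp TYPE('p) + a"
  obtain r where r: "y - 1 = ?p ^ ?E * r" using assms by (rule dvdE)
  \<comment> \<open>The exponent is the leading digit of y - 1, since exp(q)^(p^a) - 1 has leading
    digit 1.\<close>
  obtain i where "?p ^ 1 dvd r - of_nat i" by (rule padic_int_approx_nat)
  then obtain r' where r': "r = of_nat i + ?p * r'" by (metis dvdE power_one_right diff_eq_eq add.commute)
  define z where "z = (gam :: 'p padic_int) ^ (CARD('p) ^ a)"
  obtain w where w: "z - 1 - ?p ^ ?E = ?p ^ Suc ?E * w"
    using gam_power_cong[of a, where 'p='p] unfolding z_def by (rule dvdE)
  then have z: "z - 1 = ?p ^ ?E * (1 + ?p * w)" by (simp add: algebra_simps)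
  obtain s where s: "(\<Sum>l<i. z ^ l) - of_nat i = (z - 1) * s"
    using dvd_sum_power_minus[of z i] by (rule dvdE)
  then have S: "(\<Sum>l<i. z ^ l) = of_nat i + (z - 1) * s" by (metis diff_add_cancel add.commute)
  have "z ^ i - 1 = (z - 1) * (of_nat i + (z - 1) * s)"
    unfolding power_minus_1_sum S ..
  then have "y - z ^ i = (y - 1) - (z - 1) * (of_nat i + (z - 1) * s)" by (simp add: algebra_simps)
  also have "\<dots> = ?p ^ Suc ?E * (r' - w * of_nat i) - ?p ^ (?E + ?E) * ((1 + ?p * w)\<^sup>2 * s)"
    unfolding r z r' by (simp add: algebra_simps power2_eq_square power_add)
  also have "?p ^ Suc ?E dvd \<dots>"
  proof (rule dvd_diff)
    \<comment> \<open>The quadratic error term is harmless because E >= 1.\<close>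
    have "?p ^ Suc ?E dvd ?p ^ (?E + ?E)"
      using lev_exp_ge_1[where 'p='p] by (intro le_imp_power_dvd) simp
    then show "?p ^ Suc ?E dvd ?p ^ (?E + ?E) * ((1 + ?p * w)\<^sup>2 * s)" by (rule dvd_mult2)
  qed simp
  finally show ?thesis using that[of i] by (simp add: z_def power_mult)
qed

section \<open>Powers of an ideal with two generators\<close>

lemma ideal_pow_SucI: "x \<in> ideal_pow a b k \<Longrightarrow> y \<in> ideal_pow a b k \<Longrightarrow> a * x + b * y \<in> ideal_pow a b (Suc k)"
  by (simp only: ideal_pow.simps(2)) blast

lemma ideal_pow_SucE:
  assumes "z \<in> ideal_pow a b (Suc k)"
  obtains x y where "z = a * x + b * y" "x \<in> ideal_pow a b k" "y \<in> ideal_pow a b k"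
  using assms by (simp only: ideal_pow.simps(2)) blast

declare ideal_pow.simps(2) [simp del]

lemma ideal_pow_le: "x \<in> ideal_pow a b n \<Longrightarrow> m \<le> n \<Longrightarrow> x \<in> ideal_pow a b m"
  using ideal_pow_antimono by blast

lemma ideal_pow_add: "x \<in> ideal_pow a b n \<Longrightarrow> y \<in> ideal_pow a b n \<Longrightarrow> x + y \<in> ideal_pow a b n"
proof (induction n arbitrary: x y)
  case (Suc n)
  obtain x1 x2 y1 y2 where "x = a * x1 + b * x2" "y = a * y1 + b * y2"
    "x1 \<in> ideal_pow a b n" "x2 \<in> ideal_pow a b n" "y1 \<in> ideal_pow a b n" "y2 \<in> ideal_pow a b n"
    using Suc.prems by (elim ideal_pow_SucE)
  moreover from this have "x + y = a * (x1 + y1) + b * (x2 + y2)" by (simp add: algebra_simps)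
  ultimately show ?case by (simp add: Suc.IH ideal_pow_SucI)
qed simp

lemma ideal_pow_mult_left: "x \<in> ideal_pow a b n \<Longrightarrow> r * x \<in> ideal_pow a b n"
proof (induction n arbitrary: x)
  case (Suc n)
  obtain x1 x2 where "x = a * x1 + b * x2" "x1 \<in> ideal_pow a b n" "x2 \<in> ideal_pow a b n"
    using Suc.prems by (elim ideal_pow_SucE)
  moreover from this have "r * x = a * (r * x1) + b * (r * x2)" by (simp add: algebra_simps)
  ultimately show ?case by (simp add: Suc.IH ideal_pow_SucI)
qed simp

lemma ideal_pow_mult_right: "x \<in> ideal_pow a b n \<Longrightarrow> x * r \<in> ideal_pow a b n"
  using ideal_pow_mult_left[of x a b n r] by (simp add: mult.commute)

lemma ideal_pow_0 [simp]: "0 \<in> ideal_pow a b n"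
proof (induction n)
  case (Suc n)
  then show ?case using ideal_pow_SucI[of 0 a b n 0] by simp
qed simp

lemma ideal_pow_minus: "x \<in> ideal_pow a b n \<Longrightarrow> - x \<in> ideal_pow a b n"
  using ideal_pow_mult_left[of x a b n "- 1"] by simp

lemma ideal_pow_diff: "x \<in> ideal_pow a b n \<Longrightarrow> y \<in> ideal_pow a b n \<Longrightarrow> x - y \<in> ideal_pow a b n"
  using ideal_pow_add[OF _ ideal_pow_minus, of x a b n y] by simp

lemma ideal_pow_sum: "(\<And>i. i \<in> A \<Longrightarrow> f i \<in> ideal_pow a b n) \<Longrightarrow> sum f A \<in> ideal_pow a b n"
  by (induction A rule: infinite_finite_induct) (auto intro: ideal_pow_add)

lemma ideal_pow_mult: "x \<in> ideal_pow a b m \<Longrightarrow> y \<in> ideal_pow a b n \<Longrightarrow> x * y \<in> ideal_pow a b (m + n)"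
proof (induction m arbitrary: x)
  case (Suc m)
  obtain x1 x2 where x: "x = a * x1 + b * x2" "x1 \<in> ideal_pow a b m" "x2 \<in> ideal_pow a b m"
    using Suc.prems by (elim ideal_pow_SucE)
  have "x * y = a * (x1 * y) + b * (x2 * y)" by (simp add: x algebra_simps)
  then show ?case using Suc.IH Suc.prems x by (simp add: ideal_pow_SucI)
qed (simp add: ideal_pow_mult_left)

lemma ideal_pow_gen1: "a \<in> ideal_pow a b 1"
  using ideal_pow_SucI[of 1 a b 0 0] by simp

lemma ideal_pow_gen2: "b \<in> ideal_pow a b 1"
  using ideal_pow_SucI[of 0 a b 0 1] by simp

lemma ideal_pow_power: "x \<in> ideal_pow a b k \<Longrightarrow> x ^ n \<in> ideal_pow a b (k * n)"
  by (induction n) (auto intro: ideal_pow_mult)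

lemma ideal_pow_prod:
  "(\<And>i. i \<in> A \<Longrightarrow> f i \<in> ideal_pow a b (k i)) \<Longrightarrow> prod f A \<in> ideal_pow a b (sum k A)"
  by (induction A rule: infinite_finite_induct) (auto intro: ideal_pow_mult)

text \<open>A monomial of degree i + j in the two generators contains a at least i times or b at
  least j times. This separates the role of p from that of T in
  \<open>ideal_subset_small\<close>.\<close>

lemma ideal_pow_split:
  "x \<in> ideal_pow a b (i + j) \<Longrightarrow> \<exists>u v. x = a ^ i * u + b ^ j * v"
proof (induction "i + j" arbitrary: i j x)
  case 0
  then show ?case by (auto intro: exI[of _ x] exI[of _ 0])
next
  case (Suc n)
  show ?case
  proof (cases "i = 0 \<or> j = 0")
    case True
    then show ?thesis by (metis add_0 add.right_neutral mult_1 mult_zero_right power_0)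
  next
    case False
    obtain x1 x2 where x: "x = a * x1 + b * x2" "x1 \<in> ideal_pow a b n" "x2 \<in> ideal_pow a b n"
      using Suc.prems Suc.hyps(2) by (metis ideal_pow_SucE)
    have n: "n = (i - 1) + j" "n = i + (j - 1)" using Suc.hyps(2) False by auto
    obtain u v where x1: "x1 = a ^ (i - 1) * u + b ^ j * v"
      using Suc.hyps(1)[OF n(1)] x(2) n(1) by metis
    obtain u' v' where x2: "x2 = a ^ i * u' + b ^ (j - 1) * v'"
      using Suc.hyps(1)[OF n(2)] x(3) n(2) by metis
    have "a ^ i = a * a ^ (i - 1)" "b ^ j = b * b ^ (j - 1)" using False by (simp_all add: power_eq_if)
    then have "x = a ^ i * (u + b * u') + b ^ j * (a * v + v')"
      unfolding x(1) x1 x2 by (simp add: algebra_simps)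
    then show ?thesis by blast
  qed
qed

text \<open>Each p-th power gains one factor: (y^p - 1) / (y - 1) is congruent to p modulo y - 1,
  hence lies in the ideal itself.\<close>

lemma ideal_pow_one_plus_power:
  assumes "z \<in> ideal_pow (of_nat p) b (Suc j)"
  shows "(1 + z) ^ (p ^ k) - 1 \<in> ideal_pow (of_nat p) b (Suc j + k)"
proof (induction k)
  case 0
  then show ?case using assms by simp
next
  case (Suc k)
  define y where "y = (1 + z) ^ (p ^ k)"
  have y: "y - 1 \<in> ideal_pow (of_nat p) b (Suc j + k)" using Suc unfolding y_def .
  obtain s where s: "(\<Sum>i<p. y ^ i) - of_nat p = (y - 1) * s"
    using dvd_sum_power_minus by (rule dvdE)
  then have S: "(\<Sum>i<p. y ^ i) = of_nat p + (y - 1) * s" by (metis diff_add_cancel add.commute)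
  have "y - 1 \<in> ideal_pow (of_nat p) b 1" using y by (rule ideal_pow_le) simp
  then have "(\<Sum>i<p. y ^ i) \<in> ideal_pow (of_nat p) b 1"
    unfolding S by (intro ideal_pow_add ideal_pow_gen1 ideal_pow_mult_right)
  then have "y ^ p - 1 \<in> ideal_pow (of_nat p) b (Suc j + k + 1)"
    unfolding power_minus_1_sum by (intro ideal_pow_mult y)
  moreover have "y ^ p = (1 + z) ^ (p ^ Suc k)"
    unfolding y_def by (simp add: power_mult[symmetric] mult.commute)
  ultimately show ?case by simp
qed

text \<open>k binom(N, k) = N binom(N - 1, k - 1) with N = p^m; were the binomial coefficient prime
  to p, all of p^m would divide k < p^m.\<close>

lemma prime_dvd_choose_prime_power:
  assumes "prime (p::nat)" "0 < k" "k < p ^ m"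
  shows "p dvd (p ^ m choose k)"
proof (rule ccontr)
  assume nd: "\<not> p dvd (p ^ m choose k)"
  then have cop: "coprime (p ^ m) (p ^ m choose k)"
    using assms(1) by (simp add: prime_imp_coprime)
  obtain k' where k': "k = Suc k'" using assms(2) by (cases k) auto
  obtain N where N: "p ^ m = Suc N" using assms(3) by (cases "p ^ m") auto
  have "Suc k' * (Suc N choose Suc k') = Suc N * (N choose k')" by (metis Suc_times_binomial_eq mult.commute)
  then have "p ^ m dvd k * (p ^ m choose k)" unfolding k' N by (metis dvd_triv_left)
  then have "p ^ m dvd k" using cop by (simp add: coprime_dvd_mult_left_iff)
  then show False using assms(2,3) by (auto dest: dvd_imp_le)
qed

lemma one_plus_prime_power:
  assumes "prime p"
  shows "\<exists>w. (1 + z :: 'a::comm_ring_1) ^ (p ^ m) = 1 + z ^ (p ^ m) + of_nat p * w"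
proof -
  let ?N = "p ^ m"
  have N: "?N > 0" using assms prime_gt_0_nat by simp
  have "(z + 1) ^ ?N = (\<Sum>k\<le>?N. of_nat (?N choose k) * z ^ k)" by (simp add: binomial_ring)
  also have "{..?N} = insert 0 (insert ?N {0<..<?N})" using N by auto
  also have "(\<Sum>k\<in>insert 0 (insert ?N {0<..<?N}). of_nat (?N choose k) * z ^ k)
      = 1 + z ^ ?N + (\<Sum>k\<in>{0<..<?N}. of_nat (?N choose k) * z ^ k)"
    using N by (subst sum.insert; simp)
  finally have eq: "(z + 1) ^ ?N = 1 + z ^ ?N + (\<Sum>k\<in>{0<..<?N}. of_nat (?N choose k) * z ^ k)" .
  have "of_nat p dvd (\<Sum>k\<in>{0<..<?N}. of_nat (?N choose k) * z ^ k)"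
  proof (rule dvd_sum)
    fix k assume "k \<in> {0<..<?N}"
    then obtain c where "?N choose k = p * c" 
      using prime_dvd_choose_prime_power[OF assms] by (metis dvdE greaterThanLessThan_iff)
    then show "of_nat p dvd of_nat (?N choose k) * z ^ k" by simp
  qed
  then show ?thesis using eq by (auto simp: add.commute elim: dvdE)
qed

section \<open>The topology of the Iwasawa algebra\<close>

lemma mass_eqI: "(\<And>n a. mass \<mu> n a = mass \<nu> n a) \<Longrightarrow> \<mu> = \<nu>"
  by (metis mass_inject ext)

lemma mass_times:
  fixes \<mu> \<nu> :: "'p::prime_card iwasawa"
  shows "mass (\<mu> * \<nu>) n c
    = iwint (mass \<mu>) n (\<lambda>a. iwint (mass \<nu>) n (\<lambda>b. of_bool (a * b mod int (CARD('p)) ^ n = c)))"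
  by (simp add: times_iwasawa.rep_eq conv_eq)

lemma iwint_univ_char:
  assumes "(x::'p::prime_card padic_int) dvd 1"
  shows "iwint (mass (univ_char x)) n f = f (residue x n)"
proof -
  have "iwint (mass (univ_char x)) n f = (\<Sum>c\<in>units_mod TYPE('p) n. of_bool (residue x n = c) * f c)"
    unfolding iwint_def univ_char.rep_eq using assms by (intro sum.cong) auto
  also have "\<dots> = f (residue x n)" by (rule sum_of_bool_units) (rule residue_unit[OF assms])
  finally show ?thesis .
qed

lemma iwint_const:
  fixes c :: "'p::prime_card padic_int"
  shows "iwint (mass (iw_const c)) n f = c * f (1 mod int (CARD('p)) ^ n)"
proof -
  have "iwint (mass (iw_const c)) n f
      = (\<Sum>a\<in>units_mod TYPE('p) n. of_bool (1 mod int (CARD('p)) ^ n = a) * (c * f a))"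
    unfolding iwint_def iw_const.rep_eq by (intro sum.cong) auto
  also have "\<dots> = c * f (1 mod int (CARD('p)) ^ n)" by (rule sum_of_bool_units) (rule units_mod_1)
  finally show ?thesis .
qed

lemma iw_const_1 [simp]: "iw_const 1 = 1"
  by (rule mass_eqI) (simp add: iw_const.rep_eq one_iwasawa.rep_eq)

lemma mass_const_times: "mass (iw_const c * \<mu>) n a = c * mass \<mu> n a" for c :: "'p::prime_card padic_int"
  using arg_cong[OF mult_1_left[of \<mu>], of "\<lambda>\<nu>. mass \<nu> n a"]
  unfolding iw_const_1[symmetric] mass_times iwint_const by simp

lemma iw_const_add: "iw_const (x + y) = iw_const x + iw_const y"
  by (rule mass_eqI) (simp add: iw_const.rep_eq plus_iwasawa.rep_eq)

lemma iw_const_diff: "iw_const (x - y) = iw_const x - iw_const y"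
  by (rule mass_eqI) (simp add: iw_const.rep_eq minus_iwasawa.rep_eq)

lemma iw_const_0 [simp]: "iw_const 0 = 0"
  by (rule mass_eqI) (simp add: iw_const.rep_eq zero_iwasawa.rep_eq)

lemma iw_const_mult: "iw_const (x * y) = iw_const x * iw_const y"
  by (rule mass_eqI) (simp add: mass_const_times, simp add: iw_const.rep_eq)

lemma iw_const_sum: "iw_const (sum f A) = (\<Sum>i\<in>A. iw_const (f i))"
  by (induction A rule: infinite_finite_induct) (simp_all add: iw_const_add)

lemma iw_const_of_nat: "iw_const (of_nat k) = of_nat k"
  by (induction k) (simp_all add: iw_const_add)

lemma iw_const_power: "iw_const (x ^ k) = iw_const x ^ k"
  by (induction k) (simp_all add: iw_const_mult)

lemma univ_char_1 [simp]: "univ_char 1 = 1"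
  by (rule mass_eqI) (simp add: univ_char.rep_eq one_iwasawa.rep_eq one_padic_int.rep_eq)

lemma univ_char_mult:
  assumes "(x::'p::prime_card padic_int) dvd 1" "y dvd 1"
  shows "univ_char (x * y) = univ_char x * univ_char y"
proof (rule mass_eqI)
  fix n a
  have "x * y dvd 1" using mult_dvd_mono[OF assms] by simp
  then show "mass (univ_char (x * y)) n a = mass (univ_char x * univ_char y) n a"
    unfolding mass_times iwint_univ_char[OF assms(1)] iwint_univ_char[OF assms(2)]
    by (auto simp: univ_char.rep_eq times_padic_int.rep_eq)
qed

lemma unit_power: "(x::'a::comm_ring_1) dvd 1 \<Longrightarrow> x ^ n dvd 1"
  using dvd_power_same[of x 1 n] by simp

lemma univ_char_power: "(x::'p::prime_card padic_int) dvd 1 \<Longrightarrow> univ_char (x ^ n) = univ_char x ^ n"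
  by (induction n) (simp_all add: univ_char_mult unit_power)

lemma univ_char_gam: "univ_char gam = 1 + iw_T"
  by (simp add: iw_T_def gam_def)

text \<open>
  These ideals are a basis of neighbourhoods of $0$ for the profinite topology, in which $\Lambda$
  is visibly complete and in which powers of $\mathfrak{m}_\Lambda$ tend to $0$. The power
  $\mathfrak{m}_\Lambda^a$ is closed for it: split each term of a series as $p u + T v$ and
  induct on $a$.
\<close>

definition small :: "nat \<Rightarrow> 'p::prime_card iwasawa set" where
  "small m = {\<mu>. \<forall>a. of_nat (CARD('p)) ^ m dvd mass \<mu> m a}"

lemma small_0 [simp]: "0 \<in> small m"
  by (simp add: small_def zero_iwasawa.rep_eq)

lemma small_add: "\<mu> \<in> small m \<Longrightarrow> \<nu> \<in> small m \<Longrightarrow> \<mu> + \<nu> \<in> small m"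
  by (simp add: small_def plus_iwasawa.rep_eq)

lemma small_diff: "\<mu> \<in> small m \<Longrightarrow> \<nu> \<in> small m \<Longrightarrow> \<mu> - \<nu> \<in> small m"
  by (simp add: small_def minus_iwasawa.rep_eq)

lemma small_sum: "(\<And>i. i \<in> A \<Longrightarrow> f i \<in> small m) \<Longrightarrow> sum f A \<in> small m"
  by (induction A rule: infinite_finite_induct) (auto intro: small_add)

lemma small_mult:
  fixes \<mu> :: "'p::prime_card iwasawa"
  assumes "\<mu> \<in> small m" shows "\<nu> * \<mu> \<in> small m"
proof -
  have "of_nat (CARD('p)) ^ m dvd mass (\<nu> * \<mu>) m a" for a
    unfolding mass_times iwint_def
    by (intro dvd_sum dvd_mult dvd_mult2) (use assms in \<open>simp add: small_def\<close>)
  then show ?thesis by (simp add: small_def)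
qed

lemma mass_dvd_mono:
  assumes "\<And>a. x dvd mass \<mu> (n + k) a" shows "x dvd mass \<mu> n a"
  using assms
proof (induction k arbitrary: a)
  case (Suc k)
  have "x dvd mass \<mu> (n + k) a" for a
    unfolding mass_eq[of \<mu> "n + k"] using Suc.prems by (intro dvd_sum) auto
  then show ?case by (rule Suc.IH)
qed simp

lemma small_dvd:
  assumes "(\<mu> :: 'p::prime_card iwasawa) \<in> small m" "n \<le> m"
  shows "of_nat (CARD('p)) ^ m dvd mass \<mu> n a"
  using mass_dvd_mono[of _ \<mu> n "m - n"] assms by (simp add: small_def)

lemma small_antimono:
  assumes "(\<mu> :: 'p::prime_card iwasawa) \<in> small m" "n \<le> m"
  shows "\<mu> \<in> small n"
  using small_dvd[OF assms] assms(2) unfolding small_def by (auto intro: dvd_trans le_imp_power_dvd)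

lemma small_all_eq_0:
  assumes "\<And>m. (\<mu> :: 'p::prime_card iwasawa) \<in> small m" shows "\<mu> = 0"
proof (rule mass_eqI)
  fix n a
  have "mass \<mu> n a = 0"
    by (rule padic_int_eq_0I[of n]) (rule small_dvd[OF assms])
  then show "mass \<mu> n a = mass 0 n a" by (simp add: zero_iwasawa.rep_eq)
qed

lemma small_complete:
  fixes x :: "nat \<Rightarrow> 'p::prime_card iwasawa"
  assumes "\<And>n. x (Suc n) - x n \<in> small n"
  obtains L where "\<And>n. L - x n \<in> small n"
proof -
  let ?p = "of_nat (CARD('p)) :: 'p padic_int"
  have "\<exists>l. \<forall>k\<ge>n. ?p ^ k dvd l - mass (x k) n a" for n a
  proof -
    have "?p ^ k dvd mass (x (Suc k)) n a - mass (x k) n a" if "k \<ge> n" for k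
      using small_dvd[OF assms that] by (simp add: minus_iwasawa.rep_eq)
    then show ?thesis by (rule padic_int_complete[of n "\<lambda>k. mass (x k) n a"]) blast+
  qed
  then obtain l where l: "\<And>n a k. k \<ge> n \<Longrightarrow> ?p ^ k dvd l n a - mass (x k) n a" by metis
  have "(\<Sum>b | b \<in> units_mod TYPE('p) (Suc n) \<and> b mod int (CARD('p)) ^ n = a. l (Suc n) b) = l n a" for n a
  proof -
    let ?A = "{b. b \<in> units_mod TYPE('p) (Suc n) \<and> b mod int (CARD('p)) ^ n = a}"
    have "(\<Sum>b\<in>?A. l (Suc n) b) - l n a = 0"
    proof (rule padic_int_eq_0I)
      fix k assume k: "k \<ge> Suc n"
      have "mass (x k) n a = (\<Sum>b\<in>?A. mass (x k) (Suc n) b)" using mass[of "x k"] by simp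
      then have "(\<Sum>b\<in>?A. l (Suc n) b) - l n a
          = (\<Sum>b\<in>?A. l (Suc n) b - mass (x k) (Suc n) b) - (l n a - mass (x k) n a)"
        by (simp add: sum_subtractf)
      also have "?p ^ k dvd \<dots>" using k by (intro dvd_diff dvd_sum l) auto
      finally show "?p ^ k dvd (\<Sum>b\<in>?A. l (Suc n) b) - l n a" .
    qed
    then show ?thesis by simp
  qed
  then have "mass (Abs_iwasawa l) = l" by (intro Abs_iwasawa_inverse) blast
  then show ?thesis
    using l by (intro that[of "Abs_iwasawa l"]) (simp add: small_def minus_iwasawa.rep_eq)
qed

lemma univ_char_minus_1_small:
  assumes "(x::'p::prime_card padic_int) dvd 1" "of_nat (CARD('p)) ^ m dvd x - 1"
  shows "mass (univ_char x - 1) m a = 0"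
proof -
  have "residue x m = residue (1 :: 'p padic_int) m" using assms(2) power_dvd_diff_iff_residue[of m x 1] by simp
  then show ?thesis using assms(1)
    by (simp add: minus_iwasawa.rep_eq univ_char.rep_eq one_iwasawa.rep_eq one_padic_int.rep_eq)
qed

abbreviation mI :: "nat \<Rightarrow> 'p::prime_card iwasawa set" where
  "mI \<equiv> ideal_pow (of_nat (CARD('p))) iw_T"

text \<open>The exponent from which \<open>ideal_pow_split\<close> provides either m factors p or m
  factors T^(p^m).\<close>

definition mod_exp :: "'p::prime_card itself \<Rightarrow> nat \<Rightarrow> nat" where
  "mod_exp P m = m + CARD('p) ^ m * m"

text \<open>With g = exp(q)^(p^m), the binomial theorem gives T^(p^m) = [g] - 1 up to a multiple of
  p. Since g is 1 modulo p^m, the element [g] - 1 has no mass at level m, so at that level T^(p^m)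
  behaves like a multiple of p and its m-th power like a multiple of p^m.\<close>

lemma ideal_subset_small: "mI (mod_exp TYPE('p) m) \<subseteq> (small m :: 'p::prime_card iwasawa set)"
proof
  fix x :: "'p iwasawa"
  assume "x \<in> mI (mod_exp TYPE('p) m)"
  then obtain u v where x: "x = of_nat (CARD('p)) ^ m * u + iw_T ^ (CARD('p) ^ m * m) * v"
    using ideal_pow_split unfolding mod_exp_def by blast
  define g where "g = (gam :: 'p padic_int) ^ (CARD('p) ^ m)"
  have g1: "g dvd 1" unfolding g_def by (intro unit_power gam_unit)
  let ?p = "of_nat (CARD('p)) :: 'p padic_int"
  have "?p ^ (lev_exp TYPE('p) + m) dvd (g - 1 - ?p ^ (lev_exp TYPE('p) + m)) + ?p ^ (lev_exp TYPE('p) + m)"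
    using gam_power_cong[of m, where 'p='p] unfolding g_def[symmetric]
    by (intro dvd_add dvd_refl) (rule dvd_trans[OF le_imp_power_dvd], auto)
  then have "?p ^ (lev_exp TYPE('p) + m) dvd g - 1" by simp
  then have "?p ^ m dvd g - 1" by (rule dvd_trans[rotated]) (simp add: le_imp_power_dvd)
  then have g: "mass (univ_char g - 1) m a = 0" for a by (rule univ_char_minus_1_small[OF g1])
  have "univ_char g = (1 + iw_T) ^ (CARD('p) ^ m)"
    unfolding g_def by (simp add: univ_char_power gam_unit univ_char_gam)
  then obtain w where "univ_char g = 1 + iw_T ^ (CARD('p) ^ m) + of_nat (CARD('p)) * w"
    using one_plus_prime_power[OF prime_prm] by metis
  then have T: "iw_T ^ (CARD('p) ^ m) = (univ_char g - 1) + of_nat (CARD('p)) * (- w)" by simp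
  have "\<exists>z w. (iw_T :: 'p iwasawa) ^ (CARD('p) ^ m * k) = z + of_nat (CARD('p)) ^ k * w \<and> (\<forall>a. mass z m a = 0)" for k
  proof (induction k)
    case 0
    show ?case by (rule exI[of _ 0], rule exI[of _ 1]) (simp add: zero_iwasawa.rep_eq)
  next
    case (Suc k)
    then obtain z w' where zw: "(iw_T :: 'p iwasawa) ^ (CARD('p) ^ m * k) = z + of_nat (CARD('p)) ^ k * w'" "\<And>a. mass z m a = 0"
      by blast
    have "iw_T ^ (CARD('p) ^ m * Suc k)
        = (z * iw_T ^ (CARD('p) ^ m) + (of_nat (CARD('p)) ^ k * w') * (univ_char g - 1))
          + of_nat (CARD('p)) ^ Suc k * (- w * w')"
      unfolding mult_Suc_right power_add zw(1) by (subst (1) distrib_left, simp add: T algebra_simps)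
    moreover have "mass (z * r) m a = 0" "mass (r * (univ_char g - 1)) m a = 0" for r a
      unfolding mass_times iwint_def by (simp_all add: zw(2) g)
    ultimately show ?case
      by (intro exI[of _ "z * iw_T ^ (CARD('p) ^ m) + (of_nat (CARD('p)) ^ k * w') * (univ_char g - 1)"]
          exI[of _ "- w * w'"]) (simp add: plus_iwasawa.rep_eq)
  qed
  then obtain z w' where "(iw_T :: 'p iwasawa) ^ (CARD('p) ^ m * m) = z + of_nat (CARD('p)) ^ m * w'" "\<And>a. mass z m a = 0"
    by blast
  moreover have "of_nat (CARD('p)) ^ m * r \<in> small m" for r :: "'p iwasawa"
    unfolding small_def by (simp add: iw_const_of_nat[symmetric] iw_const_power[symmetric] mass_const_times)
  moreover have "z \<in> small m" if "\<And>a. mass z m a = 0" for z :: "'p iwasawa"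
    using that by (simp add: small_def)
  ultimately have "(iw_T :: 'p iwasawa) ^ (CARD('p) ^ m * m) \<in> small m" "of_nat (CARD('p)) ^ m * u \<in> small m"
    by (auto intro: small_add)
  then show "x \<in> small m"
    unfolding x by (metis small_add small_mult mult.commute)
qed

lemma ideal_all_eq_0:
  assumes "\<And>n. (x :: 'p::prime_card iwasawa) \<in> mI n" shows "x = 0"
  using assms ideal_subset_small by (intro small_all_eq_0) blast

section \<open>Series converging in the profinite topology\<close>

definition wsums :: "(nat \<Rightarrow> 'p::prime_card iwasawa) \<Rightarrow> 'p iwasawa \<Rightarrow> bool" where
  "wsums d x \<longleftrightarrow> (\<forall>m. \<exists>N. \<forall>n\<ge>N. x - (\<Sum>i<n. d i) \<in> small m)"

lemma wsums_unique:
  assumes "wsums d x" "wsums d y" shows "x = y"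
proof -
  have "x - y \<in> small m" for m
  proof -
    obtain M N where "\<And>n. n \<ge> M \<Longrightarrow> x - (\<Sum>i<n. d i) \<in> small m" "\<And>n. n \<ge> N \<Longrightarrow> y - (\<Sum>i<n. d i) \<in> small m"
      using assms unfolding wsums_def by metis
    then have "(x - (\<Sum>i<max M N. d i)) - (y - (\<Sum>i<max M N. d i)) \<in> small m"
      using small_diff[of "x - (\<Sum>i<max M N. d i)" m "y - (\<Sum>i<max M N. d i)"] by simp
    then show ?thesis by simp
  qed
  then show ?thesis using small_all_eq_0[of "x - y"] by simp
qed

lemma wsums_linear:
  assumes "wsums d x" "wsums e y" shows "wsums (\<lambda>n. r * d n + s * e n) (r * x + s * y)"
  unfolding wsums_def
proof
  fix m
  obtain M N where M: "\<And>n. n \<ge> M \<Longrightarrow> x - (\<Sum>i<n. d i) \<in> small m" and N: "\<And>n. n \<ge> N \<Longrightarrow> y - (\<Sum>i<n. e i) \<in> small m"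
    using assms unfolding wsums_def by metis
  have "r * x + s * y - (\<Sum>i<n. r * d i + s * e i) \<in> small m" if "n \<ge> max M N" for n
  proof -
    have "r * x + s * y - (\<Sum>i<n. r * d i + s * e i) = r * (x - (\<Sum>i<n. d i)) + s * (y - (\<Sum>i<n. e i))"
      by (simp add: sum.distrib sum_distrib_left algebra_simps)
    then show ?thesis using M N that by (simp add: small_add small_mult)
  qed
  then show "\<exists>N. \<forall>n\<ge>N. r * x + s * y - (\<Sum>i<n. r * d i + s * e i) \<in> small m" by blast
qed

lemma wsums_exists:
  assumes "\<And>n. d n \<in> (mI n :: 'p::prime_card iwasawa set)"
  shows "\<exists>x. wsums d x"
proof -
  let ?f = "mod_exp TYPE('p)"
  have tail: "(\<Sum>i<k. d i) - (\<Sum>i<?f m. d i) \<in> small m" if "k \<ge> ?f m" for k m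
  proof -
    have "(\<Sum>i<k. d i) - (\<Sum>i<?f m. d i) = (\<Sum>i=?f m..<k. d i)"
      using that by (simp add: sum_diff_nat_ivl atLeast0LessThan[symmetric])
    also have "\<dots> \<in> small m"
      by (intro small_sum subsetD[OF ideal_subset_small] ideal_pow_le[OF assms]) simp
    finally show ?thesis .
  qed
  have mono: "?f m \<le> ?f (Suc m)" for m
    using prm_gt_1[where 'p='p] unfolding mod_exp_def by (intro add_mono mult_mono power_increasing) auto
  obtain L where L: "\<And>m. L - (\<Sum>i<?f m. d i) \<in> small m"
    using small_complete[of "\<lambda>m. \<Sum>i<?f m. d i"] tail mono by blast
  have "L - (\<Sum>i<k. d i) \<in> small m" if "k \<ge> ?f m" for k m
    using small_diff[OF L tail[OF that]] by simp
  then show ?thesis unfolding wsums_def by blast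
qed

lemma wsums_in_ideal:
  assumes "\<And>n. d n \<in> (mI (a + n) :: 'p::prime_card iwasawa set)"
  shows "\<exists>x\<in>mI a. wsums d x"
  using assms
proof (induction a arbitrary: d)
  case 0
  then show ?case using wsums_exists[of d] by simp
next
  case (Suc a)
  have "\<exists>u v. d n = of_nat (CARD('p)) * u + iw_T * v \<and> u \<in> mI (a + n) \<and> v \<in> mI (a + n)" for n
    using Suc.prems[of n] by (simp, elim ideal_pow_SucE) blast
  then obtain u v where d: "\<And>n. d n = of_nat (CARD('p)) * u n + iw_T * v n"
    and uv: "\<And>n. u n \<in> mI (a + n)" "\<And>n. v n \<in> mI (a + n)" by metis
  obtain x y where "x \<in> mI a" "wsums u x" "y \<in> mI a" "wsums v y"
    using Suc.IH[of u, OF uv(1)] Suc.IH[of v, OF uv(2)] by blast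
  then show ?case
    using wsums_linear[of u x v y "of_nat (CARD('p))" iw_T] unfolding d[symmetric]
    by (intro bexI[of _ "of_nat (CARD('p)) * x + iw_T * y"]) (auto intro: ideal_pow_SucI)
qed

lemma wsums_tail:
  assumes "wsums (\<lambda>n. d (n + N)) y" shows "wsums d (y + (\<Sum>i<N. d i))"
  unfolding wsums_def
proof
  fix m
  obtain M where M: "\<And>n. n \<ge> M \<Longrightarrow> y - (\<Sum>i<n. d (i + N)) \<in> small m"
    using assms unfolding wsums_def by metis
  have "y + (\<Sum>i<N. d i) - (\<Sum>i<n. d i) \<in> small m" if "n \<ge> M + N" for n
  proof -
    have "(\<Sum>i<n. d i) = (\<Sum>i<N. d i) + (\<Sum>i<n - N. d (i + N))"
      using sum.shift_bounds_nat_ivl[of d 0 N "n - N"] that sum.atLeastLessThan_concat[of 0 N n d]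
      by (simp add: atLeast0LessThan)
    then show ?thesis using M[of "n - N"] that by simp
  qed
  then show "\<exists>M. \<forall>n\<ge>M. y + (\<Sum>i<N. d i) - (\<Sum>i<n. d i) \<in> small m" by blast
qed

text \<open>The tail from N on has a sum inside the ideal power by \<open>wsums_in_ideal\<close>,
  and uniqueness of sums identifies it with the remainder. Profinite convergence is thereby turned
  into convergence for the powers of (p, T).\<close>

lemma ideal_series:
  assumes "\<And>n. d n \<in> (mI (a + n) :: 'p::prime_card iwasawa set)" "wsums d x"
  shows "x - (\<Sum>i<N. d i) \<in> mI (a + N)"
proof -
  have "d (n + N) \<in> mI (a + N + n)" for n using assms(1)[of "n + N"] by (simp add: ac_simps)
  then obtain y where "y \<in> mI (a + N)" "wsums (\<lambda>n. d (n + N)) y"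
    using wsums_in_ideal[of "\<lambda>n. d (n + N)" "a + N"] by blast
  then show ?thesis using wsums_unique[OF wsums_tail assms(2)] by (metis add_diff_cancel_right')
qed

text \<open>
  Successive approximation of $y$ by powers $\exp(q)^{p^k i}$, whose classes are $(1 + T)^{p^k i}$.
\<close>

lemma univ_char_close:
  fixes y :: "'p::prime_card padic_int"
  assumes "of_nat (CARD('p)) ^ (lev_exp TYPE('p) + a) dvd y - 1"
  shows "univ_char y - 1 \<in> mI (Suc a)"
proof -
  let ?p = "of_nat (CARD('p)) :: 'p padic_int" and ?e = "lev_exp TYPE('p)"
  \<comment> \<open>The factor r is carried along because y = g y' gives [y] - 1 = ([g] - 1) + [g]
    ([y'] - 1): the remainder comes multiplied by [g].\<close>
  define S where "S k = {r * (univ_char y - 1) | r y. ?p ^ (?e + k) dvd y - 1}" for k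
  have unit: "y dvd 1" if "?p ^ (?e + k) dvd y - 1" for y k
  proof (rule unit_add_p[of 1])
    have "?p dvd ?p ^ (?e + k)" using lev_exp_ge_1[where 'p='p] by (intro dvd_power) auto
    then show "?p dvd y - 1" using that dvd_trans by blast
  qed simp
  have small: "x \<in> small k" if x0: "x \<in> S k" for x k
  proof -
    obtain r y where x: "x = r * (univ_char y - 1)" and y: "?p ^ (?e + k) dvd y - 1"
      using x0 unfolding S_def by blast
    have "?p ^ k dvd y - 1" using y by (rule dvd_trans[rotated]) (simp add: le_imp_power_dvd)
    then have "univ_char y - 1 \<in> small k"
      using univ_char_minus_1_small[OF unit[OF y]] by (simp add: small_def)
    then show ?thesis unfolding x by (rule small_mult)
  qed
  have step: "\<exists>x'. x' \<in> S (Suc k) \<and> x - x' \<in> mI (Suc k)" if x0: "x \<in> S k" for x k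
  proof -
    obtain r y where x: "x = r * (univ_char y - 1)" and y: "?p ^ (?e + k) dvd y - 1"
      using x0 unfolding S_def by blast
    obtain i where i: "?p ^ (?e + Suc k) dvd y - gam ^ (CARD('p) ^ k * i)" using gam_approx[OF y] .
    define g where "g = (gam :: 'p padic_int) ^ (CARD('p) ^ k * i)"
    have g: "g dvd 1" unfolding g_def by (intro unit_power gam_unit)
    then obtain h where h: "1 = g * h" by (rule dvdE)
    have "?p ^ (?e + Suc k) dvd h * (y - g)" using i unfolding g_def[symmetric] by (rule dvd_mult)
    also have "h * (y - g) = h * y - 1" using h by (simp add: algebra_simps)
    finally have hy: "?p ^ (?e + Suc k) dvd h * y - 1" .
    have gy: "y = g * (h * y)" using h by (metis mult.assoc mult_1)
    have uy: "univ_char y = univ_char g * univ_char (h * y)"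
      by (subst (1) gy) (rule univ_char_mult[OF g unit[OF hy]])
    have "univ_char g = ((1 + iw_T) ^ (CARD('p) ^ k)) ^ i"
      unfolding g_def power_mult by (simp add: univ_char_power gam_unit univ_char_gam unit_power)
    then have "(1 + iw_T) ^ (CARD('p) ^ k) - 1 dvd univ_char g - (1 :: 'p iwasawa)"
      by (simp add: dvd_power_minus_1)
    then obtain s where s: "univ_char g - (1 :: 'p iwasawa) = ((1 + iw_T) ^ (CARD('p) ^ k) - 1) * s"
      by (rule dvdE)
    have "(1 + iw_T) ^ (CARD('p) ^ k) - 1 \<in> (mI (Suc 0 + k) :: 'p iwasawa set)"
      by (rule ideal_pow_one_plus_power) (use ideal_pow_gen2 in simp)
    then have "r * (univ_char g - 1) \<in> mI (Suc k)"
      unfolding s by (intro ideal_pow_mult_left ideal_pow_mult_right) simp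
    moreover have "x - (r * univ_char g) * (univ_char (h * y) - 1) = r * (univ_char g - 1)"
      unfolding x uy by (simp add: algebra_simps)
    moreover have "(r * univ_char g) * (univ_char (h * y) - 1) \<in> S (Suc k)"
      unfolding S_def using hy by blast
    ultimately show ?thesis by metis
  qed
  have "univ_char y - 1 \<in> S a" unfolding S_def using assms by (metis (mono_tags, lifting) mem_Collect_eq mult_1)
  then have "univ_char y - 1 \<in> S (a + 0)" by simp
  then obtain x where x: "x 0 = univ_char y - 1" "\<And>n. x n \<in> S (a + n)" "\<And>n. x n - x (Suc n) \<in> mI (Suc (a + n))"
    using dependent_nat_choice[of "\<lambda>n x. x \<in> S (a + n) \<and> (n = 0 \<longrightarrow> x = univ_char y - 1)"
        "\<lambda>n x x'. x - x' \<in> mI (Suc (a + n))"] step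
    by (metis add_Suc_right nat.distinct(1))
  \<comment> \<open>The remainders x n tend to 0 in the profinite topology, so x 0 = [y] - 1 is the
    sum of the telescoping series d, whose n-th term lies in the power a + 1 + n of (p, T).\<close>
  define d where "d n = x n - x (Suc n)" for n
  have sum: "(\<Sum>i<n. d i) = x 0 - x n" for n unfolding d_def by (rule sum_lessThan_telescope')
  have "wsums d (x 0)" unfolding wsums_def
  proof (intro allI exI impI)
    fix m n assume "n \<ge> (m::nat)"
    have "x 0 - (\<Sum>i<n. d i) = x n" by (simp add: sum)
    moreover have "x n \<in> small m" using small[OF x(2)] by (rule small_antimono) (use \<open>n \<ge> m\<close> in simp)
    ultimately show "x 0 - (\<Sum>i<n. d i) \<in> small m" by simp
  qed
  then have "x 0 - (\<Sum>i<0. d i) \<in> mI (Suc a + 0)"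
    using x(3) by (intro ideal_series) (simp_all add: d_def[symmetric])
  then show ?thesis by (simp add: x(1))
qed

section \<open>Binomial coefficients\<close>

lemma dvd_mult_of_natD:
  assumes "k > 0" "of_nat (CARD('p)) ^ (N + multiplicity (CARD('p)) k) dvd of_nat k * (c :: 'p::prime_card padic_int)"
  shows "of_nat (CARD('p)) ^ N dvd c"
proof -
  let ?v = "multiplicity (CARD('p)) k"
  obtain m where m: "k = CARD('p) ^ ?v * m" "(of_nat m :: 'p padic_int) dvd 1"
    using of_nat_padic_split[OF assms(1)] .
  have "(of_nat k :: 'p padic_int) = of_nat (CARD('p)) ^ ?v * of_nat m"
    by (subst m(1)) simp
  then have "of_nat (CARD('p)) ^ ?v * of_nat (CARD('p)) ^ N dvd of_nat (CARD('p)) ^ ?v * (of_nat m * c)"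
    using assms(2) by (simp add: power_add ac_simps)
  then have "of_nat (CARD('p)) ^ N dvd of_nat m * c" by (simp add: dvd_mult_cancel_left)
  then show ?thesis using unit_cancel_dvd[OF m(2)] by blast
qed

definition ffact :: "'a::comm_ring_1 \<Rightarrow> nat \<Rightarrow> 'a" where
  "ffact x n = (\<Prod>i<n. x - of_nat i)"

lemma ffact_cong: "c dvd x - y \<Longrightarrow> c dvd ffact x n - ffact y n"
  by (induction n) (auto simp: ffact_def intro: dvd_diff_mult)

lemma Suc_times_choose: "Suc k * (n choose Suc k) = (n - k) * (n choose k)"
proof (cases "k \<le> n")
  case True
  then obtain j where n: "n = k + j" using le_Suc_ex by blast
  have "Suc n * (n choose k) = ((n choose k) + (n choose Suc k)) * Suc k"
    using Suc_times_binomial_eq[of n k] by simp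
  moreover have "Suc n * (n choose k) = Suc k * (n choose k) + j * (n choose k)"
    unfolding n by (simp add: algebra_simps)
  ultimately have "j * (n choose k) = Suc k * (n choose Suc k)"
    by (metis add_mult_distrib2 add_left_cancel mult.commute)
  then show ?thesis by (simp add: n)
qed simp

lemma ffact_of_nat: "ffact (of_nat j) n = (of_nat (fact n * (j choose n)) :: 'a::comm_ring_1)"
proof (induction n)
  case (Suc n)
  have "ffact (of_nat j) (Suc n) = (of_nat (fact n * (j choose n)) * (of_nat j - of_nat n) :: 'a)"
    unfolding Suc[symmetric] by (simp add: ffact_def)
  also have "\<dots> = of_nat (fact n * ((j - n) * (j choose n)))"
    by (cases "n \<le> j") (simp_all add: of_nat_diff algebra_simps binomial_eq_0)
  also have "\<dots> = of_nat (fact (Suc n) * (j choose Suc n))"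
    unfolding Suc_times_choose[symmetric] by (simp add: algebra_simps)
  finally show ?case .
qed (simp add: ffact_def)

text \<open>Vandermonde's identity, carried over from rising factorials by the sign change x to
  -x.\<close>

lemma ffact_add:
  "ffact (x + y) n = (\<Sum>k\<le>n. of_nat (n choose k) * ffact x k * ffact y (n - k))"
proof -
  have f: "ffact z k = (-1) ^ k * pochhammer (- z) k" for z :: 'a and k
    by (induction k) (simp_all add: ffact_def pochhammer_Suc algebra_simps)
  have "ffact (x + y) n = (-1) ^ n * (\<Sum>k\<le>n. of_nat (n choose k) * pochhammer (- x) k * pochhammer (- y) (n - k))"
    unfolding f using pochhammer_binomial_sum[of "- x" "- y" n] by simp
  also have "\<dots> = (\<Sum>k\<le>n. of_nat (n choose k) * ffact x k * ffact y (n - k))"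
    unfolding sum_distrib_left
  proof (rule sum.cong)
    fix k assume "k \<in> {..n}"
    then have "(-1 :: 'a) ^ n = (-1) ^ k * (-1) ^ (n - k)" by (simp flip: power_add)
    then show "(-1) ^ n * (of_nat (n choose k) * pochhammer (- x) k * pochhammer (- y) (n - k))
        = of_nat (n choose k) * ffact x k * ffact y (n - k)"
      unfolding f by (simp add: ac_simps)
  qed simp
  finally show ?thesis .
qed

text \<open>True at natural numbers, where the quotient is a binomial coefficient, and extended to
  Z_p by density and by the closedness of the multiples of n!.\<close>

lemma fact_dvd_ffact: "fact n dvd ffact (x :: 'p::prime_card padic_int) n"
proof -
  have "of_nat (fact n) dvd ffact x n"
  proof (rule of_nat_dvd_padicI)
    fix N
    obtain j where "of_nat (CARD('p)) ^ N dvd x - of_nat j" by (rule padic_int_approx_nat)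
    then have "of_nat (CARD('p)) ^ N dvd ffact x n - ffact (of_nat j) n" by (rule ffact_cong)
    then show "\<exists>y. of_nat (fact n) dvd (y :: 'p padic_int) \<and> of_nat (CARD('p)) ^ N dvd ffact x n - y"
      unfolding ffact_of_nat by (metis of_nat_mult dvd_triv_left)
  qed simp
  then show ?thesis by simp
qed

lemma padic_binom_fact: "padic_binom x n * fact n = ffact (x :: 'p::prime_card padic_int) n"
  unfolding padic_binom_def ffact_def[symmetric] by (rule div_mult_padic[OF fact_nonzero fact_dvd_ffact])

lemma padic_binom_0 [simp]: "padic_binom (x :: 'p::prime_card padic_int) 0 = 1"
  using padic_binom_fact[of x 0] by (simp add: ffact_def)

lemma padic_binom_of_nat: "padic_binom (of_nat j :: 'p::prime_card padic_int) n = of_nat (j choose n)"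
  using padic_binom_fact[of "of_nat j :: 'p padic_int" n] unfolding ffact_of_nat by simp

lemma padic_binom_add:
  "padic_binom (x + y) n = (\<Sum>k\<le>n. padic_binom (x :: 'p::prime_card padic_int) k * padic_binom y (n - k))"
proof -
  have "fact n * padic_binom (x + y) n = (\<Sum>k\<le>n. of_nat (n choose k) * ffact x k * ffact y (n - k))"
    using padic_binom_fact[of "x + y" n] by (simp add: ffact_add mult.commute)
  also have "\<dots> = (\<Sum>k\<le>n. fact n * (padic_binom x k * padic_binom y (n - k)))"
  proof (rule sum.cong)
    fix k assume "k \<in> {..n}"
    then have "fact k * fact (n - k) * (n choose k) = (fact n :: nat)"
      using binomial_fact_lemma by auto
    then have "(fact n :: 'p padic_int) = of_nat (n choose k) * fact k * fact (n - k)"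
      by (metis (no_types, opaque_lifting) of_nat_fact of_nat_mult mult.commute mult.assoc)
    then show "of_nat (n choose k) * ffact x k * ffact y (n - k) = fact n * (padic_binom x k * padic_binom y (n - k))"
      unfolding padic_binom_fact[symmetric] by (simp add: ac_simps)
  qed simp
  finally show ?thesis unfolding sum_distrib_left[symmetric] by simp
qed

lemma padic_binom_absorb:
  "of_nat (Suc n) * padic_binom x (Suc n) = x * padic_binom (x - 1 :: 'p::prime_card padic_int) n"
proof -
  have "ffact x (Suc n) = x * ffact (x - 1) n"
    unfolding ffact_def prod.lessThan_Suc_shift by (simp add: algebra_simps)
  then have "fact n * (of_nat (Suc n) * padic_binom x (Suc n)) = fact n * (x * padic_binom (x - 1) n)"
    unfolding padic_binom_fact[symmetric] by (simp add: algebra_simps)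
  then show ?thesis by simp
qed

text \<open>If the multiplicity is v + 1, then p^(v+1) <= n gives v + 1 <= p^v <= n div p.\<close>

lemma multiplicity_le_div:
  assumes "prime (p::nat)" "n > 0" shows "multiplicity p n \<le> n div p"
proof (cases "multiplicity p n")
  case (Suc v)
  have p: "p > 1" using assms(1) prime_gt_1_nat by blast
  have "p ^ Suc v dvd n" using multiplicity_dvd[of p n] Suc by simp
  then have "p * p ^ v \<le> n" using assms(2) by (simp add: dvd_imp_le)
  then have "p ^ v \<le> n div p" using p by (simp add: less_eq_div_iff_mult_less_eq mult.commute)
  moreover have "v < p ^ v" using p by (intro power_gt_expt) simp
  ultimately show ?thesis using Suc by simp
qed simp

text \<open>p^k divides n binom(x, n) = x binom(x - 1, n - 1); cancelling n costs its multiplicity,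
  which is at most n div p.\<close>

lemma padic_binom_dvd:
  assumes "of_nat (CARD('p)) ^ k dvd (x :: 'p::prime_card padic_int)" "n > 0"
  shows "of_nat (CARD('p)) ^ (k - n div CARD('p)) dvd padic_binom x n"
proof (cases "k \<le> n div CARD('p)")
  case False
  obtain n' where n: "n = Suc n'" using assms(2) by (cases n) auto
  have "of_nat (CARD('p)) ^ k dvd of_nat n * padic_binom x n"
    unfolding n padic_binom_absorb using assms(1) by (rule dvd_mult2)
  moreover have "k - n div CARD('p) + multiplicity (CARD('p)) n \<le> k"
    using multiplicity_le_div[OF prime_prm[where 'p='p] assms(2)] False by simp
  ultimately have "of_nat (CARD('p)) ^ (k - n div CARD('p) + multiplicity (CARD('p)) n) dvd of_nat n * padic_binom x n"
    by (metis le_imp_power_dvd dvd_trans)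
  then show ?thesis by (rule dvd_mult_of_natD[OF assms(2)])
qed simp

lemma padic_binom_cong:
  "\<exists>M. \<forall>x y :: 'p::prime_card padic_int. of_nat (CARD('p)) ^ M dvd x - y \<longrightarrow>
    of_nat (CARD('p)) ^ N dvd padic_binom x n - padic_binom y n"
proof (intro exI allI impI)
  fix x y :: "'p padic_int"
  assume "of_nat (CARD('p)) ^ (N + multiplicity (CARD('p)) (fact n :: nat)) dvd x - y"
  then have "of_nat (CARD('p)) ^ (N + multiplicity (CARD('p)) (fact n :: nat)) dvd
      of_nat (fact n) * (padic_binom x n - padic_binom y n)"
    using ffact_cong[of _ x y n] by (simp add: padic_binom_fact[symmetric] algebra_simps)
  then show "of_nat (CARD('p)) ^ N dvd padic_binom x n - padic_binom y n"
    by (rule dvd_mult_of_natD[rotated]) simp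
qed

section \<open>Filtrations and finite differences\<close>

definition dif :: "(nat \<Rightarrow> 'a::ab_group_add) \<Rightarrow> nat \<Rightarrow> 'a" where
  "dif f z = f (Suc z) - f z"

text \<open>Serves both the powers of p in Z_p and the sets \<open>XJ\<close>, which are not given
  as powers of an ideal but multiply in the same way.\<close>

locale filtration =
  fixes J :: "nat \<Rightarrow> 'r::comm_ring_1 set"
  assumes zero: "0 \<in> J k"
    and add: "x \<in> J k \<Longrightarrow> y \<in> J k \<Longrightarrow> x + y \<in> J k"
    and mult: "x \<in> J i \<Longrightarrow> y \<in> J j \<Longrightarrow> x * y \<in> J (i + j)"
    and top: "x \<in> J 0"
    and le: "x \<in> J n \<Longrightarrow> m \<le> n \<Longrightarrow> x \<in> J m"
begin

text \<open>
  \<open>fil M k f\<close> says that $\Delta^m f$ takes values in $J_{k + m}$ for all $m \leq M$; cutting off at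
  $M$ allows induction on the order of the difference.
\<close>

primrec fil :: "nat \<Rightarrow> nat \<Rightarrow> (nat \<Rightarrow> 'r) \<Rightarrow> bool" where
  "fil 0 k f = (\<forall>z. f z \<in> J k)"
| "fil (Suc M) k f = ((\<forall>z. f z \<in> J k) \<and> fil M (Suc k) (dif f))"

lemma fil_val: "fil M k f \<Longrightarrow> f z \<in> J k"
  by (cases M) auto

lemma fil_SucD: "fil (Suc M) k f \<Longrightarrow> fil M k f"
  by (induction M arbitrary: k f) auto

lemma fil_le: "fil M k f \<Longrightarrow> k' \<le> k \<Longrightarrow> fil M k' f"
  by (induction M arbitrary: k k' f) (auto intro: le)

lemma fil_0: "fil M k (\<lambda>z. 0)"
proof (induction M arbitrary: k)
  case (Suc M)
  have "dif (\<lambda>z. 0 :: 'r) = (\<lambda>z. 0)" by (simp add: dif_def fun_eq_iff)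
  then show ?case using Suc by (simp add: zero)
qed (simp add: zero)

lemma fil_const: "c \<in> J k \<Longrightarrow> fil M k (\<lambda>z. c)"
proof (cases M)
  case (Suc M')
  assume "c \<in> J k"
  have "dif (\<lambda>z. c) = (\<lambda>z. 0)" by (simp add: dif_def fun_eq_iff)
  then show ?thesis using fil_0 Suc \<open>c \<in> J k\<close> by simp
qed simp

lemma fil_add: "fil M k f \<Longrightarrow> fil M k g \<Longrightarrow> fil M k (\<lambda>z. f z + g z)"
proof (induction M arbitrary: k f g)
  case (Suc M)
  have "dif (\<lambda>z. f z + g z) = (\<lambda>z. dif f z + dif g z)" by (simp add: dif_def fun_eq_iff)
  then show ?case using Suc by (simp add: add)
qed (simp add: add)

lemma fil_shift: "fil M k f \<Longrightarrow> fil M k (\<lambda>z. f (Suc z))"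
proof (induction M arbitrary: k f)
  case (Suc M)
  have "dif (\<lambda>z. f (Suc z)) = (\<lambda>z. dif f (Suc z))" by (simp add: dif_def fun_eq_iff)
  then show ?case using Suc by simp
qed simp

text \<open>The product rule \<Delta>(f g)(z) = \<Delta>f(z) g(z + 1) + f(z) \<Delta>g(z) puts
  exactly one difference, hence one extra level, in each term.\<close>

lemma fil_mult: "fil M j f \<Longrightarrow> fil M k g \<Longrightarrow> fil M (j + k) (\<lambda>z. f z * g z)"
proof (induction M arbitrary: j k f g)
  case (Suc M)
  have "fil M (Suc j + k) (\<lambda>z. dif f z * g (Suc z))"
    using Suc.prems(1) by (intro Suc.IH fil_shift fil_SucD[OF Suc.prems(2)]) simp
  moreover have "fil M (j + Suc k) (\<lambda>z. f z * dif g z)"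
    using Suc.prems(2) by (intro Suc.IH fil_SucD[OF Suc.prems(1)]) simp
  moreover have "dif (\<lambda>z. f z * g z) = (\<lambda>z. dif f z * g (Suc z) + f z * dif g z)"
    by (simp add: dif_def fun_eq_iff algebra_simps)
  ultimately have "fil M (Suc (j + k)) (dif (\<lambda>z. f z * g z))" by (simp add: fil_add)
  then show ?case using Suc.prems by (simp add: mult)
qed (simp add: mult)

lemma fil_uminus: "fil M k f \<Longrightarrow> fil M k (\<lambda>z. - f z)"
  using fil_mult[OF fil_const[OF top], of M k f "- 1"] by simp

lemma fil_dif_power: "fil M k f \<Longrightarrow> m \<le> M \<Longrightarrow> (dif ^^ m) f z \<in> J (k + m)"
proof (induction m arbitrary: M k f)
  case 0
  then show ?case by (simp add: fil_val)
next
  case (Suc m)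
  obtain M' where M: "M = Suc M'" using Suc.prems(2) by (cases M) auto
  have "(dif ^^ m) (dif f) z \<in> J (Suc k + m)"
    using Suc.prems M by (intro Suc.IH[of M']) auto
  then show ?case by (simp add: funpow_swap1)
qed

end

interpretation padic: filtration "\<lambda>k. {x :: 'p::prime_card padic_int. of_nat (CARD('p)) ^ k dvd x}"
proof
  fix x :: "'p padic_int" and m n :: nat
  assume "x \<in> {x. of_nat (CARD('p)) ^ n dvd x}" "m \<le> n"
  then show "x \<in> {x. of_nat (CARD('p)) ^ m dvd x}" using power_le_dvd by blast
next
  fix x y :: "'p padic_int" and i j :: nat
  assume "x \<in> {x. of_nat (CARD('p)) ^ i dvd x}" "y \<in> {x. of_nat (CARD('p)) ^ j dvd x}"
  then show "x * y \<in> {x. of_nat (CARD('p)) ^ (i + j) dvd x}" by (simp add: power_add mult_dvd_mono)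
qed simp_all

text \<open>The difference of 1 / w is -\<Delta>w(z) / (w(z) w(z + 1)); the factor \<Delta>w
  supplies the extra level, and the bound on 1 / w for one order less supplies the rest.\<close>

lemma padic_fil_inverse:
  fixes w v :: "nat \<Rightarrow> 'p::prime_card padic_int"
  assumes "\<And>z. w z * v z = 1" "padic.fil M 0 w"
  shows "padic.fil M 0 v"
  using assms(2)
proof (induction M)
  case (Suc M)
  have "padic.fil M 0 v" by (rule Suc.IH[OF padic.fil_SucD[OF Suc.prems]])
  then have v: "padic.fil M 0 v" "padic.fil M 0 (\<lambda>z. v (Suc z))" by (auto intro: padic.fil_shift)
  have "dif v = (\<lambda>z. - (dif w z * (v z * v (Suc z))))"
  proof
    fix z
    have "dif w z * (v z * v (Suc z)) = w (Suc z) * v (Suc z) * v z - w z * v z * v (Suc z)"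
      by (simp add: dif_def algebra_simps)
    then show "dif v z = - (dif w z * (v z * v (Suc z)))" by (simp add: assms(1) dif_def)
  qed
  moreover have "padic.fil M (Suc 0 + (0 + 0)) (\<lambda>z. dif w z * (v z * v (Suc z)))"
    using Suc.prems v by (intro padic.fil_mult) auto
  ultimately show ?case by (simp add: padic.fil_uminus)
qed simp

text \<open>
  The loss of $\lfloor n / p \rfloor$ absorbs the denominator of $\binom{x}{n} = \frac{x}{n}
  \binom{x - 1}{n - 1}$, and it is superadditive in $n$, which makes \<open>XJ\<close> multiplicative.
\<close>

definition XJ :: "nat \<Rightarrow> 'p::prime_card iwasawa fps set" where
  "XJ m = {F. \<forall>n. fps_nth F n \<in> mI (m - n div CARD('p))}"

lemma mI_le: "x \<in> mI n \<Longrightarrow> m \<le> n \<Longrightarrow> x \<in> mI m"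
  by (rule ideal_pow_le)

interpretation XJ: filtration "XJ :: nat \<Rightarrow> 'p::prime_card iwasawa fps set"
proof
  fix x y :: "'p iwasawa fps" and i j
  assume x: "x \<in> XJ i" and y: "y \<in> XJ j"
  show "x * y \<in> XJ (i + j)"
    unfolding XJ_def mem_Collect_eq fps_mult_nth
  proof (intro allI ideal_pow_sum)
    fix n l :: nat assume l: "l \<in> {0..n}"
    have "fps_nth x l * fps_nth y (n - l) \<in> mI ((i - l div CARD('p)) + (j - (n - l) div CARD('p)))"
      using x y unfolding XJ_def by (intro ideal_pow_mult) auto
    moreover have "l div CARD('p) + (n - l) div CARD('p) \<le> n div CARD('p)"
      using div_add1_eq[of l "n - l" "CARD('p)"] l by simp
    ultimately show "fps_nth x l * fps_nth y (n - l) \<in> mI (i + j - n div CARD('p))"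
      by (elim mI_le) simp
  qed
next
  fix x :: "'p iwasawa fps" and m n :: nat
  assume "x \<in> XJ n" "m \<le> n"
  then show "x \<in> XJ m" unfolding XJ_def by (auto intro: mI_le diff_le_mono)
next
  fix x y :: "'p iwasawa fps" and k
  assume "x \<in> XJ k" "y \<in> XJ k"
  then show "x + y \<in> XJ k" unfolding XJ_def by (simp add: ideal_pow_add)
qed (simp_all add: XJ_def)

lemma iw_const_dvd_mI:
  assumes "of_nat (CARD('p)) ^ k dvd (x :: 'p::prime_card padic_int)" shows "iw_const x \<in> mI k"
proof -
  obtain y where "x = of_nat (CARD('p)) ^ k * y" using assms by (rule dvdE)
  then have "iw_const x = of_nat (CARD('p)) ^ k * iw_const y"
    by (simp add: iw_const_mult iw_const_power iw_const_of_nat)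
  then show ?thesis using ideal_pow_power[OF ideal_pow_gen1[of "of_nat (CARD('p))" "iw_T :: 'p iwasawa"], of k] by (simp add: ideal_pow_mult_right)
qed

text \<open>
  The generating function $[w] (1 + X)^x$ of the functions $[w] \binom{x}{n}$ is a character of
  $\mathbb{Z}_p^\times \times \mathbb{Z}_p$, so its differences along $z \mapsto (w(z), f(z))$ involve
  it at the point $(w(z + 1) / w(z), f(z + 1) - f(z))$ again.
\<close>

definition genf :: "'p::prime_card padic_int \<Rightarrow> 'p padic_int \<Rightarrow> 'p iwasawa fps" where
  "genf w x = fps_const (univ_char w) * Abs_fps (\<lambda>n. iw_const (padic_binom x n))"

lemma genf_nth: "fps_nth (genf w x) n = univ_char w * iw_const (padic_binom x n)"
  by (simp add: genf_def)

lemma genf_mult: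
  assumes "w dvd 1" "w' dvd 1"
  shows "genf (w * w') (x + y) = genf w x * genf w' y"
proof -
  have "Abs_fps (\<lambda>n. iw_const (padic_binom (x + y) n))
      = Abs_fps (\<lambda>n. iw_const (padic_binom x n)) * Abs_fps (\<lambda>n. iw_const (padic_binom y n))"
    by (rule fps_ext) (simp add: fps_mult_nth padic_binom_add iw_const_sum iw_const_mult atLeast0AtMost)
  then show ?thesis
    unfolding genf_def univ_char_mult[OF assms] by (simp add: ac_simps flip: fps_const_mult)
qed

text \<open>The constant coefficient is [w] - 1 and suffers no loss. In positive degree the bound
  comes from the binomial coefficient alone. The two precisions, q p^k for w and p^(k+1) for x, are
  those that yield the same level k + 1.\<close>

lemma genf_close:
  fixes w x :: "'p::prime_card padic_int"
  assumes "of_nat (CARD('p)) ^ (lev_exp TYPE('p) + k) dvd w - 1" "of_nat (CARD('p)) ^ Suc k dvd x"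
  shows "genf w x - 1 \<in> XJ (Suc k)"
  unfolding XJ_def mem_Collect_eq
proof
  fix n
  have w: "univ_char w - 1 \<in> mI (Suc k)" by (rule univ_char_close[OF assms(1)])
  show "fps_nth (genf w x - 1) n \<in> mI (Suc k - n div CARD('p))"
  proof (cases "n = 0")
    case True
    then show ?thesis using w by (simp add: genf_nth)
  next
    case False
    have "iw_const (padic_binom x n) \<in> mI (Suc k - n div CARD('p))"
      using False by (intro iw_const_dvd_mI padic_binom_dvd assms) auto
    then show ?thesis using False by (simp add: genf_nth ideal_pow_mult_left)
  qed
qed

lemma dif_genf:
  assumes "\<And>z. w z * v z = 1"
  shows "dif (\<lambda>z. genf (w z) (f z)) = (\<lambda>z. genf (w z) (f z) * (genf (w (Suc z) * v z) (dif f z) - 1))"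
proof
  fix z
  have u: "w z dvd 1" "v z dvd 1" for z using assms[of z] by (metis dvdI, metis dvdI mult.commute)
  have "w (Suc z) * v z dvd 1" using mult_dvd_mono[OF u(1)[of "Suc z"] u(2)[of z]] by simp
  then have "genf (w z) (f z) * genf (w (Suc z) * v z) (dif f z) = genf (w z * (w (Suc z) * v z)) (f z + dif f z)"
    using genf_mult u by metis
  also have "w z * (w (Suc z) * v z) = w (Suc z)" using assms[of z] by (metis mult.assoc mult.commute mult_1)
  also have "f z + dif f z = f (Suc z)" by (simp add: dif_def)
  finally show "dif (\<lambda>z. genf (w z) (f z)) z = genf (w z) (f z) * (genf (w (Suc z) * v z) (dif f z) - 1)"
    by (simp add: dif_def algebra_simps)
qed

lemma inverse_quotient:
  fixes w v :: "nat \<Rightarrow> 'a::comm_ring_1"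
  assumes "\<And>z. w z * v z = 1" shows "w (Suc z) * v z * (v (Suc z) * w z) = 1"
proof -
  have "w (Suc z) * v z * (v (Suc z) * w z) = (w (Suc z) * v (Suc z)) * (w z * v z)" by (simp add: ac_simps)
  then show ?thesis by (simp only: assms mult_1)
qed

lemma fil_quotient:
  fixes w v :: "nat \<Rightarrow> 'p::prime_card padic_int"
  assumes "\<And>z. w z * v z = 1" "padic.fil M 0 w" "padic.fil M k (dif w)"
  shows "padic.fil M k (\<lambda>z. w (Suc z) * v z - 1)"
proof -
  have "padic.fil M (k + 0) (\<lambda>z. dif w z * v z)"
    by (rule padic.fil_mult[OF assms(3) padic_fil_inverse[OF assms(1,2)]])
  moreover have "dif w z * v z = w (Suc z) * v z - 1" for z
    using assms(1)[of z] by (simp add: dif_def algebra_simps)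
  ultimately show ?thesis by simp
qed

text \<open>The induction varies k, w and f: the first difference is \<open>genf\<close> times the
  same kind of expression for w(z + 1) / w(z) and \<Delta>f, which satisfy the hypotheses with k +
  1. The hypotheses hold for all orders M, since passing to a difference uses them at the next
  order.\<close>

lemma fil_genf_minus_1:
  fixes w v f :: "nat \<Rightarrow> 'p::prime_card padic_int"
  assumes "\<And>z. w z * v z = 1"
    and "\<And>M. padic.fil M (lev_exp TYPE('p) + k) (\<lambda>z. w z - 1)"
    and "\<And>M. padic.fil M (Suc k) f"
  shows "XJ.fil M (Suc k) (\<lambda>z. genf (w z) (f z) - 1)"
  using assms
proof (induction M arbitrary: k w v f)
  case (Suc M)
  have val: "genf (w z) (f z) - 1 \<in> XJ (Suc k)" for z
    using padic.fil_val[OF Suc.prems(2), of z] padic.fil_val[OF Suc.prems(3), of z]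
    by (intro genf_close) auto
  have u: "w z dvd 1" "v z dvd 1" for z using Suc.prems(1)[of z] by (metis dvdI, metis dvdI mult.commute)
  have dw: "dif (\<lambda>z. w z - 1) = dif w" by (simp add: dif_def fun_eq_iff)
  have w0: "padic.fil M 0 w" for M
    using padic.fil_add[OF padic.fil_le[OF Suc.prems(2), of 0] padic.fil_const[OF padic.top], of M 1] by simp
  have dw': "padic.fil M (lev_exp TYPE('p) + Suc k) (dif w)" for M
    using Suc.prems(2)[of "Suc M"] unfolding padic.fil.simps dw by simp
  have "XJ.fil M (Suc (Suc k)) (\<lambda>z. genf (w (Suc z) * v z) (dif f z) - 1)"
  proof (rule Suc.IH[where v = "\<lambda>z. v (Suc z) * w z"])
    show "w (Suc z) * v z * (v (Suc z) * w z) = 1" for z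
      using inverse_quotient[of w v] Suc.prems(1) by blast
    show "padic.fil M (lev_exp TYPE('p) + Suc k) (\<lambda>z. w (Suc z) * v z - 1)" for M
      by (rule fil_quotient[OF Suc.prems(1) w0 dw'])
    show "padic.fil M (Suc (Suc k)) (dif f)" for M
      using Suc.prems(3)[of "Suc M"] by simp
  qed
  \<comment> \<open>The undifferenced factor is 1 plus the function of the induction hypothesis for
    the same k, w, f and one order less.\<close>
  moreover have "XJ.fil M 0 (\<lambda>z. genf (w z) (f z))"
    using XJ.fil_add[OF XJ.fil_le[OF Suc.IH[OF Suc.prems], of 0] XJ.fil_const[OF XJ.top], of 1] by simp
  ultimately have "XJ.fil M (0 + Suc (Suc k))
      (\<lambda>z. genf (w z) (f z) * (genf (w (Suc z) * v z) (dif f z) - 1))"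
    by (intro XJ.fil_mult)
  moreover have "dif (\<lambda>z. genf (w z) (f z) - 1) = dif (\<lambda>z. genf (w z) (f z))"
    by (simp add: dif_def fun_eq_iff)
  ultimately show ?case using val by (simp add: dif_genf[OF Suc.prems(1)])
next
  case 0
  show ?case
    using padic.fil_val[OF 0(2)] padic.fil_val[OF 0(3)] by (auto intro!: genf_close)
qed

text \<open>The values of w are arbitrary units, so \<open>genf\<close> itself is not close to 1.
  Only after the first difference do w(z + 1) / w(z) and \<Delta>f meet the hypotheses of
  \<open>fil_genf_minus_1\<close>, with k = 0.\<close>

lemma fil_genf:
  fixes w v f :: "nat \<Rightarrow> 'p::prime_card padic_int"
  assumes "\<And>z. w z * v z = 1"
    and "\<And>M. padic.fil M 0 w"
    and "\<And>M. padic.fil M (lev_exp TYPE('p)) (dif w)"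
    and "\<And>M. padic.fil M 0 f"
  shows "XJ.fil M 0 (\<lambda>z. genf (w z) (f z))"
proof (induction M)
  case (Suc M)
  have "XJ.fil M (Suc 0) (\<lambda>z. genf (w (Suc z) * v z) (dif f z) - 1)"
  proof (rule fil_genf_minus_1[where v = "\<lambda>z. v (Suc z) * w z"])
    show "w (Suc z) * v z * (v (Suc z) * w z) = 1" for z
      using inverse_quotient[of w v] assms(1) by blast
    show "padic.fil M (lev_exp TYPE('p) + 0) (\<lambda>z. w (Suc z) * v z - 1)" for M
      using fil_quotient[OF assms(1-3)] by simp
    show "padic.fil M (Suc 0) (dif f)" for M
      using assms(4)[of "Suc M"] by simp
  qed
  then have "XJ.fil M (0 + Suc 0) (\<lambda>z. genf (w z) (f z) * (genf (w (Suc z) * v z) (dif f z) - 1))"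
    by (intro XJ.fil_mult Suc.IH)
  then show ?case by (simp add: dif_genf[OF assms(1)] XJ.top)
qed (simp add: XJ.top)

lemma dif_power_fps_nth: "(dif ^^ m) (\<lambda>z. fps_nth (F z) n) z = fps_nth ((dif ^^ m) F z) n"
  by (induction m arbitrary: z) (simp_all add: dif_def)

text \<open>q dividing c is the condition that \<open>fil_genf\<close> puts on the difference of w =
  c z + d; p dividing a makes az + b, and with it (az + b) / (cz + d), gain a factor p with each
  difference.\<close>

lemma slash_binom_dif:
  fixes a b c d :: "'p::prime_card padic_int"
  assumes "of_nat (CARD('p)) dvd a" "of_nat (lev TYPE('p)) dvd c" "d dvd 1"
  shows "(dif ^^ m) (\<lambda>z. univ_char (c * of_nat z + d)
      * iw_const (padic_binom ((a * of_nat z + b) div (c * of_nat z + d)) n)) 0 \<in> mI (m - n div CARD('p))"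
proof -
  define w where "w z = c * of_nat z + d" for z :: nat
  have unit: "w z dvd 1" for z unfolding w_def
  proof (rule unit_add_p[OF assms(3)])
    have "of_nat (CARD('p)) dvd c" using lev_dvd assms(2) by (rule dvd_trans)
    then show "of_nat (CARD('p)) dvd c * of_nat z + d - d" by simp
  qed
  have "\<exists>y. w z * y = 1" for z
  proof -
    obtain y where "1 = w z * y" using unit[of z] by (rule dvdE)
    then have "w z * y = 1" by (rule sym)
    then show ?thesis by (rule exI)
  qed
  then obtain v where v: "\<And>z. w z * v z = 1" by metis
  define f where "f z = (a * of_nat z + b) * v z" for z
  have f: "(a * of_nat z + b) div w z = f z" for z
  proof -
    have "f z * w z = (a * of_nat z + b) * (w z * v z)" unfolding f_def by (simp only: ac_simps)
    then have "a * of_nat z + b = f z * w z" by (simp add: v)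
    moreover have "w z \<noteq> 0" using v[of z] by auto
    ultimately show ?thesis by simp
  qed
  \<comment> \<open>The first difference of a linear function is constant, so the divisibility of
    the slope settles all orders.\<close>
  have lin: "padic.fil M k (dif (\<lambda>z. a' * of_nat z + b'))" if "of_nat (CARD('p)) ^ k dvd a'" for M k and a' b' :: "'p padic_int"
  proof -
    have "dif (\<lambda>z. a' * of_nat z + b') = (\<lambda>z. a')" by (simp add: dif_def fun_eq_iff algebra_simps)
    then show ?thesis using that by (simp add: padic.fil_const)
  qed
  have lin0: "padic.fil M 0 (\<lambda>z. a' * of_nat z + b')" if "of_nat (CARD('p)) dvd a'" for M and a' b' :: "'p padic_int"
    using lin[of 1 a' _ b'] that by (cases M) auto
  have c: "of_nat (CARD('p)) dvd c" using lev_dvd assms(2) by (rule dvd_trans)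
  have w0: "padic.fil M 0 w" for M unfolding w_def by (rule lin0[OF c])
  have "XJ.fil m 0 (\<lambda>z. genf (w z) (f z))"
  proof (rule fil_genf[OF v w0])
    show "padic.fil M (lev_exp TYPE('p)) (dif w)" for M
      unfolding w_def using assms(2) by (intro lin) (simp add: lev_eq_power)
    show "padic.fil M 0 f" for M unfolding f_def
      using padic.fil_mult[OF lin0[OF assms(1)] padic_fil_inverse[OF v w0]] by simp
  qed
  then have "(dif ^^ m) (\<lambda>z. genf (w z) (f z)) 0 \<in> XJ (0 + m)" by (rule XJ.fil_dif_power) simp
  then have "fps_nth ((dif ^^ m) (\<lambda>z. genf (w z) (f z)) 0) n \<in> mI (m - n div CARD('p))"
    unfolding XJ_def by simp
  then show ?thesis by (simp add: dif_power_fps_nth[symmetric] genf_nth f w_def[symmetric])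
qed

section \<open>Mahler expansions\<close>

lemma open_mI_ball: "open {y :: 'p::prime_card iwasawa. y - x \<in> mI n}"
  unfolding open_iwasawa_def
proof (intro ballI exI[of _ n] allI impI)
  fix z y :: "'p iwasawa"
  assume "z \<in> {y. y - x \<in> mI n}" "y - z \<in> mI n"
  then have "(y - z) + (z - x) \<in> mI n" by (intro ideal_pow_add) auto
  then show "y \<in> {y. y - x \<in> mI n}" by simp
qed

lemma tendsto_iwasawa_iff:
  "(f \<longlongrightarrow> (L :: 'p::prime_card iwasawa)) F \<longleftrightarrow> (\<forall>n. eventually (\<lambda>i. f i - L \<in> mI n) F)"
proof
  assume "(f \<longlongrightarrow> L) F"
  then show "\<forall>n. eventually (\<lambda>i. f i - L \<in> mI n) F"
    using topological_tendstoD[OF _ open_mI_ball, of f L F L] by simp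
next
  assume ev: "\<forall>n. eventually (\<lambda>i. f i - L \<in> mI n) F"
  show "(f \<longlongrightarrow> L) F"
  proof (rule topological_tendstoI)
    fix S assume "open S" "L \<in> S"
    then obtain n where "\<And>y. y - L \<in> mI n \<Longrightarrow> y \<in> S"
      unfolding open_iwasawa_def by blast
    then show "eventually (\<lambda>i. f i \<in> S) F"
      using ev by (metis (mono_tags, lifting) eventually_mono)
  qed
qed

text \<open>The powers of (p, T) intersect in 0. Uniqueness of limits is needed to recover Mahler
  coefficients from the function.\<close>

instance iwasawa :: (prime_card) t2_space
proof
  fix x y :: "'a iwasawa"
  assume "x \<noteq> y"
  then obtain n where n: "x - y \<notin> mI n" using ideal_all_eq_0[of "x - y"] by auto
  have "{z. z - x \<in> mI n} \<inter> {z. z - y \<in> mI n} = {}"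
  proof (rule ccontr)
    assume "\<not> ?thesis"
    then obtain z where "z - x \<in> mI n" "z - y \<in> mI n" by blast
    then have "(z - y) - (z - x) \<in> mI n" using ideal_pow_diff by blast
    then show False using n by simp
  qed
  then show "\<exists>U V. open U \<and> open V \<and> x \<in> U \<and> y \<in> V \<and> U \<inter> V = {}"
    using open_mI_ball[of x n] open_mI_ball[of y n]
    by (intro exI[of _ "{z. z - x \<in> mI n}"] exI[of _ "{z. z - y \<in> mI n}"]) auto
qed

lemma continuous_padic_iwasawa_iff:
  fixes h :: "'p::prime_card padic_int \<Rightarrow> 'p iwasawa"
  shows "continuous_on UNIV h \<longleftrightarrow>
    (\<forall>z N. \<exists>M. \<forall>z'. of_nat (CARD('p)) ^ M dvd z' - z \<longrightarrow> h z' - h z \<in> mI N)"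
proof -
  have "continuous_on UNIV h \<longleftrightarrow> (\<forall>B. open B \<longrightarrow> open (h -` B))"
    by (simp add: continuous_on_open_vimage)
  also have "\<dots> \<longleftrightarrow> (\<forall>z N. \<exists>M. \<forall>z'. of_nat (CARD('p)) ^ M dvd z' - z \<longrightarrow> h z' - h z \<in> mI N)"
  proof (intro iffI allI impI)
    fix z N
    assume "\<forall>B. open B \<longrightarrow> open (h -` B)"
    then have "open (h -` {y. y - h z \<in> mI N})" using open_mI_ball by blast
    moreover have "z \<in> h -` {y. y - h z \<in> mI N}" by simp
    ultimately show "\<exists>M. \<forall>z'. of_nat (CARD('p)) ^ M dvd z' - z \<longrightarrow> h z' - h z \<in> mI N"
      unfolding open_padic_int_def by auto
  next
    fix B :: "'p iwasawa set"
    assume c: "\<forall>z N. \<exists>M. \<forall>z'. of_nat (CARD('p)) ^ M dvd z' - z \<longrightarrow> h z' - h z \<in> mI N" and "open B"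
    show "open (h -` B)" unfolding open_padic_int_def
    proof
      fix z assume "z \<in> h -` B"
      then obtain N where "\<And>y. y - h z \<in> mI N \<Longrightarrow> y \<in> B"
        using \<open>open B\<close> unfolding open_iwasawa_def by auto
      then show "\<exists>M. \<forall>z'. of_nat (CARD('p)) ^ M dvd z' - z \<longrightarrow> z' \<in> h -` B"
        using c by (metis vimageI2)
    qed
  qed
  finally show ?thesis .
qed

lemma dif_power_dif: "(dif ^^ k) (dif f) = (dif ^^ Suc k) f"
  by (simp add: funpow_swap1)

lemma newton_expansion:
  fixes f :: "nat \<Rightarrow> 'a::comm_ring_1"
  assumes "z \<le> K"
  shows "f z = (\<Sum>k\<le>K. of_nat (z choose k) * (dif ^^ k) f 0)"
  using assms
proof (induction z arbitrary: f K)
  case 0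
  have "(\<Sum>k\<le>K. of_nat (0 choose k) * (dif ^^ k) f 0) = (\<Sum>k\<in>{0}. of_nat (0 choose k) * (dif ^^ k) f 0)"
    by (rule sum.mono_neutral_right) (auto simp: binomial_eq_0)
  then show ?case by simp
next
  case (Suc z)
  then obtain K' where K: "K = Suc K'" by (cases K) auto
  have 1: "f z = (\<Sum>k\<le>K. of_nat (z choose k) * (dif ^^ k) f 0)" using Suc by simp
  have 2: "dif f z = (\<Sum>k\<le>K'. of_nat (z choose k) * (dif ^^ Suc k) f 0)"
    using Suc.IH[of K' "dif f"] Suc.prems K unfolding dif_power_dif by simp
  have "f (Suc z) = f z + dif f z" by (simp add: dif_def)
  then show ?case
    unfolding 1 2 K sum.atMost_Suc_shift by (simp add: sum.distrib algebra_simps)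
qed

text \<open>At natural numbers the expansion is Newton's finite formula. Approximate z by a natural
  number n: the function and one fixed partial sum change little by continuity, and all later
  partial sums differ from it by elements of the same ideal power, uniformly in the
  argument.\<close>

lemma mahler_sums:
  fixes g :: "'p::prime_card padic_int \<Rightarrow> 'p iwasawa"
  assumes "continuous_on UNIV g"
    and "\<And>N. \<exists>K. \<forall>k\<ge>K. (dif ^^ k) (\<lambda>n. g (of_nat n)) 0 \<in> mI N"
  shows "(\<lambda>k. (dif ^^ k) (\<lambda>n. g (of_nat n)) 0 * iw_const (padic_binom z k)) sums g z"
  unfolding sums_def tendsto_iwasawa_iff
proof
  fix N
  define a where "a k = (dif ^^ k) (\<lambda>n. g (of_nat n)) 0" for k
  define s where "s K z = (\<Sum>k<K. a k * iw_const (padic_binom z k))" for K z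
  obtain K0 where K0: "\<And>k. k \<ge> K0 \<Longrightarrow> a k \<in> mI N" using assms(2) unfolding a_def by metis
  have tail: "s K z - s K0 z \<in> mI N" if "K \<ge> K0" for K z
  proof -
    have "s K z - s K0 z = (\<Sum>k=K0..<K. a k * iw_const (padic_binom z k))"
      unfolding s_def using that by (simp add: sum_diff_nat_ivl atLeast0LessThan[symmetric])
    also have "\<dots> \<in> mI N" using K0 by (intro ideal_pow_sum ideal_pow_mult_right) simp
    finally show ?thesis .
  qed
  have "\<exists>M. \<forall>z'. of_nat (CARD('p)) ^ M dvd z' - z \<longrightarrow> s K z' - s K z \<in> mI N" for K
  proof (induction K)
    case 0
    show ?case by (simp add: s_def)
  next
    case (Suc K)
    then obtain M1 where M1: "\<And>z'. of_nat (CARD('p)) ^ M1 dvd z' - z \<Longrightarrow> s K z' - s K z \<in> mI N" by blast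
    obtain M2 where M2: "\<And>z'. of_nat (CARD('p)) ^ M2 dvd z' - z \<Longrightarrow>
        of_nat (CARD('p)) ^ N dvd padic_binom z' K - padic_binom z K"
      using padic_binom_cong[of N K, where 'p='p] by blast
    have "s (Suc K) z' - s (Suc K) z \<in> mI N" if "of_nat (CARD('p)) ^ (M1 + M2) dvd z' - z" for z'
    proof -
      have "of_nat (CARD('p)) ^ M1 dvd z' - z" "of_nat (CARD('p)) ^ M2 dvd z' - z"
        using that unfolding power_add by (auto dest: dvd_mult_left dvd_mult_right)
      then have "s K z' - s K z \<in> mI N" "iw_const (padic_binom z' K - padic_binom z K) \<in> mI N"
        using M1 M2 iw_const_dvd_mI by blast+
      then have "(s K z' - s K z) + a K * iw_const (padic_binom z' K - padic_binom z K) \<in> mI N"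
        by (intro ideal_pow_add ideal_pow_mult_left)
      then show ?thesis by (simp add: s_def iw_const_diff algebra_simps)
    qed
    then show ?case by blast
  qed
  then obtain M1 where M1: "\<And>z'. of_nat (CARD('p)) ^ M1 dvd z' - z \<Longrightarrow> s K0 z' - s K0 z \<in> mI N" by blast
  obtain M2 where M2: "\<And>z'. of_nat (CARD('p)) ^ M2 dvd z' - z \<Longrightarrow> g z' - g z \<in> mI N"
    using assms(1) unfolding continuous_padic_iwasawa_iff by blast
  obtain n where n: "of_nat (CARD('p)) ^ (M1 + M2) dvd z - of_nat n" by (rule padic_int_approx_nat)
  then have "of_nat (CARD('p)) ^ (M1 + M2) dvd of_nat n - z" by (metis dvd_minus_iff minus_diff_eq)
  then have "of_nat (CARD('p)) ^ M1 dvd of_nat n - z" "of_nat (CARD('p)) ^ M2 dvd of_nat n - z"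
    unfolding power_add by (auto dest: dvd_mult_left dvd_mult_right)
  then have A: "s K0 (of_nat n) - s K0 z \<in> mI N" and B: "g (of_nat n) - g z \<in> mI N"
    using M1 M2 by blast+
  \<comment> \<open>The bound n + K0 is large enough both for Newton's formula to be exact at n and
    for the tail estimate beyond K0.\<close>
  have "g (of_nat n) = (\<Sum>k\<le>n + K0. of_nat (n choose k) * a k)"
    unfolding a_def by (rule newton_expansion) simp
  then have g: "g (of_nat n) = s (Suc (n + K0)) (of_nat n)"
    unfolding s_def lessThan_Suc_atMost by (simp add: padic_binom_of_nat iw_const_of_nat mult.commute)
  have C: "s (Suc (n + K0)) (of_nat n) - s K0 (of_nat n) \<in> mI N" by (rule tail) simp
  have "s K z - g z \<in> mI N" if "K \<ge> K0" for K
  proof -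
    have "s K z - g z = (s K z - s K0 z) - (s K0 (of_nat n) - s K0 z)
        - (s (Suc (n + K0)) (of_nat n) - s K0 (of_nat n)) + (g (of_nat n) - g z)"
      by (simp add: g)
    also have "\<dots> \<in> mI N"
      by (rule ideal_pow_add[OF ideal_pow_diff[OF ideal_pow_diff[OF tail[OF that] A] C] B])
    finally show ?thesis .
  qed
  then show "eventually (\<lambda>K. (\<Sum>k<K. (dif ^^ k) (\<lambda>n. g (of_nat n)) 0 * iw_const (padic_binom z k)) - g z \<in> mI N) sequentially"
    unfolding eventually_sequentially s_def a_def by blast
qed

lemma basis_sums_iff:
  assumes "j < t"
  shows "(\<lambda>m. c m * basis_value t m j z) sums x \<longleftrightarrow>
    (\<lambda>k. c (t * k + j) * iw_const (padic_binom z k)) sums (x :: 'p::prime_card iwasawa)"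
proof -
  have "(\<lambda>k. c (t * k + j) * basis_value t (t * k + j) j z) sums x \<longleftrightarrow> (\<lambda>m. c m * basis_value t m j z) sums x"
  proof (rule sums_mono_reindex)
    show "strict_mono (\<lambda>k. t * k + j)" using assms by (auto simp: strict_mono_def)
    fix m assume "m \<notin> range (\<lambda>k. t * k + j)"
    then have "j \<noteq> m mod t" by (metis mult_div_mod_eq rangeI)
    then show "c m * basis_value t m j z = 0" by (simp add: basis_value_def)
  qed
  then show ?thesis using assms by (simp add: basis_value_def)
qed

lemma sums_of_nat_iff:
  "(\<lambda>k. c k * iw_const (padic_binom (of_nat n) k)) sums x \<longleftrightarrow>
    (x :: 'p::prime_card iwasawa) = (\<Sum>k\<le>n. c k * of_nat (n choose k))"
proof -
  have "(\<lambda>k. c k * iw_const (padic_binom (of_nat n) k)) sums (\<Sum>k\<le>n. c k * iw_const (padic_binom (of_nat n) k))"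
    by (rule sums_finite) (simp_all add: padic_binom_of_nat binomial_eq_0)
  then have "(\<lambda>k. c k * iw_const (padic_binom (of_nat n) k)) sums (\<Sum>k\<le>n. c k * of_nat (n choose k))"
    by (simp add: padic_binom_of_nat iw_const_of_nat)
  then show ?thesis using sums_unique2 by blast
qed

text \<open>The differences at 0 give one expansion by \<open>mahler_sums\<close>. It is the only
  one, because at natural numbers the series are finite and determine the coefficients
  recursively.\<close>

lemma coords_eq:
  fixes \<phi> :: "'p::prime_card form"
  assumes t: "t > 0"
    and cont: "\<And>j. j < t \<Longrightarrow> continuous_on UNIV (\<phi> (\<gamma> j))"
    and lim: "\<And>j N. j < t \<Longrightarrow> \<exists>K. \<forall>k\<ge>K. (dif ^^ k) (\<lambda>n. \<phi> (\<gamma> j) (of_nat n)) 0 \<in> mI N"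
  shows "coords t \<gamma> \<phi> m = (dif ^^ (m div t)) (\<lambda>n. \<phi> (\<gamma> (m mod t)) (of_nat n)) 0"
proof -
  define c where "c m = (dif ^^ (m div t)) (\<lambda>n. \<phi> (\<gamma> (m mod t)) (of_nat n)) 0" for m
  let ?P = "\<lambda>c. c \<longlonglongrightarrow> 0 \<and> (\<forall>j<t. \<forall>z. (\<lambda>m. c m * basis_value t m j z) sums \<phi> (\<gamma> j) z)"
  have sums: "(\<lambda>m. c m * basis_value t m j z) sums \<phi> (\<gamma> j) z" if "j < t" for j z
    unfolding basis_sums_iff[OF that] c_def using that mahler_sums[OF cont lim, of j] by simp
  have "c \<longlonglongrightarrow> 0"
    unfolding tendsto_iwasawa_iff
  proof
    fix N
    have "\<forall>j. \<exists>K. j < t \<longrightarrow> (\<forall>k\<ge>K. (dif ^^ k) (\<lambda>n. \<phi> (\<gamma> j) (of_nat n)) 0 \<in> mI N)"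
      using lim by blast
    from choice[OF this] obtain K
      where K: "\<And>j k. j < t \<Longrightarrow> k \<ge> K j \<Longrightarrow> (dif ^^ k) (\<lambda>n. \<phi> (\<gamma> j) (of_nat n)) 0 \<in> mI N"
      by blast
    \<comment> \<open>The sum of the t thresholds bounds each of them; the factor t translates a
      degree into an index of the interleaved basis.\<close>
    have "c m - 0 \<in> mI N" if "m \<ge> t * (\<Sum>j<t. K j)" for m
    proof -
      have m: "m mod t < t" using t by simp
      have "K (m mod t) \<le> (\<Sum>j<t. K j)" using m by (intro member_le_sum) auto
      also have "\<dots> \<le> m div t" using that t by (simp add: less_eq_div_iff_mult_less_eq mult.commute)
      finally show ?thesis unfolding c_def using K[OF m] by simp
    qed
    then show "eventually (\<lambda>m. c m - 0 \<in> mI N) sequentially" unfolding eventually_sequentially by blast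
  qed
  moreover have "c' = c" if "?P c'" for c'
  proof
    fix m
    have eq: "(\<Sum>k\<le>n. c' (t * k + j) * of_nat (n choose k)) = (\<Sum>k\<le>n. c (t * k + j) * of_nat (n choose k))"
      if "j < t" for j n
    proof -
      have "(\<lambda>k. c' (t * k + j) * iw_const (padic_binom (of_nat n) k)) sums \<phi> (\<gamma> j) (of_nat n)"
        "(\<lambda>k. c (t * k + j) * iw_const (padic_binom (of_nat n) k)) sums \<phi> (\<gamma> j) (of_nat n)"
        using \<open>?P c'\<close> sums[OF that] that basis_sums_iff[OF that, of c' "of_nat n" "\<phi> (\<gamma> j) (of_nat n)"]
          basis_sums_iff[OF that, of c "of_nat n" "\<phi> (\<gamma> j) (of_nat n)"] by blast+
      then show ?thesis unfolding sums_of_nat_iff by metis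
    qed
    \<comment> \<open>The equations at n = 0, 1, 2, ... form a triangular system with diagonal
      entries binom(k, k) = 1.\<close>
    have "c' (t * k + j) = c (t * k + j)" if "j < t" for j k
    proof (induction k rule: less_induct)
      case (less k)
      have "(\<Sum>i<k. c' (t * i + j) * of_nat (k choose i)) = (\<Sum>i<k. c (t * i + j) * of_nat (k choose i))"
        using less by simp
      then show ?case using eq[OF that, of k] by (simp add: lessThan_Suc_atMost[symmetric])
    qed
    from this[of "m mod t" "m div t"] show "c' m = c m" using t by simp
  qed
  ultimately have "coords t \<gamma> \<phi> = c"
    unfolding coords_def using sums by (intro the_equality conjI allI impI) auto
  then show ?thesis by (simp add: c_def)
qed

section \<open>Characteristic series\<close>

text \<open>Membership can be tested on coefficients because the ideal has two fixed generators:
  cofactors chosen for each coefficient assemble into two power series.\<close>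

lemma fps_ideal_pow_iff:
  "F \<in> ideal_pow (of_nat (CARD('p))) (fps_const iw_T) k \<longleftrightarrow>
    (\<forall>n. fps_nth F n \<in> (mI k :: 'p::prime_card iwasawa set))"
proof (induction k arbitrary: F)
  case 0
  show ?case by simp
next
  case (Suc k)
  have nth: "fps_nth (of_nat (CARD('p)) * x + fps_const iw_T * y) n
      = of_nat (CARD('p)) * fps_nth x n + iw_T * fps_nth y n" for x y :: "'p iwasawa fps" and n
    by (simp add: fps_of_nat[symmetric])
  show ?case
  proof
    assume "F \<in> ideal_pow (of_nat (CARD('p))) (fps_const iw_T) (Suc k)"
    then show "\<forall>n. fps_nth F n \<in> mI (Suc k)"
      by (elim ideal_pow_SucE) (auto simp: nth Suc.IH intro: ideal_pow_SucI)
  next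
    assume "\<forall>n. fps_nth F n \<in> mI (Suc k)"
    then have "\<forall>n. \<exists>x y. fps_nth F n = of_nat (CARD('p)) * x + iw_T * y \<and> x \<in> mI k \<and> y \<in> mI k"
      by (metis ideal_pow_SucE)
    then obtain x y where xy: "\<And>n. fps_nth F n = of_nat (CARD('p)) * x n + iw_T * y n"
      "\<And>n. x n \<in> mI k" "\<And>n. y n \<in> mI k" by metis
    have "F = of_nat (CARD('p)) * Abs_fps x + fps_const iw_T * Abs_fps y"
      by (rule fps_ext) (simp add: nth xy(1))
    then show "F \<in> ideal_pow (of_nat (CARD('p))) (fps_const iw_T) (Suc k)"
      using xy by (simp add: ideal_pow_SucI Suc.IH)
  qed
qed

text \<open>The principal minor in Leibniz form, which allows an index set that is not an initial
  segment.\<close>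

definition perm_minor :: "(nat \<Rightarrow> nat \<Rightarrow> 'r::comm_ring_1) \<Rightarrow> nat set \<Rightarrow> 'r" where
  "perm_minor P S = (\<Sum>\<sigma> | \<sigma> permutes S. of_int (sign \<sigma>) * (\<Prod>i\<in>S. P i (\<sigma> i)))"

text \<open>Expand each product of entries -X P + \<delta> over the set S of rows in which the first
  summand is chosen. The Kronecker symbols of the other rows vanish unless the permutation fixes
  every point outside S, so what remains is a sum over permutations of S.\<close>

lemma char_trunc_expand:
  "char_trunc P N = (\<Sum>S\<in>Pow {0..<N}. (- fps_X) ^ card S * fps_const (perm_minor P S))"
proof -
  let ?A = "{0..<N}"
  let ?M = "1\<^sub>m N - fps_X \<cdot>\<^sub>m mat N N (\<lambda>(i, j). fps_const (P i j))"
  have "char_trunc P N = (\<Sum>\<sigma> | \<sigma> permutes ?A. of_int (sign \<sigma>) * (\<Prod>i\<in>?A. ?M $$ (i, \<sigma> i)))"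
    unfolding char_trunc_def by (subst det_def'[where n = N]) auto
  also have "\<dots> = (\<Sum>\<sigma> | \<sigma> permutes ?A. of_int (sign \<sigma>) *
      (\<Prod>i\<in>?A. (- fps_X) * fps_const (P i (\<sigma> i)) + of_bool (\<sigma> i = i)))"
  proof (intro sum.cong refl arg_cong2[where f = "(*)"] prod.cong)
    fix \<sigma> i assume "\<sigma> \<in> {\<sigma>. \<sigma> permutes ?A}" and i: "i \<in> ?A"
    then have "\<sigma> i \<in> ?A" by (simp add: permutes_in_image del: atLeastLessThan_iff)
    then show "?M $$ (i, \<sigma> i) = (- fps_X) * fps_const (P i (\<sigma> i)) + of_bool (\<sigma> i = i)"
      using i by auto
  qed
  also have "\<dots> = (\<Sum>\<sigma> | \<sigma> permutes ?A. \<Sum>S\<in>Pow ?A. of_int (sign \<sigma>) *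
      ((\<Prod>i\<in>S. (- fps_X) * fps_const (P i (\<sigma> i))) * (\<Prod>i\<in>?A - S. of_bool (\<sigma> i = i))))"
    by (simp only: prod_add[OF finite_atLeastLessThan] sum_distrib_left)
  also have "\<dots> = (\<Sum>S\<in>Pow ?A. \<Sum>\<sigma> | \<sigma> permutes ?A. of_int (sign \<sigma>) *
      ((\<Prod>i\<in>S. (- fps_X) * fps_const (P i (\<sigma> i))) * (\<Prod>i\<in>?A - S. of_bool (\<sigma> i = i))))"
    by (rule sum.swap)
  also have "\<dots> = (\<Sum>S\<in>Pow ?A. (- fps_X) ^ card S * fps_const (perm_minor P S))"
  proof (rule sum.cong[OF refl])
    fix S assume "S \<in> Pow ?A"
    then have S: "S \<subseteq> ?A" "finite S" by (auto intro: finite_subset)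
    have "(\<Sum>\<sigma> | \<sigma> permutes ?A. of_int (sign \<sigma>) *
        ((\<Prod>i\<in>S. (- fps_X) * fps_const (P i (\<sigma> i))) * (\<Prod>i\<in>?A - S. of_bool (\<sigma> i = i))))
      = (\<Sum>\<sigma> | \<sigma> permutes S. of_int (sign \<sigma>) *
        ((\<Prod>i\<in>S. (- fps_X) * fps_const (P i (\<sigma> i))) * (\<Prod>i\<in>?A - S. of_bool (\<sigma> i = i))))"
    proof (rule sum.mono_neutral_right)
      show "finite {\<sigma>. \<sigma> permutes ?A}" by (rule finite_permutations) simp
      show "{\<sigma>. \<sigma> permutes S} \<subseteq> {\<sigma>. \<sigma> permutes ?A}" using permutes_subset[OF _ S(1)] by blast
      show "\<forall>\<sigma>\<in>{\<sigma>. \<sigma> permutes ?A} - {\<sigma>. \<sigma> permutes S}. of_int (sign \<sigma>) *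
        ((\<Prod>i\<in>S. (- fps_X) * fps_const (P i (\<sigma> i))) * (\<Prod>i\<in>?A - S. of_bool (\<sigma> i = i))) = 0"
      proof
        fix \<sigma> assume "\<sigma> \<in> {\<sigma>. \<sigma> permutes ?A} - {\<sigma>. \<sigma> permutes S}"
        then obtain i where "i \<in> ?A - S" "\<sigma> i \<noteq> i" using permutes_superset by blast
        then have "(\<Prod>i\<in>?A - S. of_bool (\<sigma> i = i)) = (0 :: 'a fps)"
          by (intro prod_zero) (auto intro!: bexI[of _ i])
        then show "of_int (sign \<sigma>) *
          ((\<Prod>i\<in>S. (- fps_X) * fps_const (P i (\<sigma> i))) * (\<Prod>i\<in>?A - S. of_bool (\<sigma> i = i))) = 0"
          by simp
      qed
    qed
    also have "\<dots> = (\<Sum>\<sigma> | \<sigma> permutes S. (- fps_X) ^ card S * fps_const (of_int (sign \<sigma>) * (\<Prod>i\<in>S. P i (\<sigma> i))))"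
    proof (rule sum.cong[OF refl])
      fix \<sigma> assume "\<sigma> \<in> {\<sigma>. \<sigma> permutes S}"
      then have "(\<Prod>i\<in>?A - S. of_bool (\<sigma> i = i)) = (1 :: 'a fps)"
        by (intro prod.neutral) (auto simp: permutes_not_in)
      moreover have "(\<Prod>i\<in>S. fps_const (P i (\<sigma> i))) = fps_const (\<Prod>i\<in>S. P i (\<sigma> i))"
        by (induction S rule: infinite_finite_induct) simp_all
      ultimately show "of_int (sign \<sigma>) *
          ((\<Prod>i\<in>S. (- fps_X) * fps_const (P i (\<sigma> i))) * (\<Prod>i\<in>?A - S. of_bool (\<sigma> i = i)))
        = (- fps_X) ^ card S * fps_const (of_int (sign \<sigma>) * (\<Prod>i\<in>S. P i (\<sigma> i)))"
        by (simp only: prod.distrib prod_constant mult_1_left mult_1_right fps_const_mult[symmetric] fps_of_int ac_simps)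
    qed
    also have "\<dots> = (- fps_X) ^ card S * fps_const (perm_minor P S)"
      unfolding sum_distrib_left[symmetric] perm_minor_def
      by (rule arg_cong2[where f = "(*)"], simp)
        (induction "{\<sigma>. \<sigma> permutes S}" rule: infinite_finite_induct; simp add: fps_sum_nth fps_eq_iff)
    finally show "(\<Sum>\<sigma> | \<sigma> permutes ?A. of_int (sign \<sigma>) *
        ((\<Prod>i\<in>S. (- fps_X) * fps_const (P i (\<sigma> i))) * (\<Prod>i\<in>?A - S. of_bool (\<sigma> i = i))))
      = (- fps_X) ^ card S * fps_const (perm_minor P S)" .
  qed
  finally show ?thesis .
qed

lemma fps_X_power_const_nth:
  "fps_nth ((- fps_X) ^ m * fps_const (c :: 'a::comm_ring_1)) k = (if k = m then (- 1) ^ m * c else 0)"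
proof -
  have "(- fps_X :: 'a fps) ^ m = fps_const ((- 1) ^ m) * fps_X ^ m"
    by (subst power_minus) (simp add: fps_const_power[symmetric] fps_const_neg[symmetric] del: fps_const_power fps_const_neg)
  then show ?thesis by (simp add: fps_X_power_nth mult.assoc)
qed

lemma char_trunc_nth:
  "fps_nth (char_trunc P N) k = (\<Sum>S\<in>Pow {0..<N}. if k = card S then (- 1) ^ card S * perm_minor P S else 0)"
  unfolding char_trunc_expand fps_sum_nth fps_X_power_const_nth ..

text \<open>The largest element of S is at least the number of the others, so removing it compares g
  at that element with the last term on the left.\<close>

lemma sum_mono_ge_lessThan:
  fixes g :: "nat \<Rightarrow> nat"
  assumes "mono g" "finite S" shows "(\<Sum>i<card S. g i) \<le> sum g S"
  using assms(2)
proof (induction S rule: finite_linorder_max_induct)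
  case (insert b A)
  have "card A \<le> card {..<b}" using insert.hyps by (intro card_mono) auto
  then have "g (card A) \<le> g b" using assms(1) by (simp add: monoD)
  moreover have "b \<notin> A" using insert.hyps by auto
  ultimately show ?case using insert by simp
qed simp

text \<open>The row index supplies r factors and the column index takes s of them away. The
  remaining assumptions, monotonicity and unboundedness of the diagonal exponent, give the lower
  bound over sets of indices and the convergence.\<close>

locale hodge_matrix =
  fixes P :: "nat \<Rightarrow> nat \<Rightarrow> 'p::prime_card iwasawa" and r s :: "nat \<Rightarrow> nat"
  assumes P: "P i j \<in> mI (r i - s j)"
    and s_le_r: "s i \<le> r i"
    and mono: "mono (\<lambda>i. r i - s i)"
    and unbounded: "\<exists>i. n \<le> r i - s i"
begin

definition g :: "nat \<Rightarrow> nat" where "g i = r i - s i"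

text \<open>A permutation of S only rearranges the column losses, so every term of the minor has at
  least the total exponent of the diagonal.\<close>

lemma perm_minor_mI:
  assumes "finite S" shows "perm_minor P S \<in> mI (sum g S)"
  unfolding perm_minor_def
proof (intro ideal_pow_sum ideal_pow_mult_left)
  fix \<sigma> assume "\<sigma> \<in> {\<sigma>. \<sigma> permutes S}"
  then have \<sigma>: "\<sigma> permutes S" by simp
  have "sum r S = sum g S + sum s S"
    unfolding sum.distrib[symmetric] g_def using s_le_r by simp
  moreover have "sum s S = (\<Sum>i\<in>S. s (\<sigma> i))" using sum.permute[OF \<sigma>, of s] by (simp add: o_def)
  \<comment> \<open>Subtraction is truncated at 0 off the diagonal; the resulting inequality goes in
    the required direction.\<close>
  moreover have "sum r S \<le> (\<Sum>i\<in>S. (r i - s (\<sigma> i)) + s (\<sigma> i))" by (intro sum_mono) simp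
  ultimately have "sum g S \<le> (\<Sum>i\<in>S. r i - s (\<sigma> i))" by (simp add: sum.distrib)
  then show "(\<Prod>i\<in>S. P i (\<sigma> i)) \<in> mI (sum g S)"
    using ideal_pow_prod[of S "\<lambda>i. P i (\<sigma> i)" _ _ "\<lambda>i. r i - s (\<sigma> i)"] P by (blast intro: mI_le)
qed

lemma char_trunc_mI: "fps_nth (char_trunc P N) k \<in> mI (\<Sum>i<k. g i)"
  unfolding char_trunc_nth
proof (rule ideal_pow_sum)
  fix S assume "S \<in> Pow {0..<N}"
  then have S: "finite S" by (auto intro: finite_subset)
  then have "perm_minor P S \<in> mI (\<Sum>i<card S. g i)"
    using perm_minor_mI[OF S] sum_mono_ge_lessThan[OF mono S] unfolding g_def[symmetric] by (blast intro: mI_le)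
  then show "(if k = card S then (- 1) ^ card S * perm_minor P S else 0) \<in> mI (\<Sum>i<k. g i)"
    by (simp add: ideal_pow_mult_left)
qed

text \<open>Passing from N to M adds only minors whose index set contains some i >= N, and that
  index alone contributes g i >= g N. The bound does not depend on k, as convergence in
  \<Lambda>[[X]] requires.\<close>

lemma char_trunc_Cauchy:
  assumes "N \<le> M" shows "fps_nth (char_trunc P M) k - fps_nth (char_trunc P N) k \<in> mI (g N)"
proof -
  let ?f = "\<lambda>S. if k = card S then (- 1) ^ card S * perm_minor P S else 0"
  have "fps_nth (char_trunc P M) k - fps_nth (char_trunc P N) k = sum ?f (Pow {0..<M} - Pow {0..<N})"
    unfolding char_trunc_nth using assms by (subst sum_diff) auto
  also have "\<dots> \<in> mI (g N)"
  proof (rule ideal_pow_sum)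
    fix S assume S: "S \<in> Pow {0..<M} - Pow {0..<N}"
    then have fin: "finite S" by (auto intro: finite_subset)
    obtain i where i: "i \<in> S" "N \<le> i" using S by force
    have "g N \<le> g i" using mono i(2) unfolding g_def by (rule monoD)
    also have "\<dots> \<le> sum g S" using i(1) fin by (intro member_le_sum) auto
    finally have "perm_minor P S \<in> mI (g N)" using perm_minor_mI[OF fin] mI_le by blast
    then show "?f S \<in> mI (g N)" by (simp add: ideal_pow_mult_left)
  qed
  finally show ?thesis .
qed

end

text \<open>The modulus h is kept in the conclusion, so that one modulus serves all coefficients of
  the characteristic series at once.\<close>

lemma mI_complete:
  fixes x :: "nat \<Rightarrow> 'p::prime_card iwasawa"
  assumes "\<And>n M. M \<ge> h n \<Longrightarrow> x M - x (h n) \<in> mI n"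
  shows "\<exists>L. \<forall>n. \<forall>M\<ge>h n. x M - L \<in> mI n"
proof -
  \<comment> \<open>H n and H (n + 1) both exceed h n, so the n-th increment along H lies in the
    n-th ideal power and the increments can be summed.\<close>
  define H where "H n = (\<Sum>i\<le>n. h i)" for n :: nat
  have "h n \<le> H m" if "n \<le> m" for n m unfolding H_def using that by (intro member_le_sum) auto
  then have H: "h n \<le> H n" "h n \<le> H (Suc n)" for n by auto
  define d where "d n = x (H (Suc n)) - x (H n)" for n
  have d: "d n \<in> mI (0 + n)" for n
    using ideal_pow_diff[OF assms[OF H(2)] assms[OF H(1)], of n] by (simp add: d_def)
  obtain y where "wsums d y" using wsums_exists[of d] d by auto
  then have y: "y - (\<Sum>i<n. d i) \<in> mI (0 + n)" for n by (rule ideal_series[OF d])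
  have d_sum: "(\<Sum>i<n. d i) = x (H n) - x (H 0)" for n unfolding d_def by (rule sum_lessThan_telescope)
  have "x M - (y + x (H 0)) \<in> mI n" if "M \<ge> h n" for n M
  proof -
    have "x M - (y + x (H 0)) = (x M - x (h n)) - (x (H n) - x (h n)) - (y - (\<Sum>i<n. d i))"
      by (simp add: d_sum)
    also have "\<dots> \<in> mI n"
      using ideal_pow_diff[OF ideal_pow_diff[OF assms[OF that] assms[OF H(1)]] y[of n, simplified]] .
    finally show ?thesis .
  qed
  then show ?thesis by blast
qed

lemma iw_fps_limit_iff:
  "iw_fps_limit F C \<longleftrightarrow>
    (\<forall>k. eventually (\<lambda>N. \<forall>n. fps_nth (F N) n - fps_nth C n \<in> (mI k :: 'p::prime_card iwasawa set)) sequentially)"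
  by (simp add: iw_fps_limit_def fps_ideal_pow_iff)

lemma iw_fps_limit_unique:
  assumes "iw_fps_limit F C" "iw_fps_limit F (C' :: 'p::prime_card iwasawa fps)" shows "C = C'"
proof (rule fps_ext)
  fix n
  have "fps_nth C n - fps_nth C' n \<in> mI k" for k
  proof -
    have "eventually (\<lambda>N. (\<forall>n. fps_nth (F N) n - fps_nth C n \<in> mI k)
        \<and> (\<forall>n. fps_nth (F N) n - fps_nth C' n \<in> mI k)) sequentially"
      using assms unfolding iw_fps_limit_iff by (intro eventually_conj) auto
    then obtain N where "fps_nth (F N) n - fps_nth C n \<in> mI k" "fps_nth (F N) n - fps_nth C' n \<in> mI k"
      unfolding eventually_sequentially by blast
    then have "(fps_nth (F N) n - fps_nth C' n) - (fps_nth (F N) n - fps_nth C n) \<in> mI k"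
      using ideal_pow_diff by blast
    then show ?thesis by simp
  qed
  then show "fps_nth C n = fps_nth C' n" using ideal_all_eq_0 by (metis eq_iff_diff_eq_0)
qed

context hodge_matrix
begin

lemma char_series_limit: "iw_fps_limit (char_trunc P) (char_series P)"
  and ex1_char_series: "\<exists>!C. iw_fps_limit (char_trunc P) C"
proof -
  have "\<forall>n. \<exists>i. n \<le> g i" using unbounded unfolding g_def by blast
  then obtain h where h: "\<And>n. n \<le> g (h n)" by metis
  have "\<exists>L. \<forall>n. \<forall>M\<ge>h n. fps_nth (char_trunc P M) k - L \<in> mI n" for k
    by (rule mI_complete) (rule mI_le[OF char_trunc_Cauchy h])
  then obtain L where L: "\<And>k n M. M \<ge> h n \<Longrightarrow> fps_nth (char_trunc P M) k - L k \<in> mI n" by metis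
  have "iw_fps_limit (char_trunc P) (Abs_fps L)"
    unfolding iw_fps_limit_iff eventually_sequentially using L by auto
  then show "\<exists>!C. iw_fps_limit (char_trunc P) C" using iw_fps_limit_unique by blast
  then show "iw_fps_limit (char_trunc P) (char_series P)" unfolding char_series_def by (rule theI')
qed

text \<open>A single truncation congruent to the limit modulo this ideal suffices, because the bound
  holds for every truncation.\<close>

lemma char_series_mI: "fps_nth (char_series P) k \<in> mI (\<Sum>i<k. g i)"
proof -
  obtain N where "fps_nth (char_trunc P N) k - fps_nth (char_series P) k \<in> mI (\<Sum>i<k. g i)"
    using char_series_limit unfolding iw_fps_limit_iff eventually_sequentially by blast
  then have "fps_nth (char_trunc P N) k - (fps_nth (char_trunc P N) k - fps_nth (char_series P) k) \<in> mI (\<Sum>i<k. g i)"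
    by (rule ideal_pow_diff[OF char_trunc_mI])
  then show ?thesis by simp
qed

end

section \<open>From powers of (p, T) to powers of T\<close>

lemma iw_annulus_of_add: "iw_annulus_of (x + y) = iw_annulus_of x + iw_annulus_of y"
  by transfer simp

lemma iw_annulus_of_mult: "iw_annulus_of (x * y) = iw_annulus_of x * iw_annulus_of y"
  by transfer simp

lemma iw_annulus_of_p:
  "iw_annulus_of (of_nat (CARD('p))) = iw_annulus_of iw_T * abs_iw_annulus (fps_X :: 'p::prime_card iwasawa fps)"
proof -
  have "annulus_rel dvd (fps_const iw_T * fps_X - of_nat (CARD('p)) :: 'p iwasawa fps)"
    unfolding annulus_rel_def by (rule dvd_refl)
  then have "annulus_rel dvd fps_const (of_nat (CARD('p))) - (fps_const iw_T * fps_X :: 'p iwasawa fps)"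
    unfolding fps_of_nat by (metis dvd_minus_iff minus_diff_eq)
  then show ?thesis
    by (simp add: iw_annulus_of.abs_eq times_iw_annulus.abs_eq iw_annulus.abs_eq_iff)
qed

lemma iw_annulus_of_mI:
  assumes "x \<in> (mI k :: 'p::prime_card iwasawa set)"
  shows "\<exists>y. iw_annulus_of x = iw_annulus_of iw_T ^ k * y"
  using assms
proof (induction k arbitrary: x)
  case 0
  show ?case by (rule exI[of _ "iw_annulus_of x"]) simp
next
  case (Suc k)
  obtain u v where x: "x = of_nat (CARD('p)) * u + iw_T * v" "u \<in> mI k" "v \<in> mI k"
    using Suc.prems by (rule ideal_pow_SucE)
  obtain y z where "iw_annulus_of u = iw_annulus_of iw_T ^ k * y" "iw_annulus_of v = iw_annulus_of iw_T ^ k * z"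
    using Suc.IH x by blast
  then have "iw_annulus_of x = iw_annulus_of iw_T ^ Suc k * (abs_iw_annulus fps_X * y + z)"
    unfolding x(1) iw_annulus_of_add iw_annulus_of_mult iw_annulus_of_p by (simp add: algebra_simps)
  then show ?case by blast
qed

section \<open>The quaternion algebra\<close>

text \<open>Covers Q_p and the adeles away from p at once. Only nonzero integers are assumed
  invertible, so each identity for \<open>rat_in\<close> is checked after multiplication by a common
  denominator.\<close>

context
  assumes int_units: "\<And>n::int. n \<noteq> 0 \<Longrightarrow> (of_int n :: 'r::comm_ring_1) dvd 1"
begin

lemma of_int_cancel:
  fixes x y :: 'r assumes "n \<noteq> 0" "of_int n * x = of_int n * y" shows "x = y"
proof -
  obtain v where v: "1 = (of_int n :: 'r) * v" using int_units[OF assms(1)] by (rule dvdE)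
  have "of_int n * z * v = z" for z :: 'r
  proof -
    have "of_int n * z * v = (of_int n * v) * z" by (simp add: ac_simps)
    then show ?thesis by (simp flip: v)
  qed
  then show ?thesis using assms(2) by metis
qed

text \<open>\<open>rat_in\<close> is defined through the reduced fraction; this characterizes its
  value by any fraction m / n representing the rational number.\<close>

lemma rat_in_spec:
  assumes "n \<noteq> 0" "r * of_int n = of_int m" shows "(of_int n :: 'r) * rat_in r = of_int m"
proof -
  obtain m' n' where q: "quotient_of r = (m', n')" by fastforce
  have n': "n' > 0" using quotient_of_denom_pos[OF q] .
  obtain v where v: "1 = (of_int n' :: 'r) * v" using int_units[of n'] n' by (auto elim: dvdE)
  have "(THE y. of_int n' * y = (1 :: 'r)) = v"
    using v of_int_cancel[of n'] n' by (intro the_equality) auto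
  then have rin: "rat_in r = (of_int m' * v :: 'r)" unfolding rat_in_def q by simp
  have m': "of_int m' = r * of_int n'" using quotient_of_div[OF q] n' by simp
  have "of_int (m' * n) = (of_int (m * n') :: rat)"
    by (simp add: m' assms(2)[symmetric] ac_simps)
  then have mn: "m' * n = m * n'" by (simp only: of_int_eq_iff)
  have "of_int n' * (of_int n * rat_in r) = (of_int (m' * n) * (of_int n' * v) :: 'r)"
    unfolding rin by (simp add: ac_simps)
  also have "\<dots> = of_int n' * of_int m" unfolding mn v[symmetric] by (simp add: mult.commute)
  finally show ?thesis by (rule of_int_cancel[rotated]) (use n' in simp)
qed

lemma rat_in_eqI:
  assumes "n \<noteq> 0" "r * of_int n = of_int m" "(of_int n :: 'r) * y = of_int m" shows "rat_in r = y"
  using rat_in_spec[OF assms(1,2)] assms(3) of_int_cancel[OF assms(1)] by simp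

lemma rat_fraction: "\<exists>m n. n \<noteq> 0 \<and> r * of_int n = (of_int m :: rat)"
proof -
  obtain m n where q: "quotient_of r = (m, n)" by fastforce
  then show ?thesis using quotient_of_div[OF q] quotient_of_denom_pos[OF q] by (intro exI[of _ m] exI[of _ n]) simp
qed

lemma rat_in_1: "rat_in 1 = (1 :: 'r)"
  by (rule rat_in_eqI[of 1 _ 1]) auto

lemma rat_in_0: "rat_in 0 = (0 :: 'r)"
  by (rule rat_in_eqI[of 1 _ 0]) auto

lemma rat_in_mult: "rat_in (x * y) = (rat_in x * rat_in y :: 'r)"
proof -
  obtain a b c d where *: "b \<noteq> 0" "x * of_int b = of_int a" "d \<noteq> 0" "y * of_int d = of_int c"
    using rat_fraction by metis
  show ?thesis
  proof (rule rat_in_eqI)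
    show "b * d \<noteq> 0" using * by simp
    have "x * y * of_int (b * d) = (x * of_int b) * (y * of_int d)" by (simp add: ac_simps)
    then show "x * y * of_int (b * d) = of_int (a * c)" by (simp add: *)
    have "of_int (b * d) * (rat_in x * rat_in y) = (of_int b * rat_in x) * (of_int d * rat_in y :: 'r)"
      by (simp add: ac_simps)
    then show "of_int (b * d) * (rat_in x * rat_in y) = (of_int (a * c) :: 'r)"
      by (simp add: rat_in_spec[OF *(1,2)] rat_in_spec[OF *(3,4)])
  qed
qed

lemma rat_in_add: "rat_in (x + y) = (rat_in x + rat_in y :: 'r)"
proof -
  obtain a b c d where *: "b \<noteq> 0" "x * of_int b = of_int a" "d \<noteq> 0" "y * of_int d = of_int c"
    using rat_fraction by metis
  show ?thesis
  proof (rule rat_in_eqI)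
    show "b * d \<noteq> 0" using * by simp
    have "(x + y) * of_int (b * d) = (x * of_int b) * of_int d + (y * of_int d) * of_int b"
      by (simp add: algebra_simps)
    then show "(x + y) * of_int (b * d) = of_int (a * d + c * b)" by (simp add: *)
    have "of_int (b * d) * (rat_in x + rat_in y)
        = (of_int b * rat_in x) * of_int d + (of_int d * rat_in y) * (of_int b :: 'r)"
      by (simp add: algebra_simps)
    then show "of_int (b * d) * (rat_in x + rat_in y) = (of_int (a * d + c * b) :: 'r)"
      by (simp add: rat_in_spec[OF *(1,2)] rat_in_spec[OF *(3,4)])
  qed
qed

lemma rat_in_diff: "rat_in (x - y) = (rat_in x - rat_in y :: 'r)"
proof -
  have "rat_in x = (rat_in (x - y) + rat_in y :: 'r)" using rat_in_add[of "x - y" y] by simp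
  then show ?thesis by simp
qed

lemma quat_map_rat_in_mult:
  "quat_map rat_in (quat_mult \<alpha> \<beta> x y) =
    quat_mult (rat_in \<alpha>) (rat_in \<beta>) (quat_map rat_in x) (quat_map (rat_in :: rat \<Rightarrow> 'r) y)"
  by (cases x; cases y) (simp add: quat_map_def rat_in_mult rat_in_add rat_in_diff)

lemma quat_map_rat_in_1: "quat_map rat_in (quat_of 1) = (quat_of 1 :: 'r quat)"
  by (simp add: quat_map_def quat_of_def rat_in_0 rat_in_1)

end

lemma of_nat_padic_nonzero: "k > 0 \<Longrightarrow> (of_nat k :: 'p::prime_card padic) \<noteq> 0"
  by (simp add: of_nat_fract eq_fract Zero_fract_def)

lemma int_units_padic:
  fixes n :: int assumes "n \<noteq> 0" shows "(of_int n :: 'p::prime_card padic) dvd 1"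
proof -
  have "(of_nat (nat \<bar>n\<bar>) :: 'p padic) \<noteq> 0" by (rule of_nat_padic_nonzero) (use assms in simp)
  then have "(of_int n :: 'p padic) \<noteq> 0" by (cases "n \<ge> 0") (auto simp: of_nat_nat)
  then show ?thesis by (simp add: dvd_field_iff)
qed

lemma away_of_zhat_of_nat: "away_of_zhat (of_nat k) = (of_nat k :: 'p::prime_card away_adele)"
proof (induction k)
  case 0
  have "away_of_zhat 0 = (0 :: 'p away_adele)" by transfer (rule away_rel_refl, simp)
  then show ?case by simp
next
  case (Suc k)
  have "away_of_zhat (1 + of_nat k) = (1 + away_of_zhat (of_nat k) :: 'p away_adele)"
    by transfer (rule away_relI[of _ _ 1], auto)
  then show ?case by (simp add: Suc)
qed

lift_definition away_inverse :: "nat \<Rightarrow> 'p::prime_card away_adele" is "\<lambda>k. (1, int (Suc k))"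
  by (rule away_rel_refl) simp

lemma away_inverse: "of_nat (Suc k) * away_inverse k = (1 :: 'p::prime_card away_adele)"
proof -
  have "away_of_zhat (of_nat (Suc k)) * away_inverse k = (1 :: 'p away_adele)"
    by transfer (rule away_relI[of _ _ 1], auto)
  then show ?thesis unfolding away_of_zhat_of_nat .
qed

lemma int_units_away:
  fixes n :: int assumes "n \<noteq> 0" shows "(of_int n :: 'p::prime_card away_adele) dvd 1"
proof -
  obtain k where k: "nat \<bar>n\<bar> = Suc k" using assms by (cases "nat \<bar>n\<bar>") auto
  have "(of_nat (nat \<bar>n\<bar>) :: 'p away_adele) dvd 1" unfolding k using away_inverse by (metis dvd_triv_left)
  then show ?thesis by (cases "n \<ge> 0") (auto simp: of_nat_nat)
qed

section \<open>Two by two matrices\<close>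

lemma mat2_index [simp]:
  "mat2 a b c d $$ (0, 0) = a" "mat2 a b c d $$ (0, Suc 0) = b"
  "mat2 a b c d $$ (Suc 0, 0) = c" "mat2 a b c d $$ (Suc 0, Suc 0) = d"
  "dim_row (mat2 a b c d) = 2" "dim_col (mat2 a b c d) = 2"
  by (simp_all add: mat2_def mat_of_rows_list_def)

lemma mat2_eqI:
  assumes "A \<in> carrier_mat 2 2" "A $$ (0, 0) = a" "A $$ (0, Suc 0) = b" "A $$ (Suc 0, 0) = c" "A $$ (Suc 0, Suc 0) = d"
  shows "A = mat2 a b c d"
proof (rule eq_matI)
  fix i j assume "i < dim_row (mat2 a b c d)" "j < dim_col (mat2 a b c d)"
  then have "i = 0 \<or> i = Suc 0" "j = 0 \<or> j = Suc 0" by auto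
  then show "A $$ (i, j) = mat2 a b c d $$ (i, j)" using assms by auto
qed (use assms in auto)

lemma mat2_carrier [simp]: "mat2 a b c d \<in> carrier_mat 2 2"
  by (simp add: carrier_matI)

lemma mat2_inject: "mat2 a b c d = mat2 a' b' c' d' \<longleftrightarrow> a = a' \<and> b = b' \<and> c = c' \<and> d = d'"
  by (metis mat2_index(1-4))

lemma mat2_mult: "mat2 a b c d * mat2 a' b' c' d'
    = mat2 (a * a' + b * c') (a * b' + b * d') (c * a' + d * c') (c * b' + d * d')"
  by (rule mat2_eqI) (auto simp: scalar_prod_def times_mat_def carrier_matI numeral_2_eq_2 sum.atLeast0_lessThan_Suc)

lemma mat2_one: "1\<^sub>m 2 = mat2 1 0 0 1"
  by (rule mat2_eqI) auto

lemma map_mat2: "map_mat f (mat2 a b c d) = mat2 (f a) (f b) (f c) (f d)"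
  by (rule mat2_eqI) auto

lemma of_lev_dvd_p: "of_nat (lev TYPE('p)) dvd c \<Longrightarrow> of_nat (CARD('p)) dvd (c :: 'p::prime_card padic_int)"
  using lev_dvd dvd_trans by blast

text \<open>Contains the Iwahori matrices and the v_j, and makes c z + d a unit for all z, so that
  the weight action is defined and continuous on it.\<close>

definition M1 :: "'p::prime_card padic_int mat set" where
  "M1 = {mat2 a b c d | a b c d. of_nat (lev TYPE('p)) dvd c \<and> d dvd 1}"

lemma iwahori_subset_M1: "iwahori \<subseteq> M1"
  unfolding iwahori_def M1_def by blast

lemma Up_rep_M1: "Up_rep j \<in> M1"
  unfolding Up_rep_def M1_def by (intro CollectI exI conjI, rule refl) auto

lemma unit_mult: "(x::'a::comm_ring_1) dvd 1 \<Longrightarrow> y dvd 1 \<Longrightarrow> x * y dvd 1"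
  using mult_dvd_mono[of x 1 y 1] by simp

lemma iwahori_mult: "u \<in> iwahori \<Longrightarrow> v \<in> iwahori \<Longrightarrow> u * v \<in> (iwahori :: 'p::prime_card padic_int mat set)"
proof -
  assume "u \<in> iwahori" "v \<in> iwahori"
  then obtain a b c d a' b' c' d' where u: "u = mat2 a b c d" "a dvd 1" "of_nat (lev TYPE('p)) dvd c" "d dvd 1"
    and v: "v = mat2 a' b' c' d'" "a' dvd 1" "of_nat (lev TYPE('p)) dvd c'" "d' dvd 1"
    unfolding iwahori_def by blast
  have "a * a' + b * c' dvd 1"
    by (rule unit_add_p[OF unit_mult[OF u(2) v(2)]]) (use of_lev_dvd_p[OF v(3)] in simp)
  moreover have "c * b' + d * d' dvd 1"
    by (rule unit_add_p[OF unit_mult[OF u(4) v(4)]]) (use of_lev_dvd_p[OF u(3)] in simp)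
  moreover have "of_nat (lev TYPE('p)) dvd c * a' + d * c'" using u(3) v(3) by simp
  ultimately show ?thesis unfolding u(1) v(1) mat2_mult iwahori_def by blast
qed

lemma iwahori_1: "1\<^sub>m 2 \<in> iwahori"
  unfolding mat2_one iwahori_def by (intro CollectI exI conjI, rule refl) auto

text \<open>The determinant is a d modulo p, hence a unit, and the adjugate matrix keeps the Iwahori
  shape.\<close>

lemma iwahori_inverse:
  assumes "u \<in> (iwahori :: 'p::prime_card padic_int mat set)"
  shows "\<exists>v\<in>iwahori. u * v = 1\<^sub>m 2 \<and> v * u = 1\<^sub>m 2"
proof -
  obtain a b c d where u: "u = mat2 a b c d" "a dvd 1" "of_nat (lev TYPE('p)) dvd c" "d dvd 1"
    using assms unfolding iwahori_def by blast
  have "a * d - b * c dvd 1"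
    by (rule unit_add_p[OF unit_mult[OF u(2) u(4)]]) (use of_lev_dvd_p[OF u(3)] in simp)
  then obtain e where e: "1 = (a * d - b * c) * e" by (rule dvdE)
  then have e1: "a * (d * e) - b * (c * e) = 1" by (simp add: algebra_simps)
  have "e dvd 1" using e by (metis dvd_triv_right)
  have "u * mat2 (d * e) (- b * e) (- c * e) (a * e) = 1\<^sub>m 2" "mat2 (d * e) (- b * e) (- c * e) (a * e) * u = 1\<^sub>m 2"
    unfolding u(1) mat2_mult mat2_one mat2_inject using e1 by (simp_all add: algebra_simps)
  moreover have "mat2 (d * e) (- b * e) (- c * e) (a * e) \<in> iwahori"
    unfolding iwahori_def using u \<open>e dvd 1\<close> by (auto intro!: exI unit_mult)
  ultimately show ?thesis by blast
qed

lemma M1_carrier: "u \<in> M1 \<Longrightarrow> u \<in> carrier_mat 2 2"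
  unfolding M1_def by auto

section \<open>The weight action\<close>

lemma M1_denom_unit:
  assumes "of_nat (lev TYPE('p)) dvd c" "d dvd 1" shows "c * z + d dvd (1 :: 'p::prime_card padic_int)"
  by (rule unit_add_p[OF assms(2)]) (use of_lev_dvd_p[OF assms(1)] in simp)

lemma slash_mat2: "slash h (mat2 a b c d) z = univ_char (c * z + d) * h ((a * z + b) div (c * z + d))"
  by (simp add: slash_def Let_def)

lemma unit_div_mult: "y dvd 1 \<Longrightarrow> x div y * y = (x :: 'p::prime_card padic_int)"
  by (rule div_mult_padic) (auto intro: dvd_trans)

text \<open>The automorphy factor is a cocycle: that of g g' at z is that of g' at z times that of g
  at g'(z). The character [-] turns this product into a product in \<Lambda>.\<close>

lemma slash_slash:
  assumes "g \<in> M1" "g' \<in> (M1 :: 'p::prime_card padic_int mat set)"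
  shows "slash (slash h g) g' = slash h (g * g')"
proof
  fix z
  obtain a b c d where g: "g = mat2 a b c d" "of_nat (lev TYPE('p)) dvd c" "d dvd 1"
    using assms(1) unfolding M1_def by blast
  obtain a' b' c' d' where g': "g' = mat2 a' b' c' d'" "of_nat (lev TYPE('p)) dvd c'" "d' dvd 1"
    using assms(2) unfolding M1_def by blast
  define w' where "w' = c' * z + d'"
  have w': "w' dvd 1" unfolding w'_def by (rule M1_denom_unit[OF g'(2,3)])
  define z' where "z' = (a' * z + b') div w'"
  have z': "z' * w' = a' * z + b'" unfolding z'_def by (rule unit_div_mult[OF w'])
  have w: "c * z' + d dvd 1" by (rule M1_denom_unit[OF g(2,3)])
  have "(c * z' + d) * w' = c * (z' * w') + d * w'" by (simp add: algebra_simps)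
  then have C: "(c * a' + d * c') * z + (c * b' + d * d') = w' * (c * z' + d)"
    unfolding z' by (simp add: w'_def algebra_simps)
  have "(a * z' + b) * w' = a * (z' * w') + b * w'" by (simp add: algebra_simps)
  then have A: "(a * a' + b * c') * z + (a * b' + b * d') = (a * z' + b) * w'"
    unfolding z' by (simp add: w'_def algebra_simps)
  define t where "t = (a * z' + b) div (c * z' + d)"
  have "t * (c * z' + d) = a * z' + b" unfolding t_def by (rule unit_div_mult[OF w])
  then have eq: "(a * z' + b) * w' = t * (w' * (c * z' + d))" by (metis mult.assoc mult.commute)
  have "w' * (c * z' + d) \<noteq> 0" using unit_mult[OF w' w] by auto
  \<comment> \<open>The common factor w' of numerator and denominator cancels, which leaves g
    applied to g'(z).\<close>
  then have t: "(a * z' + b) * w' div (w' * (c * z' + d)) = t"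
    unfolding eq by (rule nonzero_mult_div_cancel_right)
  show "slash (slash h g) g' z = slash h (g * g') z"
    unfolding g(1) g'(1) mat2_mult slash_mat2 C A t
    unfolding w'_def[symmetric] z'_def[symmetric] t_def[symmetric] univ_char_mult[OF w' w]
    by (simp add: mult.assoc)
qed

lemma slash_1: "slash (h :: 'p::prime_card padic_int \<Rightarrow> 'p iwasawa) (1\<^sub>m 2) = h"
proof
  fix z :: "'p padic_int"
  have "z div 1 = z" using nonzero_mult_div_cancel_right[of 1 z] by simp
  then show "slash h (1\<^sub>m 2) z = h z" unfolding mat2_one slash_mat2 by simp
qed

lemma univ_char_diff:
  assumes "(x :: 'p::prime_card padic_int) dvd 1" "y dvd 1" "of_nat (CARD('p)) ^ (lev_exp TYPE('p) + N) dvd y - x"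
  shows "univ_char y - univ_char x \<in> mI N"
proof -
  obtain v where v: "1 = x * v" using assms(1) by (rule dvdE)
  have vu: "v dvd 1" using v by (metis dvd_triv_right)
  have "of_nat (CARD('p)) ^ (lev_exp TYPE('p) + N) dvd v * (y - x)" using assms(3) by (rule dvd_mult)
  also have "v * (y - x) = v * y - 1" using v by (simp add: algebra_simps)
  finally have "univ_char (v * y) - 1 \<in> mI (Suc N)" by (rule univ_char_close)
  then have "univ_char (v * y) - 1 \<in> mI N" by (rule mI_le) simp
  then have "univ_char x * (univ_char (v * y) - 1) \<in> mI N" by (rule ideal_pow_mult_left)
  moreover have "x * (v * y) = y" using v by (metis mult.assoc mult_1)
  then have "univ_char x * univ_char (v * y) = univ_char y"
    using univ_char_mult[OF assms(1) unit_mult[OF vu assms(2)]] by metis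
  ultimately show ?thesis by (simp add: algebra_simps)
qed

lemma continuous_slash:
  assumes "continuous_on UNIV h" "g \<in> (M1 :: 'p::prime_card padic_int mat set)"
  shows "continuous_on UNIV (slash h g)"
  unfolding continuous_padic_iwasawa_iff
proof (intro allI)
  fix z :: "'p padic_int" and N
  let ?p = "of_nat (CARD('p)) :: 'p padic_int"
  obtain a b c d where g: "g = mat2 a b c d" "of_nat (lev TYPE('p)) dvd c" "d dvd 1"
    using assms(2) unfolding M1_def by blast
  define w where "w z = c * z + d" for z
  have w: "w z dvd 1" for z unfolding w_def by (rule M1_denom_unit[OF g(2,3)])
  define f where "f z = (a * z + b) div w z" for z
  have f: "f z * w z = a * z + b" for z unfolding f_def by (rule unit_div_mult[OF w])
  obtain M where M: "\<And>y. ?p ^ M dvd y - f z \<Longrightarrow> h y - h (f z) \<in> mI N"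
    using assms(1) unfolding continuous_padic_iwasawa_iff by blast
  have "slash h g z' - slash h g z \<in> mI N" if z': "?p ^ (M + (lev_exp TYPE('p) + N)) dvd z' - z" for z'
  proof -
    have z1: "?p ^ M dvd z' - z" and z2: "?p ^ (lev_exp TYPE('p) + N) dvd z' - z"
      using z' by (auto simp: power_add dest: dvd_mult_left dvd_mult_right)
    \<comment> \<open>Clearing denominators exhibits f z' - f z as a multiple of z' - z up to the
      unit w z', so a Moebius map from \<open>M1\<close> does not increase p-adic distances.\<close>
    have "w z' * (f z' - f z) = f z' * w z' - f z * w z - f z * (w z' - w z)" by (simp add: algebra_simps)
    also have "\<dots> = (z' - z) * (a - f z * c)" unfolding f by (simp add: w_def algebra_simps)
    finally have "?p ^ M dvd w z' * (f z' - f z)" using z1 by simp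
    then have "?p ^ M dvd f z' - f z" using unit_cancel_dvd[OF w] by blast
    then have H: "h (f z') - h (f z) \<in> mI N" by (rule M)
    have "w z' - w z = c * (z' - z)" by (simp add: w_def algebra_simps)
    then have U: "univ_char (w z') - univ_char (w z) \<in> mI N"
      using z2 by (intro univ_char_diff w) simp
    have "slash h g z' - slash h g z
        = (univ_char (w z') - univ_char (w z)) * h (f z') + univ_char (w z) * (h (f z') - h (f z))"
      unfolding g(1) slash_mat2 w_def f_def by (simp add: algebra_simps)
    also have "\<dots> \<in> mI N" by (intro ideal_pow_add ideal_pow_mult_left[OF H] ideal_pow_mult_right[OF U])
    finally show ?thesis .
  qed
  then show "\<exists>M. \<forall>z'. ?p ^ M dvd z' - z \<longrightarrow> slash h g z' - slash h g z \<in> mI N" by blast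
qed

lemma continuous_padic_sum:
  fixes f :: "'i \<Rightarrow> 'p::prime_card padic_int \<Rightarrow> 'p iwasawa"
  assumes "\<And>i. i \<in> A \<Longrightarrow> continuous_on UNIV (f i)"
  shows "continuous_on UNIV (\<lambda>z. \<Sum>i\<in>A. f i z)"
  using assms
proof (induction A rule: infinite_finite_induct)
  case (insert i A)
  let ?p = "of_nat (CARD('p)) :: 'p padic_int"
  have 1: "continuous_on UNIV (f i)" and 2: "continuous_on UNIV (\<lambda>z. \<Sum>i\<in>A. f i z)" using insert by auto
  show ?case unfolding continuous_padic_iwasawa_iff
  proof (intro allI)
    fix z N
    obtain M1 where M1: "\<And>z'. ?p ^ M1 dvd z' - z \<Longrightarrow> f i z' - f i z \<in> mI N"
      using 1 unfolding continuous_padic_iwasawa_iff by blast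
    obtain M2 where M2: "\<And>z'. ?p ^ M2 dvd z' - z \<Longrightarrow> (\<Sum>i\<in>A. f i z') - (\<Sum>i\<in>A. f i z) \<in> mI N"
      using 2 unfolding continuous_padic_iwasawa_iff by blast
    have "(\<Sum>i\<in>insert i A. f i z') - (\<Sum>i\<in>insert i A. f i z) \<in> mI N" if "?p ^ (M1 + M2) dvd z' - z" for z'
    proof -
      have "?p ^ M1 dvd z' - z" "?p ^ M2 dvd z' - z"
        using that by (auto simp: power_add dest: dvd_mult_left dvd_mult_right)
      then have "(f i z' - f i z) + ((\<Sum>i\<in>A. f i z') - (\<Sum>i\<in>A. f i z)) \<in> mI N"
        using M1 M2 ideal_pow_add by blast
      then show ?thesis using insert.hyps by (simp add: algebra_simps)
    qed
    then show "\<exists>M. \<forall>z'. ?p ^ M dvd z' - z \<longrightarrow> (\<Sum>i\<in>insert i A. f i z') - (\<Sum>i\<in>insert i A. f i z) \<in> mI N"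
      by blast
  qed
qed auto

lemma continuous_basis_value: "continuous_on UNIV (basis_value t n j :: 'p::prime_card padic_int \<Rightarrow> 'p iwasawa)"
proof (cases "j = n mod t")
  case True
  have eq: "basis_value t n j = (\<lambda>z :: 'p padic_int. iw_const (padic_binom z (n div t)))"
    using True by (simp add: basis_value_def fun_eq_iff)
  show ?thesis unfolding continuous_padic_iwasawa_iff eq
  proof (intro allI)
    fix z :: "'p padic_int" and N
    obtain M where "\<And>z'. of_nat (CARD('p)) ^ M dvd z' - z \<Longrightarrow>
        of_nat (CARD('p)) ^ N dvd padic_binom z' (n div t) - padic_binom z (n div t)"
      using padic_binom_cong[of N "n div t", where 'p='p] by blast
    then show "\<exists>M. \<forall>z'. of_nat (CARD('p)) ^ M dvd z' - z \<longrightarrow>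
        iw_const (padic_binom z' (n div t)) - iw_const (padic_binom z (n div t)) \<in> mI N"
      using iw_const_dvd_mI unfolding iw_const_diff[symmetric] by blast
  qed
next
  case False
  then have "basis_value t n j = (\<lambda>z :: 'p padic_int. 0)" by (simp add: basis_value_def fun_eq_iff)
  then show ?thesis by simp
qed

lemma dif_power_sum: "(dif ^^ m) (\<lambda>z. \<Sum>i\<in>A. f i z) z = (\<Sum>i\<in>A. (dif ^^ m) (f i) z)"
  by (induction m arbitrary: z) (simp_all add: dif_def sum_subtractf)

lemma dif_power_0: "(dif ^^ m) (\<lambda>z. 0 :: 'a::ab_group_add) z = 0"
  by (induction m arbitrary: z) (simp_all add: dif_def)

lemma dif_slash_basis_value:
  assumes "of_nat (CARD('p)) dvd a" "of_nat (lev TYPE('p)) dvd c" "d dvd (1 :: 'p::prime_card padic_int)"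
  shows "(dif ^^ m) (\<lambda>z. slash (basis_value t n j) (mat2 a b c d) (of_nat z)) 0 \<in> mI (m - n div t div CARD('p))"
proof (cases "j = n mod t")
  case True
  then show ?thesis using slash_binom_dif[OF assms] unfolding slash_mat2 basis_value_def by simp
next
  case False
  then show ?thesis unfolding slash_mat2 basis_value_def by (simp add: dif_power_0)
qed

section \<open>Automorphic forms\<close>

lemma quat_alg_simps [simp]:
  "carrier (quat_alg a b) = UNIV" "x \<otimes>\<^bsub>quat_alg a b\<^esub> y = quat_mult a b x y"
  "\<one>\<^bsub>quat_alg a b\<^esub> = quat_of 1"
  by (simp_all add: quat_alg_def)

lemma monoid_quat_alg: "Group.monoid (quat_alg a b)"
  using ring_quat_alg by (rule ring.is_monoid)

lemma monoid_D_fin: "Group.monoid (D_fin \<alpha> \<beta>)"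
  unfolding D_fin_def by (intro DirProd_monoid monoid_quat_alg)

lemma D_fin_simps [simp]:
  "carrier (D_fin \<alpha> \<beta>) = UNIV" "\<one>\<^bsub>D_fin \<alpha> \<beta>\<^esub> = (quat_of 1, quat_of 1)"
  by (simp_all add: D_fin_def)

lemma D_fin_mult: "x \<otimes>\<^bsub>D_fin \<alpha> \<beta>\<^esub> y = (quat_mult (rat_in \<alpha>) (rat_in \<beta>) (fst x) (fst y),
    quat_mult (rat_in \<alpha>) (rat_in \<beta>) (snd x) (snd y))"
  by (simp add: D_fin_def mult_DirProd')

lemma quat_mult_1 [simp]: "quat_mult a b (quat_of 1) x = x" "quat_mult a b x (quat_of 1) = x"
  by (cases x; simp add: quat_of_def)+

lemma (in Group.monoid) inv_unique_Units:
  "x \<in> carrier G \<Longrightarrow> y \<in> carrier G \<Longrightarrow> y \<otimes> x = \<one> \<Longrightarrow> x \<otimes> y = \<one> \<Longrightarrow> x \<in> Units G \<and> inv x = y"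
  using inv_char[of x y] unfolding Units_def by blast

text \<open>Two expressions of one element in the same double coset yield an element that is at once
  a conjugate of a quotient of the left factors and a quotient of the right factors.\<close>

lemma (in Group.monoid) conj_of_eq:
  assumes "a \<in> Units G" "b \<in> Units G" "c \<in> Units G" "l \<in> Units G" "l' \<in> Units G"
    and "a \<otimes> c \<otimes> l = b \<otimes> c \<otimes> l'"
  shows "inv c \<otimes> (inv b \<otimes> a) \<otimes> c = l' \<otimes> inv l"
proof -
  have cl: "a \<in> carrier G" "b \<in> carrier G" "c \<in> carrier G" "l \<in> carrier G" "l' \<in> carrier G"
    "inv a \<in> carrier G" "inv b \<in> carrier G" "inv c \<in> carrier G" "inv l \<in> carrier G"
    using assms by (auto intro: Units_closed)
  have "inv c \<otimes> (inv b \<otimes> a) \<otimes> c = inv c \<otimes> inv b \<otimes> (a \<otimes> c \<otimes> l) \<otimes> inv l"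
    using cl assms(4) by (simp add: m_assoc)
  also have "\<dots> = inv c \<otimes> (inv b \<otimes> b) \<otimes> c \<otimes> l' \<otimes> inv l"
    unfolding assms(6) using cl by (simp only: m_assoc m_closed)
  also have "\<dots> = l' \<otimes> inv l" using cl assms by (simp add: m_assoc)
  finally show ?thesis .
qed

section \<open>Global units, the Iwahori group and the tame level inside the adelic units\<close>

locale quat_setup =
  fixes \<alpha> \<beta> :: rat
    and \<theta> :: "'p::prime_card padic quat \<Rightarrow> 'p padic mat"
    and K :: "'p away_adele quat set"
    and t :: nat
    and \<gamma> :: "nat \<Rightarrow> 'p padic quat \<times> 'p away_adele quat"
  assumes split: "splitting \<alpha> \<beta> \<theta>"
    and K: "subgroup K (units_of (D_away \<alpha> \<beta>))"
    and neat: "neat \<alpha> \<beta> \<theta> K"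
    and \<gamma>_units: "i < t \<Longrightarrow> \<gamma> i \<in> Units (D_fin \<alpha> \<beta>)"
    and disj: "disjoint_family_on (\<lambda>i. double_coset \<alpha> \<beta> \<theta> K (\<gamma> i)) {..<t}"
    and cover: "Units (D_fin \<alpha> \<beta>) = (\<Union>i<t. double_coset \<alpha> \<beta> \<theta> K (\<gamma> i))"
begin

abbreviation M :: "('p padic quat \<times> 'p away_adele quat) monoid" where
  "M \<equiv> D_fin \<alpha> \<beta>"

abbreviation \<Gamma> :: "('p padic quat \<times> 'p away_adele quat) set" where
  "\<Gamma> \<equiv> global_units \<alpha> \<beta>"

abbreviation Lv :: "('p padic quat \<times> 'p away_adele quat) set" where
  "Lv \<equiv> level_group \<theta> K"

lemma monoid_M: "Group.monoid M"
  by (rule monoid_D_fin)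

lemma M_assoc: "x \<otimes>\<^bsub>M\<^esub> y \<otimes>\<^bsub>M\<^esub> z = x \<otimes>\<^bsub>M\<^esub> (y \<otimes>\<^bsub>M\<^esub> z)"
  using Group.monoid.m_assoc[OF monoid_M, of x y z] by simp

lemma M_one [simp]: "\<one>\<^bsub>M\<^esub> \<otimes>\<^bsub>M\<^esub> x = x" "x \<otimes>\<^bsub>M\<^esub> \<one>\<^bsub>M\<^esub> = x"
  by (simp_all add: D_fin_mult)

lemma M_inv: "y \<otimes>\<^bsub>M\<^esub> x = \<one>\<^bsub>M\<^esub> \<Longrightarrow> x \<otimes>\<^bsub>M\<^esub> y = \<one>\<^bsub>M\<^esub> \<Longrightarrow> x \<in> Units M \<and> inv\<^bsub>M\<^esub> x = y"
  using monoid.inv_unique_Units[OF monoid_M, of x y] by (simp del: D_fin_simps(2))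

lemma M_Units_mult: "x \<in> Units M \<Longrightarrow> y \<in> Units M \<Longrightarrow> x \<otimes>\<^bsub>M\<^esub> y \<in> Units M"
  by (rule Group.monoid.Units_m_closed[OF monoid_M])

lemma M_Units_inv: "x \<in> Units M \<Longrightarrow> inv\<^bsub>M\<^esub> x \<in> Units M"
  by (rule Group.monoid.Units_inv_Units[OF monoid_M])

lemma M_inv_mult:
  assumes "x \<in> Units M" "y \<in> Units M" shows "inv\<^bsub>M\<^esub> (x \<otimes>\<^bsub>M\<^esub> y) = inv\<^bsub>M\<^esub> y \<otimes>\<^bsub>M\<^esub> inv\<^bsub>M\<^esub> x"
  using group.inv_mult_group[OF Group.monoid.units_group[OF monoid_M], of x y] assms
  by (simp add: units_of_carrier units_of_mult Group.monoid.units_of_inv[OF monoid_M] M_Units_mult)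

lemma \<theta>_iso: "\<theta> \<in> ring_iso (D_p \<alpha> \<beta>) (ring_mat TYPE('p padic) 2 ())"
  using split unfolding splitting_def by blast

lemma \<theta>_bij: "bij_betw \<theta> UNIV (carrier_mat 2 2)"
  using \<theta>_iso unfolding ring_iso_def by (simp add: ring_mat_def)

lemma \<theta>_mult: "\<theta> (quat_mult (rat_in \<alpha>) (rat_in \<beta>) x y) = \<theta> x * \<theta> y"
  using \<theta>_iso unfolding ring_iso_def Ring.ring_hom_def
  by (cases x; cases y) (simp add: ring_mat_def)

lemma \<theta>_one: "\<theta> (quat_of 1) = 1\<^sub>m 2"
  using \<theta>_iso unfolding ring_iso_def Ring.ring_hom_def by (simp add: ring_mat_def)

lemma \<theta>_inj: "\<theta> x = \<theta> y \<Longrightarrow> x = y"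
  using \<theta>_bij unfolding bij_betw_def inj_def by blast

lemma \<theta>_inverse: "A \<in> carrier_mat 2 2 \<Longrightarrow> \<theta> (the_inv_into UNIV \<theta> A) = A"
  using \<theta>_bij unfolding bij_betw_def by (intro f_the_inv_into_f) auto

lemma \<theta>_at_p: "g \<in> carrier_mat 2 2 \<Longrightarrow> \<theta> (fst (at_p \<theta> g)) = map_mat to_fract g"
  by (simp add: at_p_def \<theta>_inverse)

lemma snd_at_p [simp]: "snd (at_p \<theta> g) = quat_of 1"
  by (simp add: at_p_def)

lemma at_p_mult:
  assumes "g \<in> M1" "h \<in> M1" shows "at_p \<theta> (g * h) = at_p \<theta> g \<otimes>\<^bsub>M\<^esub> at_p \<theta> h"
proof (rule prod_eqI)
  have "g * h \<in> carrier_mat 2 2" using assms[THEN M1_carrier] by (rule mult_carrier_mat)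
  then have "\<theta> (fst (at_p \<theta> (g * h))) = map_mat to_fract (g * h)" by (rule \<theta>_at_p)
  also have "\<dots> = map_mat to_fract g * map_mat to_fract h"
    using assms unfolding M1_def by (auto simp: mat2_mult map_mat2)
  also have "\<dots> = \<theta> (fst (at_p \<theta> g \<otimes>\<^bsub>M\<^esub> at_p \<theta> h))"
    using assms[THEN M1_carrier] by (simp add: D_fin_mult \<theta>_mult \<theta>_at_p)
  finally show "fst (at_p \<theta> (g * h)) = fst (at_p \<theta> g \<otimes>\<^bsub>M\<^esub> at_p \<theta> h)" by (rule \<theta>_inj)
qed (simp add: D_fin_mult)

lemma at_p_1: "at_p \<theta> (1\<^sub>m 2) = \<one>\<^bsub>M\<^esub>"
proof (rule prod_eqI)
  have "\<theta> (fst (at_p \<theta> (1\<^sub>m 2))) = map_mat to_fract (1\<^sub>m 2)" by (rule \<theta>_at_p) simp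
  also have "\<dots> = \<theta> (quat_of 1)" unfolding \<theta>_one by (simp add: mat2_one map_mat2)
  finally show "fst (at_p \<theta> (1\<^sub>m 2)) = fst \<one>\<^bsub>M\<^esub>" by (simp add: \<theta>_inj)
qed simp

lemma at_p_inject:
  assumes "g \<in> carrier_mat 2 2" "h \<in> carrier_mat 2 2" "fst (at_p \<theta> g) = fst (at_p \<theta> h)" shows "g = h"
proof -
  have eq: "map_mat to_fract g = (map_mat to_fract h :: 'p padic mat)"
    using assms \<theta>_at_p by metis
  show ?thesis
  proof (rule eq_matI)
    fix i j assume ij: "i < dim_row h" "j < dim_col h"
    then have "to_fract (g $$ (i, j)) = to_fract (h $$ (i, j))"
      using assms(1,2) arg_cong[OF eq, of "\<lambda>A. A $$ (i, j)"] by auto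
    then show "g $$ (i, j) = h $$ (i, j)" by simp
  qed (use assms in auto)
qed

lemma at_p_iwahori:
  assumes "u \<in> iwahori"
  shows "at_p \<theta> u \<in> Units M" "\<exists>v\<in>iwahori. inv\<^bsub>M\<^esub> (at_p \<theta> u) = at_p \<theta> v"
proof -
  obtain v where v: "v \<in> iwahori" "u * v = 1\<^sub>m 2" "v * u = 1\<^sub>m 2" using iwahori_inverse[OF assms] by blast
  have M1: "u \<in> M1" "v \<in> M1" using assms v iwahori_subset_M1 by auto
  have "at_p \<theta> u \<in> Units M \<and> inv\<^bsub>M\<^esub> (at_p \<theta> u) = at_p \<theta> v"
    by (rule M_inv) (simp_all only: at_p_mult[symmetric] M1 v at_p_1)
  then show "at_p \<theta> u \<in> Units M" "\<exists>v\<in>iwahori. inv\<^bsub>M\<^esub> (at_p \<theta> u) = at_p \<theta> v" using v by auto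
qed

text \<open>The inverse of v_j has denominator p and is therefore built directly as a matrix over
  Q_p, outside the range of integral matrices to which \<open>at_p\<close> applies.\<close>

lemma at_p_Up_rep: "at_p \<theta> (Up_rep j) \<in> Units M"
proof -
  let ?p = "to_fract (of_nat (CARD('p))) :: 'p padic" and ?c = "to_fract (of_nat (j * lev TYPE('p))) :: 'p padic"
  let ?W = "mat2 (1 / ?p) 0 (- ?c / ?p) 1"
  have p: "?p \<noteq> 0" by simp
  define y :: "'p padic quat \<times> 'p away_adele quat" where "y = (the_inv_into UNIV \<theta> ?W, quat_of 1)"
  have y: "\<theta> (fst y) = ?W" unfolding y_def by (simp add: \<theta>_inverse)
  have v: "\<theta> (fst (at_p \<theta> (Up_rep j))) = mat2 ?p 0 ?c 1"
    by (subst \<theta>_at_p[OF M1_carrier[OF Up_rep_M1]]) (simp add: Up_rep_def map_mat2)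
  have "mat2 ?p 0 ?c 1 * ?W = 1\<^sub>m 2" "?W * mat2 ?p 0 ?c 1 = 1\<^sub>m 2"
    unfolding mat2_mult mat2_one mat2_inject using p by simp_all
  then have 1: "\<theta> (fst (at_p \<theta> (Up_rep j) \<otimes>\<^bsub>M\<^esub> y)) = \<theta> (quat_of 1)" "\<theta> (fst (y \<otimes>\<^bsub>M\<^esub> at_p \<theta> (Up_rep j))) = \<theta> (quat_of 1)"
    by (simp_all add: D_fin_mult \<theta>_mult v y \<theta>_one)
  have "at_p \<theta> (Up_rep j) \<otimes>\<^bsub>M\<^esub> y = \<one>\<^bsub>M\<^esub>" "y \<otimes>\<^bsub>M\<^esub> at_p \<theta> (Up_rep j) = \<one>\<^bsub>M\<^esub>"
    using 1[THEN \<theta>_inj] by (auto intro!: prod_eqI simp: D_fin_mult y_def)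
  then show ?thesis using M_inv by blast
qed

definition diag_in :: "rat quat \<Rightarrow> 'p padic quat \<times> 'p away_adele quat" where
  "diag_in \<delta> = (quat_map rat_in \<delta>, quat_map rat_in \<delta>)"

lemma diag_in_mult: "diag_in (quat_mult \<alpha> \<beta> x y) = diag_in x \<otimes>\<^bsub>M\<^esub> diag_in y"
  by (simp add: diag_in_def D_fin_mult quat_map_rat_in_mult int_units_padic int_units_away)

lemma diag_in_1: "diag_in (quat_of 1) = \<one>\<^bsub>M\<^esub>"
  by (simp add: diag_in_def quat_map_rat_in_1 int_units_padic int_units_away)

lemma \<Gamma>_eq: "\<Gamma> = diag_in ` Units (quat_alg \<alpha> \<beta>)"
  unfolding global_units_def diag_in_def ..

lemma \<Gamma>_mult: "\<delta> \<in> \<Gamma> \<Longrightarrow> \<epsilon> \<in> \<Gamma> \<Longrightarrow> \<delta> \<otimes>\<^bsub>M\<^esub> \<epsilon> \<in> \<Gamma>"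
  unfolding \<Gamma>_eq using Group.monoid.Units_m_closed[OF monoid_quat_alg, of _ \<alpha> \<beta>]
  by (auto simp: diag_in_mult[symmetric])

lemma \<Gamma>_one: "\<one>\<^bsub>M\<^esub> \<in> \<Gamma>"
  unfolding \<Gamma>_eq diag_in_1[symmetric] using Group.monoid.Units_one_closed[OF monoid_quat_alg, of \<alpha> \<beta>] by simp

lemma \<Gamma>_inv: assumes "\<delta> \<in> \<Gamma>" shows "\<delta> \<in> Units M" "inv\<^bsub>M\<^esub> \<delta> \<in> \<Gamma>"
proof -
  obtain d where d: "d \<in> Units (quat_alg \<alpha> \<beta>)" "\<delta> = diag_in d" using assms unfolding \<Gamma>_eq by blast
  then obtain e where e: "quat_mult \<alpha> \<beta> e d = quat_of 1" "quat_mult \<alpha> \<beta> d e = quat_of 1"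
    unfolding Units_def by auto
  then have "e \<in> Units (quat_alg \<alpha> \<beta>)"
    unfolding Units_def by (intro CollectI conjI bexI[of _ d]) simp_all
  moreover have "\<delta> \<in> Units M \<and> inv\<^bsub>M\<^esub> \<delta> = diag_in e"
    by (rule M_inv) (simp_all only: d(2) diag_in_mult[symmetric] e diag_in_1)
  ultimately show "\<delta> \<in> Units M" "inv\<^bsub>M\<^esub> \<delta> \<in> \<Gamma>" unfolding \<Gamma>_eq by auto
qed

lemma K_mult: "k \<in> K \<Longrightarrow> k' \<in> K \<Longrightarrow> quat_mult (rat_in \<alpha>) (rat_in \<beta>) k k' \<in> K"
  using subgroup.m_closed[OF K] by (simp add: units_of_mult)

lemma K_one: "quat_of 1 \<in> K"
  using subgroup.one_closed[OF K] by (simp add: units_of_one)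

lemma K_inv: assumes "k \<in> K"
  shows "\<exists>k'\<in>K. quat_mult (rat_in \<alpha>) (rat_in \<beta>) k k' = quat_of 1 \<and> quat_mult (rat_in \<alpha>) (rat_in \<beta>) k' k = quat_of 1"
proof -
  let ?A = "D_away \<alpha> \<beta> :: 'p away_adele quat ring"
  have k: "k \<in> Units ?A" using subgroup.subset[OF K] assms by (auto simp: units_of_carrier)
  have "inv\<^bsub>?A\<^esub> k \<in> K"
    using subgroup.m_inv_closed[OF K assms] Group.monoid.units_of_inv[OF monoid_quat_alg k] by simp
  then show ?thesis
    using Group.monoid.Units_l_inv[OF monoid_quat_alg k] Group.monoid.Units_r_inv[OF monoid_quat_alg k]
    by (intro bexI[of _ "inv\<^bsub>?A\<^esub> k"]) auto
qed

lemma level_eq: "at_p \<theta> u \<otimes>\<^bsub>M\<^esub> away_p k = (fst (at_p \<theta> u), k)"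
  by (simp add: D_fin_mult away_p_def)

lemma away_p_at_p: "away_p k \<otimes>\<^bsub>M\<^esub> at_p \<theta> u = at_p \<theta> u \<otimes>\<^bsub>M\<^esub> away_p k"
  by (simp add: D_fin_mult away_p_def)

lemma away_p_mult: "away_p (quat_mult (rat_in \<alpha>) (rat_in \<beta>) k k') = away_p k \<otimes>\<^bsub>M\<^esub> away_p k'"
  by (simp add: D_fin_mult away_p_def)

lemma away_p_1: "away_p (quat_of 1) = \<one>\<^bsub>M\<^esub>"
  by (simp add: away_p_def)

lemma away_p_inv: assumes "k \<in> K"
  shows "away_p k \<in> Units M" "\<exists>k'\<in>K. inv\<^bsub>M\<^esub> (away_p k) = away_p k'"
proof -
  obtain k' where k': "k' \<in> K" "quat_mult (rat_in \<alpha>) (rat_in \<beta>) k k' = quat_of 1"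
    "quat_mult (rat_in \<alpha>) (rat_in \<beta>) k' k = quat_of 1" using K_inv[OF assms] by blast
  have "away_p k \<in> Units M \<and> inv\<^bsub>M\<^esub> (away_p k) = away_p k'"
    by (rule M_inv) (simp_all only: away_p_mult[symmetric] k' away_p_1)
  then show "away_p k \<in> Units M" "\<exists>k'\<in>K. inv\<^bsub>M\<^esub> (away_p k) = away_p k'" using k'(1) by auto
qed

lemma Lv_iff: "l \<in> Lv \<longleftrightarrow> (\<exists>u\<in>iwahori. \<exists>k\<in>K. l = at_p \<theta> u \<otimes>\<^bsub>M\<^esub> away_p k)"
  unfolding level_group_def level_eq by blast

lemma Lv_mult: "l \<in> Lv \<Longrightarrow> l' \<in> Lv \<Longrightarrow> l \<otimes>\<^bsub>M\<^esub> l' \<in> Lv"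
proof -
  assume "l \<in> Lv" "l' \<in> Lv"
  then obtain u k u' k' where l: "u \<in> iwahori" "k \<in> K" "l = at_p \<theta> u \<otimes>\<^bsub>M\<^esub> away_p k"
    and l': "u' \<in> iwahori" "k' \<in> K" "l' = at_p \<theta> u' \<otimes>\<^bsub>M\<^esub> away_p k'" unfolding Lv_iff by blast
  have "l \<otimes>\<^bsub>M\<^esub> l' = at_p \<theta> u \<otimes>\<^bsub>M\<^esub> (away_p k \<otimes>\<^bsub>M\<^esub> at_p \<theta> u') \<otimes>\<^bsub>M\<^esub> away_p k'"
    unfolding l l' by (simp only: M_assoc)
  also have "\<dots> = at_p \<theta> (u * u') \<otimes>\<^bsub>M\<^esub> away_p (quat_mult (rat_in \<alpha>) (rat_in \<beta>) k k')"
    unfolding away_p_at_p away_p_mult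
    using l l' iwahori_subset_M1 by (subst at_p_mult) (auto simp only: M_assoc)
  finally show ?thesis unfolding Lv_iff using iwahori_mult[OF l(1) l'(1)] K_mult[OF l(2) l'(2)] by blast
qed

lemma Lv_inv: assumes "l \<in> Lv" shows "l \<in> Units M" "inv\<^bsub>M\<^esub> l \<in> Lv"
proof -
  obtain u k where l: "u \<in> iwahori" "k \<in> K" "l = at_p \<theta> u \<otimes>\<^bsub>M\<^esub> away_p k" using assms unfolding Lv_iff by blast
  show "l \<in> Units M" unfolding l(3) using at_p_iwahori(1)[OF l(1)] away_p_inv(1)[OF l(2)] by (rule M_Units_mult)
  obtain u' k' where l': "u' \<in> iwahori" "inv\<^bsub>M\<^esub> (at_p \<theta> u) = at_p \<theta> u'" "k' \<in> K" "inv\<^bsub>M\<^esub> (away_p k) = away_p k'"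
    using at_p_iwahori(2)[OF l(1)] away_p_inv(2)[OF l(2)] by blast
  have "inv\<^bsub>M\<^esub> l = inv\<^bsub>M\<^esub> (away_p k) \<otimes>\<^bsub>M\<^esub> inv\<^bsub>M\<^esub> (at_p \<theta> u)"
    unfolding l(3) by (rule M_inv_mult[OF at_p_iwahori(1)[OF l(1)] away_p_inv(1)[OF l(2)]])
  then show "inv\<^bsub>M\<^esub> l \<in> Lv" unfolding l' away_p_at_p Lv_iff using l' by blast
qed

section \<open>Unique decomposition with respect to the representatives\<close>

lemma decomp_exists:
  assumes "x \<in> Units M"
  obtains i \<delta> u k where "i < t" "\<delta> \<in> \<Gamma>" "u \<in> iwahori" "k \<in> K"
    "x = \<delta> \<otimes>\<^bsub>M\<^esub> \<gamma> i \<otimes>\<^bsub>M\<^esub> (at_p \<theta> u \<otimes>\<^bsub>M\<^esub> away_p k)"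
proof -
  obtain i \<delta> l where "i < t" "\<delta> \<in> \<Gamma>" "l \<in> Lv" "x = \<delta> \<otimes>\<^bsub>M\<^esub> \<gamma> i \<otimes>\<^bsub>M\<^esub> l"
    using assms unfolding cover double_coset_def by blast
  then show ?thesis using that unfolding Lv_iff by blast
qed

lemma neat_one:
  assumes "x \<in> Units M" "\<delta> \<in> \<Gamma>" "inv\<^bsub>M\<^esub> x \<otimes>\<^bsub>M\<^esub> \<delta> \<otimes>\<^bsub>M\<^esub> x \<in> Lv"
  shows "inv\<^bsub>M\<^esub> x \<otimes>\<^bsub>M\<^esub> \<delta> \<otimes>\<^bsub>M\<^esub> x = \<one>\<^bsub>M\<^esub>"
proof -
  have "{inv\<^bsub>M\<^esub> x \<otimes>\<^bsub>M\<^esub> \<delta> \<otimes>\<^bsub>M\<^esub> x | \<delta>. \<delta> \<in> \<Gamma>} \<inter> Lv = {\<one>\<^bsub>M\<^esub>}"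
    using neat assms(1) unfolding neat_def by (rule bspec)
  moreover have "inv\<^bsub>M\<^esub> x \<otimes>\<^bsub>M\<^esub> \<delta> \<otimes>\<^bsub>M\<^esub> x \<in> {inv\<^bsub>M\<^esub> x \<otimes>\<^bsub>M\<^esub> \<delta> \<otimes>\<^bsub>M\<^esub> x | \<delta>. \<delta> \<in> \<Gamma>} \<inter> Lv"
    using assms(2,3) by blast
  ultimately show ?thesis by (simp only: singleton_iff)
qed

text \<open>Disjointness of the double cosets fixes the index. The quotient of the level components
  is then conjugate to a global unit by the representative and lies in the level group, so neatness
  makes it trivial.\<close>

lemma decomp_unique:
  assumes "i < t" "\<delta> \<in> \<Gamma>" "l \<in> Lv" "j < t" "\<epsilon> \<in> \<Gamma>" "l' \<in> Lv"
    and eq: "\<delta> \<otimes>\<^bsub>M\<^esub> \<gamma> i \<otimes>\<^bsub>M\<^esub> l = \<epsilon> \<otimes>\<^bsub>M\<^esub> \<gamma> j \<otimes>\<^bsub>M\<^esub> l'"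
  shows "i = j" "l = l'"
proof -
  have "\<delta> \<otimes>\<^bsub>M\<^esub> \<gamma> i \<otimes>\<^bsub>M\<^esub> l \<in> double_coset \<alpha> \<beta> \<theta> K (\<gamma> i)"
    "\<epsilon> \<otimes>\<^bsub>M\<^esub> \<gamma> j \<otimes>\<^bsub>M\<^esub> l' \<in> double_coset \<alpha> \<beta> \<theta> K (\<gamma> j)"
    using assms unfolding double_coset_def by blast+
  then show ij: "i = j" using disj assms(1,4) eq unfolding disjoint_family_on_def by (metis IntI empty_iff lessThan_iff)
  let ?x = "\<gamma> i"
  have units: "\<delta> \<in> Units M" "\<epsilon> \<in> Units M" "?x \<in> Units M" "l \<in> Units M" "l' \<in> Units M"
    using assms(1-6) \<Gamma>_inv(1) Lv_inv(1) \<gamma>_units by auto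
  have conj: "inv\<^bsub>M\<^esub> ?x \<otimes>\<^bsub>M\<^esub> (inv\<^bsub>M\<^esub> \<epsilon> \<otimes>\<^bsub>M\<^esub> \<delta>) \<otimes>\<^bsub>M\<^esub> ?x = l' \<otimes>\<^bsub>M\<^esub> inv\<^bsub>M\<^esub> l"
    by (rule monoid.conj_of_eq[OF monoid_M units]) (use eq in \<open>simp only: ij\<close>)
  have "inv\<^bsub>M\<^esub> \<epsilon> \<otimes>\<^bsub>M\<^esub> \<delta> \<in> \<Gamma>" by (rule \<Gamma>_mult[OF \<Gamma>_inv(2)[OF assms(5)] assms(2)])
  moreover have "l' \<otimes>\<^bsub>M\<^esub> inv\<^bsub>M\<^esub> l \<in> Lv" by (rule Lv_mult[OF assms(6) Lv_inv(2)[OF assms(3)]])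
  ultimately have "l' \<otimes>\<^bsub>M\<^esub> inv\<^bsub>M\<^esub> l = \<one>\<^bsub>M\<^esub>"
    using neat_one[OF units(3)] unfolding conj[symmetric] by blast
  then have "l' \<otimes>\<^bsub>M\<^esub> inv\<^bsub>M\<^esub> l \<otimes>\<^bsub>M\<^esub> l = l" by (simp del: D_fin_simps)
  moreover have "inv\<^bsub>M\<^esub> l \<otimes>\<^bsub>M\<^esub> l = \<one>\<^bsub>M\<^esub>" using Group.monoid.Units_l_inv[OF monoid_M units(4)] .
  ultimately show "l = l'" by (simp add: M_assoc del: D_fin_simps)
qed

section \<open>Forms as tuples of continuous functions\<close>

lemma forms_value:
  assumes "\<phi> \<in> forms \<alpha> \<beta> \<theta> K" "i < t" "\<delta> \<in> \<Gamma>" "u \<in> iwahori" "k \<in> K"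
  shows "\<phi> (\<delta> \<otimes>\<^bsub>M\<^esub> \<gamma> i \<otimes>\<^bsub>M\<^esub> (at_p \<theta> u \<otimes>\<^bsub>M\<^esub> away_p k)) = slash (\<phi> (\<gamma> i)) u"
proof -
  have u: "\<gamma> i \<in> Units M" "at_p \<theta> u \<in> Units M" "\<delta> \<in> Units M" using \<gamma>_units assms at_p_iwahori(1) \<Gamma>_inv by auto
  have "\<delta> \<otimes>\<^bsub>M\<^esub> \<gamma> i \<otimes>\<^bsub>M\<^esub> (at_p \<theta> u \<otimes>\<^bsub>M\<^esub> away_p k) = \<delta> \<otimes>\<^bsub>M\<^esub> (\<gamma> i \<otimes>\<^bsub>M\<^esub> at_p \<theta> u) \<otimes>\<^bsub>M\<^esub> away_p k"
    by (simp only: M_assoc)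
  also have "\<phi> \<dots> = \<phi> (\<delta> \<otimes>\<^bsub>M\<^esub> (\<gamma> i \<otimes>\<^bsub>M\<^esub> at_p \<theta> u))"
    using assms(1,5) M_Units_mult[OF u(3) M_Units_mult[OF u(1,2)]] unfolding forms_def by blast
  also have "\<dots> = \<phi> (\<gamma> i \<otimes>\<^bsub>M\<^esub> at_p \<theta> u)"
    using assms(1,3) M_Units_mult[OF u(1,2)] unfolding forms_def by blast
  also have "\<dots> = slash (\<phi> (\<gamma> i)) u"
    using assms(1,4) u(1) unfolding forms_def by blast
  finally show ?thesis .
qed

lemma forms_eqI:
  assumes "\<phi> \<in> forms \<alpha> \<beta> \<theta> K" "\<psi> \<in> forms \<alpha> \<beta> \<theta> K" "\<And>i. i < t \<Longrightarrow> \<phi> (\<gamma> i) = \<psi> (\<gamma> i)"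
  shows "\<phi> = \<psi>"
proof
  fix x
  show "\<phi> x = \<psi> x"
  proof (cases "x \<in> Units M")
    case True
    then obtain i \<delta> u k where x: "i < t" "\<delta> \<in> \<Gamma>" "u \<in> iwahori" "k \<in> K"
      "x = \<delta> \<otimes>\<^bsub>M\<^esub> \<gamma> i \<otimes>\<^bsub>M\<^esub> (at_p \<theta> u \<otimes>\<^bsub>M\<^esub> away_p k)" by (rule decomp_exists)
    show ?thesis unfolding x(5) using forms_value[OF assms(1) x(1-4)] forms_value[OF assms(2) x(1-4)] assms(3) x(1) by simp
  next
    case False
    then show ?thesis using assms(1,2) unfolding forms_def by (auto dest!: PiE_arb)
  qed
qed

text \<open>The invariance properties force the value at \<delta> \<gamma>_i u k to be h_i acted on
  by u. By \<open>decomp_unique\<close> this does not depend on the decomposition, and equivariance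
  under the Iwahori group is the cocycle rule \<open>slash_slash\<close>.\<close>

lemma form_exists:
  assumes "\<And>i. i < t \<Longrightarrow> continuous_on UNIV (h i)"
  shows "\<exists>\<phi>\<in>forms \<alpha> \<beta> \<theta> K. \<forall>i<t. \<phi> (\<gamma> i) = h i"
proof -
  define val where "val x f \<longleftrightarrow> (\<exists>i<t. \<exists>\<delta>\<in>\<Gamma>. \<exists>u\<in>iwahori. \<exists>k\<in>K.
    x = \<delta> \<otimes>\<^bsub>M\<^esub> \<gamma> i \<otimes>\<^bsub>M\<^esub> (at_p \<theta> u \<otimes>\<^bsub>M\<^esub> away_p k) \<and> f = slash (h i) u)" for x f
  have unique: "f = f'" if ff: "val x f" "val x f'" for x f f'
  proof -
    obtain i \<delta> u k where x: "i < t" "\<delta> \<in> \<Gamma>" "u \<in> iwahori" "k \<in> K"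
      "x = \<delta> \<otimes>\<^bsub>M\<^esub> \<gamma> i \<otimes>\<^bsub>M\<^esub> (at_p \<theta> u \<otimes>\<^bsub>M\<^esub> away_p k)" "f = slash (h i) u" using ff(1) unfolding val_def by blast
    obtain i' \<delta>' u' k' where x': "i' < t" "\<delta>' \<in> \<Gamma>" "u' \<in> iwahori" "k' \<in> K"
      "x = \<delta>' \<otimes>\<^bsub>M\<^esub> \<gamma> i' \<otimes>\<^bsub>M\<^esub> (at_p \<theta> u' \<otimes>\<^bsub>M\<^esub> away_p k')" "f' = slash (h i') u'" using ff(2) unfolding val_def by blast
    have L: "at_p \<theta> u \<otimes>\<^bsub>M\<^esub> away_p k \<in> Lv" "at_p \<theta> u' \<otimes>\<^bsub>M\<^esub> away_p k' \<in> Lv"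
      unfolding Lv_iff using x x' by blast+
    have "i = i'" "at_p \<theta> u \<otimes>\<^bsub>M\<^esub> away_p k = at_p \<theta> u' \<otimes>\<^bsub>M\<^esub> away_p k'"
      using decomp_unique[OF x(1,2) L(1) x'(1,2) L(2)] x(5) x'(5) by simp_all
    then have "i = i'" "fst (at_p \<theta> u) = fst (at_p \<theta> u')" unfolding level_eq by auto
    moreover have "u \<in> carrier_mat 2 2" "u' \<in> carrier_mat 2 2"
      using x(3) x'(3) iwahori_subset_M1 M1_carrier by auto
    ultimately show ?thesis using at_p_inject x(6) x'(6) by blast
  qed
  have ex: "\<exists>f. val x f" if xU: "x \<in> Units M" for x
  proof -
    obtain i \<delta> u k where "i < t" "\<delta> \<in> \<Gamma>" "u \<in> iwahori" "k \<in> K"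
      "x = \<delta> \<otimes>\<^bsub>M\<^esub> \<gamma> i \<otimes>\<^bsub>M\<^esub> (at_p \<theta> u \<otimes>\<^bsub>M\<^esub> away_p k)" using xU by (rule decomp_exists)
    then have "val x (slash (h i) u)" unfolding val_def by blast
    then show ?thesis by blast
  qed
  \<comment> \<open>Outside the units the value must be \<open>undefined\<close>, because
    \<open>forms\<close> consists of extensional functions.\<close>
  define \<phi> where "\<phi> x = (if x \<in> Units M then SOME f. val x f else undefined)" for x
  have \<phi>: "val x (\<phi> x)" if "x \<in> Units M" for x
    using someI_ex[OF ex[OF that]] that by (simp add: \<phi>_def)
  have \<phi>_eq: "\<phi> x = f" if "x \<in> Units M" "val x f" for x f
    using unique[OF \<phi>[OF that(1)] that(2)] .
  have cont: "continuous_on UNIV (\<phi> x)" if x: "x \<in> Units M" for x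
  proof -
    obtain i u where "i < t" "u \<in> iwahori" and eq: "\<phi> x = slash (h i) u"
      using \<phi>[OF x] unfolding val_def by blast
    then show ?thesis unfolding eq using iwahori_subset_M1 by (intro continuous_slash assms) auto
  qed
  have "\<phi> \<in> forms \<alpha> \<beta> \<theta> K"
    unfolding forms_def mem_Collect_eq
  proof (intro conjI ballI PiE_I)
    fix x assume x: "x \<in> Units M"
    obtain i \<epsilon> u k where d: "i < t" "\<epsilon> \<in> \<Gamma>" "u \<in> iwahori" "k \<in> K"
      "x = \<epsilon> \<otimes>\<^bsub>M\<^esub> \<gamma> i \<otimes>\<^bsub>M\<^esub> (at_p \<theta> u \<otimes>\<^bsub>M\<^esub> away_p k)" "\<phi> x = slash (h i) u" using \<phi>[OF x] unfolding val_def by blast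
    show "\<phi> x \<in> {h. continuous_on UNIV h}" using cont[OF x] by simp
    {
      fix \<delta> assume \<delta>: "\<delta> \<in> \<Gamma>"
      have "\<delta> \<otimes>\<^bsub>M\<^esub> x = (\<delta> \<otimes>\<^bsub>M\<^esub> \<epsilon>) \<otimes>\<^bsub>M\<^esub> \<gamma> i \<otimes>\<^bsub>M\<^esub> (at_p \<theta> u \<otimes>\<^bsub>M\<^esub> away_p k)"
        unfolding d(5) by (simp only: M_assoc)
      then have "val (\<delta> \<otimes>\<^bsub>M\<^esub> x) (\<phi> x)" unfolding val_def using d \<Gamma>_mult[OF \<delta> d(2)] by blast
      then show "\<phi> (\<delta> \<otimes>\<^bsub>M\<^esub> x) = \<phi> x" using M_Units_mult[OF \<Gamma>_inv(1)[OF \<delta>] x] by (intro \<phi>_eq)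
    next
      fix k' assume k': "k' \<in> K"
      have "x \<otimes>\<^bsub>M\<^esub> away_p k' = \<epsilon> \<otimes>\<^bsub>M\<^esub> \<gamma> i \<otimes>\<^bsub>M\<^esub> (at_p \<theta> u \<otimes>\<^bsub>M\<^esub> away_p (quat_mult (rat_in \<alpha>) (rat_in \<beta>) k k'))"
        unfolding d(5) away_p_mult by (simp only: M_assoc)
      then have "val (x \<otimes>\<^bsub>M\<^esub> away_p k') (\<phi> x)" unfolding val_def using d K_mult[OF d(4) k'] by blast
      then show "\<phi> (x \<otimes>\<^bsub>M\<^esub> away_p k') = \<phi> x" using M_Units_mult[OF x away_p_inv(1)[OF k']] by (intro \<phi>_eq)
    next
      fix u' :: "'p padic_int mat" assume u': "u' \<in> iwahori"
      have M1: "u \<in> M1" "u' \<in> M1" using u' d iwahori_subset_M1 by auto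
      have "x \<otimes>\<^bsub>M\<^esub> at_p \<theta> u' = \<epsilon> \<otimes>\<^bsub>M\<^esub> \<gamma> i \<otimes>\<^bsub>M\<^esub> (at_p \<theta> u \<otimes>\<^bsub>M\<^esub> (away_p k \<otimes>\<^bsub>M\<^esub> at_p \<theta> u'))"
        unfolding d(5) by (simp only: M_assoc)
      also have "\<dots> = \<epsilon> \<otimes>\<^bsub>M\<^esub> \<gamma> i \<otimes>\<^bsub>M\<^esub> (at_p \<theta> (u * u') \<otimes>\<^bsub>M\<^esub> away_p k)"
        unfolding away_p_at_p at_p_mult[OF M1] by (simp only: M_assoc)
      finally have "val (x \<otimes>\<^bsub>M\<^esub> at_p \<theta> u') (slash (h i) (u * u'))"
        unfolding val_def using d iwahori_mult[OF d(3) u'] by blast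
      then show "\<phi> (x \<otimes>\<^bsub>M\<^esub> at_p \<theta> u') = slash (\<phi> x) u'"
        unfolding d(6) slash_slash[OF M1] using M_Units_mult[OF x at_p_iwahori(1)[OF u']] by (intro \<phi>_eq)
    }
  next
    fix x assume "x \<notin> Units M" then show "\<phi> x = undefined" by (simp add: \<phi>_def)
  qed
  moreover have "\<phi> (\<gamma> i) = h i" if "i < t" for i
  proof (rule \<phi>_eq[OF \<gamma>_units[OF that]])
    have "\<gamma> i = \<one>\<^bsub>M\<^esub> \<otimes>\<^bsub>M\<^esub> \<gamma> i \<otimes>\<^bsub>M\<^esub> (at_p \<theta> (1\<^sub>m 2) \<otimes>\<^bsub>M\<^esub> away_p (quat_of 1))"
      unfolding at_p_1 away_p_1 by (simp del: D_fin_simps)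
    then show "val (\<gamma> i) (h i)"
      unfolding val_def using that \<Gamma>_one iwahori_1 K_one slash_1[of "h i"] by metis
  qed
  ultimately show ?thesis by blast
qed

lemma basis_form:
  "basis_form \<alpha> \<beta> \<theta> K t \<gamma> n \<in> forms \<alpha> \<beta> \<theta> K \<and>
    (\<forall>j<t. basis_form \<alpha> \<beta> \<theta> K t \<gamma> n (\<gamma> j) = basis_value t n j)"
proof -
  have "\<exists>!\<phi>. \<phi> \<in> forms \<alpha> \<beta> \<theta> K \<and> (\<forall>j<t. \<phi> (\<gamma> j) = basis_value t n j)"
  proof (rule ex_ex1I)
    show "\<exists>\<phi>. \<phi> \<in> forms \<alpha> \<beta> \<theta> K \<and> (\<forall>j<t. \<phi> (\<gamma> j) = basis_value t n j)"
      using form_exists[of "basis_value t n"] continuous_basis_value by blast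
  qed (auto intro: forms_eqI)
  then show ?thesis unfolding basis_form_def by (rule theI')
qed

text \<open>The Iwahori component u of \<gamma>_i v_j^(-1) combines with v_j into u v_j. Its first
  column is (a p + b j q, c p + d j q), which gives the divisibilities by p and q, and its second
  column is that of u. The summand l depends on j, since \<gamma>_i v_j^(-1) may lie in any of the
  double cosets.\<close>

lemma Up_basis_form:
  assumes "i < t"
  obtains l a b c d where
    "Up \<alpha> \<beta> \<theta> (basis_form \<alpha> \<beta> \<theta> K t \<gamma> n) (\<gamma> i)
      = (\<lambda>z. \<Sum>j<CARD('p). slash (basis_value t n (l j)) (mat2 (a j) (b j) (c j) (d j)) z)"
    "\<And>j. of_nat (CARD('p)) dvd a j" "\<And>j. of_nat (lev TYPE('p)) dvd c j" "\<And>j. d j dvd 1"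
proof -
  define \<phi> where "\<phi> = basis_form \<alpha> \<beta> \<theta> K t \<gamma> n"
  have \<phi>: "\<phi> \<in> forms \<alpha> \<beta> \<theta> K" "\<And>j. j < t \<Longrightarrow> \<phi> (\<gamma> j) = basis_value t n j"
    using basis_form unfolding \<phi>_def by blast+
  have "\<exists>l a b c d. slash (\<phi> (\<gamma> i \<otimes>\<^bsub>M\<^esub> inv\<^bsub>M\<^esub> (at_p \<theta> (Up_rep j)))) (Up_rep j)
      = slash (basis_value t n l) (mat2 a b c d) \<and>
    of_nat (CARD('p)) dvd a \<and> of_nat (lev TYPE('p)) dvd c \<and> d dvd 1" for j
  proof -
    have "\<gamma> i \<otimes>\<^bsub>M\<^esub> inv\<^bsub>M\<^esub> (at_p \<theta> (Up_rep j)) \<in> Units M"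
      using M_Units_mult \<gamma>_units[OF assms] M_Units_inv at_p_Up_rep by blast
    then obtain l \<delta> u k where x: "l < t" "\<delta> \<in> \<Gamma>" "u \<in> iwahori" "k \<in> K"
      "\<gamma> i \<otimes>\<^bsub>M\<^esub> inv\<^bsub>M\<^esub> (at_p \<theta> (Up_rep j)) = \<delta> \<otimes>\<^bsub>M\<^esub> \<gamma> l \<otimes>\<^bsub>M\<^esub> (at_p \<theta> u \<otimes>\<^bsub>M\<^esub> away_p k)"
      by (rule decomp_exists)
    have "slash (\<phi> (\<gamma> i \<otimes>\<^bsub>M\<^esub> inv\<^bsub>M\<^esub> (at_p \<theta> (Up_rep j)))) (Up_rep j) = slash (slash (basis_value t n l) u) (Up_rep j)"
      unfolding x(5) forms_value[OF \<phi>(1) x(1-4)] \<phi>(2)[OF x(1)] ..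
    also have "\<dots> = slash (basis_value t n l) (u * Up_rep j)"
      using x(3) iwahori_subset_M1 by (intro slash_slash Up_rep_M1) auto
    finally have eq: "slash (\<phi> (\<gamma> i \<otimes>\<^bsub>M\<^esub> inv\<^bsub>M\<^esub> (at_p \<theta> (Up_rep j)))) (Up_rep j)
      = slash (basis_value t n l) (u * Up_rep j)" .
    obtain a b c d where u: "u = mat2 a b c d" "a dvd 1" "of_nat (lev TYPE('p)) dvd c" "d dvd 1"
      using x(3) unfolding iwahori_def by blast
    let ?p = "of_nat (CARD('p)) :: 'p padic_int" and ?c = "of_nat (j * lev TYPE('p)) :: 'p padic_int"
    have "u * Up_rep j = mat2 (a * ?p + b * ?c) b (c * ?p + d * ?c) d"
      unfolding u(1) Up_rep_def mat2_mult by simp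
    moreover have "?p dvd ?c" using lev_dvd[where 'p='p] by simp
    moreover have "of_nat (lev TYPE('p)) dvd c * ?p + d * ?c" using u(3) by simp
    ultimately show ?thesis using eq u(4) by (metis dvd_add dvd_mult dvd_refl)
  qed
  then obtain l a b c d where *: "\<And>j. slash (\<phi> (\<gamma> i \<otimes>\<^bsub>M\<^esub> inv\<^bsub>M\<^esub> (at_p \<theta> (Up_rep j)))) (Up_rep j)
      = slash (basis_value t n (l j)) (mat2 (a j) (b j) (c j) (d j))"
    "\<And>j. of_nat (CARD('p)) dvd a j" "\<And>j. of_nat (lev TYPE('p)) dvd c j" "\<And>j. d j dvd 1"
    by metis
  have "Up \<alpha> \<beta> \<theta> \<phi> (\<gamma> i)
      = (\<lambda>z. \<Sum>j<CARD('p). slash (basis_value t n (l j)) (mat2 (a j) (b j) (c j) (d j)) z)"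
    unfolding Up_def using \<gamma>_units[OF assms] by (simp add: *(1))
  then show ?thesis using that *(2-4) unfolding \<phi>_def by blast
qed

lemma t_pos: "t > 0"
proof (rule ccontr)
  assume "\<not> ?thesis"
  then have "Units M = {}" using cover by simp
  then show False using Group.monoid.Units_one_closed[OF monoid_M] by blast
qed

text \<open>The degrees of the row and column functions are m div t and n div t. For fixed n the
  bound on the differences also tends to infinity with their order, which is the convergence that
  \<open>coords_eq\<close> asks for.\<close>

lemma Up_matrix_mI: "Up_matrix \<alpha> \<beta> \<theta> K t \<gamma> m n \<in> mI (m div t - n div t div CARD('p))"
proof -
  define \<psi> where "\<psi> = Up \<alpha> \<beta> \<theta> (basis_form \<alpha> \<beta> \<theta> K t \<gamma> n)"
  have *: "continuous_on UNIV (\<psi> (\<gamma> i)) \<and>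
      (\<forall>k. (dif ^^ k) (\<lambda>z. \<psi> (\<gamma> i) (of_nat z)) 0 \<in> mI (k - n div t div CARD('p)))" if i: "i < t" for i
  proof -
    obtain l a b c d where eq: "\<psi> (\<gamma> i)
        = (\<lambda>z. \<Sum>j<CARD('p). slash (basis_value t n (l j)) (mat2 (a j) (b j) (c j) (d j)) z)"
      and d: "\<And>j. of_nat (CARD('p)) dvd a j" "\<And>j. of_nat (lev TYPE('p)) dvd c j" "\<And>j. d j dvd 1"
      using Up_basis_form[OF i, of n] unfolding \<psi>_def by blast
    have "mat2 (a j) (b j) (c j) (d j) \<in> M1" for j unfolding M1_def using d by blast
    then have "continuous_on UNIV (\<psi> (\<gamma> i))"
      unfolding eq by (intro continuous_padic_sum continuous_slash continuous_basis_value)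
    moreover have "(dif ^^ k) (\<lambda>z. \<psi> (\<gamma> i) (of_nat z)) 0 \<in> mI (k - n div t div CARD('p))" for k
      unfolding eq dif_power_sum by (intro ideal_pow_sum dif_slash_basis_value d)
    ultimately show ?thesis by blast
  qed
  have "coords t \<gamma> \<psi> m = (dif ^^ (m div t)) (\<lambda>z. \<psi> (\<gamma> (m mod t)) (of_nat z)) 0"
  proof (rule coords_eq[OF t_pos])
    fix i assume "i < t"
    then show "continuous_on UNIV (\<psi> (\<gamma> i))" using * by blast
    fix N
    have "(dif ^^ k) (\<lambda>z. \<psi> (\<gamma> i) (of_nat z)) 0 \<in> mI N" if k: "k \<ge> N + n div t div CARD('p)" for k
    proof (rule mI_le)
      show "(dif ^^ k) (\<lambda>z. \<psi> (\<gamma> i) (of_nat z)) 0 \<in> mI (k - n div t div CARD('p))"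
        using * \<open>i < t\<close> by blast
    qed (use k in simp)
    then show "\<exists>K. \<forall>k\<ge>K. (dif ^^ k) (\<lambda>z. \<psi> (\<gamma> i) (of_nat z)) 0 \<in> mI N" by blast
  qed
  then show ?thesis unfolding Up_matrix_def \<psi>_def[symmetric] using * t_pos by simp
qed

end

lemma hodge_matrix_floor:
  fixes P :: "nat \<Rightarrow> nat \<Rightarrow> 'p::prime_card iwasawa"
  assumes "t > 0" "\<And>i j. P i j \<in> mI (i div t - j div t div CARD('p))"
  shows "hodge_matrix P (\<lambda>i. i div t) (\<lambda>i. i div t div CARD('p))"
proof
  \<comment> \<open>When x grows by 1, x div p grows by at most 1.\<close>
  have "mono (\<lambda>x. x - x div CARD('p))"
    unfolding mono_iff_le_Suc by (auto simp: div_Suc)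
  then show "mono (\<lambda>i. i div t - i div t div CARD('p))"
    by (intro monoI) (meson monoD div_le_mono)
  show "\<exists>i. n \<le> i div t - i div t div CARD('p)" for n
  \<comment> \<open>This index has degree 2 n, and at most half of it is lost because p >=
    2.\<close>
  proof (rule exI[of _ "t * (2 * n)"])
    have "2 * n div CARD('p) \<le> 2 * n div 2" using prm_gt_1[where 'p='p] by (intro div_le_mono2) auto
    then show "n \<le> t * (2 * n) div t - t * (2 * n) div t div CARD('p)" using assms(1) by simp
  qed
qed (use assms(2) in auto)

theorem theorem3p16:
  fixes \<alpha> \<beta> :: rat
    and \<theta> :: "'p::prime_card padic quat \<Rightarrow> 'p padic mat"
    and K :: "'p away_adele quat set"
    and t :: nat
    and \<gamma> :: "nat \<Rightarrow> 'p padic quat \<times> 'p away_adele quat"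
    and P :: "nat \<Rightarrow> nat \<Rightarrow> 'p iwasawa"
    and lam :: "nat \<Rightarrow> nat"
  assumes "definite_quat \<alpha> \<beta>"
    and "splitting \<alpha> \<beta> \<theta>"
    and "open_compact_subgroup (D_away \<alpha> \<beta>) K"
    and "neat \<alpha> \<beta> \<theta> K"
    and "t = card (double_coset \<alpha> \<beta> \<theta> K ` Units (D_fin \<alpha> \<beta>))"
    and "\<And>i. i < t \<Longrightarrow> \<gamma> i \<in> Units (D_fin \<alpha> \<beta>) \<and> fst (\<gamma> i) = quat_of 1"
    and "disjoint_family_on (\<lambda>i. double_coset \<alpha> \<beta> \<theta> K (\<gamma> i)) {..<t}"
    and "Units (D_fin \<alpha> \<beta>) = (\<Union>i<t. double_coset \<alpha> \<beta> \<theta> K (\<gamma> i))"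
    and "P = Up_matrix \<alpha> \<beta> \<theta> K t \<gamma>"
    and "lam 0 = 0"
    and "\<And>i. int (lam (Suc i)) - int (lam i) =
        \<lfloor>real i / real t\<rfloor> - \<lfloor>real i / (real CARD('p) * real t)\<rfloor>"
  shows "(\<exists>!C. iw_fps_limit (char_trunc P) C) \<and>
    (\<forall>n. iw_annulus_of (fps_nth (char_series P) n) \<in> {iw_annulus_of iw_T ^ lam n * y | y. True})"
proof -
  interpret quat_setup \<alpha> \<beta> \<theta> K t \<gamma>
  proof (rule quat_setup.intro)
    show "subgroup K (units_of (D_away \<alpha> \<beta>))"
      using assms(3) unfolding open_compact_subgroup_def by (rule conjunct1)
    show "\<gamma> i \<in> Units (D_fin \<alpha> \<beta>)" if "i < t" for i using assms(6)[OF that] by (rule conjunct1)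
  qed (rule assms)+
  interpret hodge_matrix P "\<lambda>i. i div t" "\<lambda>i. i div t div CARD('p)"
    unfolding assms(9) by (rule hodge_matrix_floor[OF t_pos Up_matrix_mI])
  have "lam n = (\<Sum>i<n. g i)" for n
  proof (induction n)
    case (Suc n)
    \<comment> \<open>The floor of n / (p t) is the iterated quotient n div t div p, so the
      increments of \<open>lam\<close> are the diagonal exponents \<open>g\<close>.\<close>
    have "\<lfloor>real n / (real CARD('p) * real t)\<rfloor> = int (n div (CARD('p) * t))"
      unfolding of_nat_mult[symmetric] by (rule floor_divide_of_nat_eq)
    also have "n div (CARD('p) * t) = n div t div CARD('p)" by (simp add: div_mult2_eq mult.commute)
    finally have "int (lam (Suc n)) = int (lam n) + int (g n)"
      using assms(11)[of n] by (simp add: floor_divide_of_nat_eq g_def of_nat_diff)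
    then have "lam (Suc n) = lam n + g n" by linarith
    then show ?case using Suc by simp
  qed (simp add: assms(10))
  then have "\<exists>y. iw_annulus_of (fps_nth (char_series P) n) = iw_annulus_of iw_T ^ lam n * y" for n
    using iw_annulus_of_mI[OF char_series_mI[of n]] by simp
  then show ?thesis using ex1_char_series by auto
qed

end
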